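(* Let $s\in(0,1]$ and $p\in[1,+\infty]$ be such that $sp>N$. Let $\widetilde s,\widetilde p$ satisfy $$\text{either}\quad\begin{cases}0\le\widetilde s\le\dfrac{sp-N}{p},\\ p\le\widetilde p\le+\infty,\end{cases}\qquad\text{or}\qquad\begin{cases}\dfrac{sp-N}{p}<\widetilde s\le s,\\ p\le\widetilde p\le\dfrac{Np}{N-(s-\widetilde s)p}.\end{cases}$$ Then there exists a positive constant $C=C(N,s,p,\widetilde s,\widetilde p)$ such that, for any $u\in W^{s,p}(\mathbb{R}^N)$, $$\|u\|_{W^{\widetilde s,\widetilde p}(\mathbb{R}^N)}\le C\,\|u\|_{W^{s,p}(\mathbb{R}^N)},$$ namely, the space $W^{s,p}(\mathbb{R}^N)$ is continuously embedded in $W^{\widetilde s,\widetilde p}(\mathbb{R}^N)$. Moreover, the curve $\gamma$ defined for $\theta\in[0,1]$ as $$\gamma(\theta):=(s_\theta,p_\theta)=\left(\theta\widetilde s+(1-\theta)s,\ \frac{p\,\widetilde p}{\widetilde p+\theta(p-\widetilde p)}\right)$$ is such that, if $0\le\theta_1\le\theta_2\le1$, then the space $W^{s_{\theta_1},p_{\theta_1}}(\mathbb{R}^N)$ is continuously embedded in $W^{s_{\theta_2},p_{\theta_2}}(\mathbb{R}^N)$.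
   Context: $N\ge1$ is an integer and functions are real-valued and measurable. Let $\Omega$ be either $\mathbb{R}^N$ or an open bounded subset of $\mathbb{R}^N$ with Lipschitz boundary. For $s\in[0,1]$ and $p\in[1,+\infty)$ define $[u]_{W^{0,p}(\Omega)}:=\|u\|_{L^p(\Omega)}$, $[u]_{W^{1,p}(\Omega)}:=\|\nabla u\|_{L^p(\Omega)}$ (weak gradient) and, for $s\in(0,1)$, $$[u]_{W^{s,p}(\Omega)}:=\left(c_{N,s,p}\iint_{\Omega\times\Omega}\frac{|u(x)-u(y)|^p}{|x-y|^{N+sp}}\,dx\,dy\right)^{1/p},\qquad c_{N,s,p}:=\frac{s\,2^{2s-1}\,\Gamma\left(\frac{ps+p+N-2}{2}\right)}{\pi^{N/2}\,\Gamma(1-s)}.$$ Set $W^{s,p}(\Omega):=\{u\in L^p(\Omega):[u]_{W^{s,p}(\Omega)}<+\infty\}$, with norm $\|u\|_{W^{0,p}(\Omega)}:=\|u\|_{L^p(\Omega)}$ if $s=0$ and $\|u\|_{W^{s,p}(\Omega)}:=\big([u]^p_{W^{s,p}(\Omega)}+\|u\|^p_{L^p(\Omega)}\big)^{1/p}$ if $s\in(0,1]$. For $p=+\infty$: $W^{0,\infty}(\Omega):=L^\infty(\Omega)$ and, for $s\in(0,1]$, $W^{s,\infty}(\Omega):=C^{0,s}(\Omega)$ with norm $\|u\|_{L^\infty(\Omega)}+\sup_{x\neq y\in\Omega}\frac{|u(x)-u(y)|}{|x-y|^s}$ (functions being identified up to a.e. equality). Conventions for infinite exponents: $\frac{sp-N}{p}$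 means $s-\frac Np$ with $\frac N\infty=0$ (so if $p=+\infty$ it equals $s$, the condition $sp>N$ holds, and the second alternative is empty); and $p_\theta$ is given by $\frac1{p_\theta}=\frac{1-\theta}{p}+\frac{\theta}{\widetilde p}$ with $\frac1\infty=0$, $\frac10=+\infty$. *)

theory Defs
  imports "HOL-Probability.Essential_Supremum"
begin

text \<open>
  All function spaces are defined over an open set \<open>\<Omega>\<close> of a Euclidean space \<open>'a\<close> of dimension
  \<open>DIM('a)\<close>. Functions are total functions on \<open>'a\<close>, of which only the values on \<open>\<Omega>\<close> matter.
  Norms and seminorms take values in \<open>[0, \<infinity>]\<close>. An integrability exponent is an extended real in
  \<open>[1, \<infinity>]\<close>; \<open>real_of_ereal p\<close> is used only when \<open>p\<close> is finite.
\<close>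

text \<open>The library has no real powers on \<open>[0, \<infinity>]\<close>; only exponents \<open>a > 0\<close> are used.\<close>

definition ennpow :: "ennreal \<Rightarrow> real \<Rightarrow> ennreal" where
  "ennpow x a = (if x = \<infinity> then \<infinity> else ennreal (enn2real x powr a))"

subsection \<open>Lebesgue spaces\<close>

definition Lp_norm ::
  "'a::euclidean_space set \<Rightarrow> ereal \<Rightarrow> ('a \<Rightarrow> 'b::euclidean_space) \<Rightarrow> ennreal" where
  "Lp_norm \<Omega> p f =
     (if p = \<infinity> then esssup (lebesgue_on \<Omega>) (\<lambda>x. ennreal (norm (f x)))
      else ennpow (\<integral>\<^sup>+x. ennreal (norm (f x) powr real_of_ereal p) \<partial>lebesgue_on \<Omega>)
             (1 / real_of_ereal p))"

definition Lp_space :: "'a::euclidean_space set \<Rightarrow> ereal \<Rightarrow> ('a \<Rightarrow> real) set" where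
  "Lp_space \<Omega> p = {u \<in> borel_measurable (lebesgue_on \<Omega>). Lp_norm \<Omega> p u < \<infinity>}"

subsection \<open>Weak gradient\<close>

primrec Ck :: "nat \<Rightarrow> ('a::euclidean_space \<Rightarrow> real) \<Rightarrow> bool" where
  "Ck 0 \<phi> \<longleftrightarrow> continuous_on UNIV \<phi>"
| "Ck (Suc k) \<phi> \<longleftrightarrow>
     (\<forall>x. \<phi> differentiable (at x)) \<and> (\<forall>v. Ck k (\<lambda>x. frechet_derivative \<phi> (at x) v))"

text \<open>The space \<open>C\<^sub>c\<^sup>\<infinity>(\<Omega>)\<close>, its elements being extended by zero to the whole space.\<close>

definition test_functions :: "'a::euclidean_space set \<Rightarrow> ('a \<Rightarrow> real) set" where
  "test_functions \<Omega> =
     {\<phi>. (\<forall>k. Ck k \<phi>) \<and> compact (closure {x. \<phi> x \<noteq> 0}) \<and> closure {x. \<phi> x \<noteq> 0} \<subseteq> \<Omega>}"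

definition locally_integrable ::
  "'a::euclidean_space set \<Rightarrow> ('a \<Rightarrow> 'b::euclidean_space) \<Rightarrow> bool" where
  "locally_integrable \<Omega> f \<longleftrightarrow> (\<forall>K. compact K \<and> K \<subseteq> \<Omega> \<longrightarrow> integrable (lebesgue_on K) f)"

definition has_weak_gradient ::
  "'a::euclidean_space set \<Rightarrow> ('a \<Rightarrow> real) \<Rightarrow> ('a \<Rightarrow> 'a) \<Rightarrow> bool" where
  "has_weak_gradient \<Omega> u g \<longleftrightarrow>
     locally_integrable \<Omega> u \<and> g \<in> borel_measurable (lebesgue_on \<Omega>) \<and> locally_integrable \<Omega> g \<and>
     (\<forall>\<phi> \<in> test_functions \<Omega>. \<forall>i \<in> Basis.
        (\<integral>x. u x * frechet_derivative \<phi> (at x) i \<partial>lebesgue_on \<Omega>) =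
        - (\<integral>x. (g x \<bullet> i) * \<phi> x \<partial>lebesgue_on \<Omega>))"

text \<open>
  For open \<open>\<Omega>\<close> a weak gradient is unique up to a null set, so its \<open>L\<^sup>p\<close> norm does not depend on
  the choice made here.
\<close>

definition weak_gradient :: "'a::euclidean_space set \<Rightarrow> ('a \<Rightarrow> real) \<Rightarrow> 'a \<Rightarrow> 'a" where
  "weak_gradient \<Omega> u = (SOME g. has_weak_gradient \<Omega> u g)"

subsection \<open>Fractional seminorm\<close>

text \<open>The normalising constant, with \<open>n\<close> the dimension of the space.\<close>

definition gagliardo_const :: "nat \<Rightarrow> real \<Rightarrow> real \<Rightarrow> real" where
  "gagliardo_const n s p =
     s * 2 powr (2 * s - 1) * Gamma ((p * s + p + real n - 2) / 2) /
     (pi powr (real n / 2) * Gamma (1 - s))"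

text \<open>On the diagonal, a null set, the quotient below is \<open>0 / 0 = 0\<close>.\<close>

definition gagliardo_seminorm ::
  "'a::euclidean_space set \<Rightarrow> real \<Rightarrow> real \<Rightarrow> ('a \<Rightarrow> real) \<Rightarrow> ennreal" where
  "gagliardo_seminorm \<Omega> s p u =
     ennpow (ennreal (gagliardo_const DIM('a) s p) *
             (\<integral>\<^sup>+(x, y). ennreal (\<bar>u x - u y\<bar> powr p / norm (x - y) powr (real DIM('a) + s * p))
                \<partial>(lebesgue_on \<Omega> \<Otimes>\<^sub>M lebesgue_on \<Omega>)))
       (1 / p)"

subsection \<open>Hoelder seminorm\<close>

definition holder_seminorm ::
  "'a::euclidean_space set \<Rightarrow> real \<Rightarrow> ('a \<Rightarrow> real) \<Rightarrow> ennreal" where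
  "holder_seminorm \<Omega> s v =
     (SUP (x, y) \<in> {(x, y). x \<in> \<Omega> \<and> y \<in> \<Omega> \<and> x \<noteq> y}.
        ennreal (\<bar>v x - v y\<bar> / norm (x - y) powr s))"

text \<open>
  Functions are identified up to a.e. equality, so a Hoelder function is one having a continuous
  representative with finite Hoelder seminorm. On open \<open>\<Omega>\<close> the continuous representative is unique.
\<close>

definition is_continuous_rep ::
  "'a::euclidean_space set \<Rightarrow> ('a \<Rightarrow> real) \<Rightarrow> ('a \<Rightarrow> real) \<Rightarrow> bool" where
  "is_continuous_rep \<Omega> u v \<longleftrightarrow> continuous_on \<Omega> v \<and> (AE x in lebesgue_on \<Omega>. v x = u x)"

definition continuous_rep ::
  "'a::euclidean_space set \<Rightarrow> ('a \<Rightarrow> real) \<Rightarrow> 'a \<Rightarrow> real" where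
  "continuous_rep \<Omega> u = (SOME v. is_continuous_rep \<Omega> u v)"

subsection \<open>The scale of fractional Sobolev spaces\<close>

text \<open>For \<open>p = \<infinity>\<close> and \<open>0 < s \<le> 1\<close> the seminorm is the Hoelder one, so that the space is \<open>C\<^sup>0\<^sup>,\<^sup>s(\<Omega>)\<close>.\<close>

definition sobolev_seminorm ::
  "'a::euclidean_space set \<Rightarrow> real \<Rightarrow> ereal \<Rightarrow> ('a \<Rightarrow> real) \<Rightarrow> ennreal" where
  "sobolev_seminorm \<Omega> s p u =
     (if s = 0 then Lp_norm \<Omega> p u
      else if p = \<infinity> then
        (if \<exists>v. is_continuous_rep \<Omega> u v then holder_seminorm \<Omega> s (continuous_rep \<Omega> u) else \<infinity>)
      else if s = 1 then
        (if \<exists>g. has_weak_gradient \<Omega> u g then Lp_norm \<Omega> p (weak_gradient \<Omega> u) else \<infinity>)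
      else gagliardo_seminorm \<Omega> s (real_of_ereal p) u)"

definition sobolev_space ::
  "'a::euclidean_space set \<Rightarrow> real \<Rightarrow> ereal \<Rightarrow> ('a \<Rightarrow> real) set" where
  "sobolev_space \<Omega> s p = {u \<in> Lp_space \<Omega> p. sobolev_seminorm \<Omega> s p u < \<infinity>}"

definition sobolev_norm ::
  "'a::euclidean_space set \<Rightarrow> real \<Rightarrow> ereal \<Rightarrow> ('a \<Rightarrow> real) \<Rightarrow> ennreal" where
  "sobolev_norm \<Omega> s p u =
     (if s = 0 then Lp_norm \<Omega> p u
      else if p = \<infinity> then Lp_norm \<Omega> \<infinity> u + sobolev_seminorm \<Omega> s \<infinity> u
      else ennpow (ennpow (sobolev_seminorm \<Omega> s p u) (real_of_ereal p) +
                   ennpow (Lp_norm \<Omega> p u) (real_of_ereal p))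
             (1 / real_of_ereal p))"

definition sobolev_embedded ::
  "'a::euclidean_space set \<Rightarrow> real \<times> ereal \<Rightarrow> real \<times> ereal \<Rightarrow> bool" where
  "sobolev_embedded \<Omega> a b \<longleftrightarrow>
     (case a of (s, p) \<Rightarrow> case b of (t, q) \<Rightarrow>
        sobolev_space \<Omega> s p \<subseteq> sobolev_space \<Omega> t q \<and>
        (\<exists>C::real. C > 0 \<and>
           (\<forall>u \<in> sobolev_space \<Omega> s p. sobolev_norm \<Omega> t q u \<le> ennreal C * sobolev_norm \<Omega> s p u)))"

subsection \<open>The curve of exponents\<close>

definition curve_exponent :: "ereal \<Rightarrow> ereal \<Rightarrow> real \<Rightarrow> ereal" where
  "curve_exponent p q \<theta> =
     (if p = \<infinity> \<or> q = \<infinity> then 1 / (ereal (1 - \<theta>) / p + ereal \<theta> / q)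
      else p * q / (q + ereal \<theta> * (p - q)))"

definition exponent_curve ::
  "real \<Rightarrow> ereal \<Rightarrow> real \<Rightarrow> ereal \<Rightarrow> real \<Rightarrow> real \<times> ereal" where
  "exponent_curve s p t q \<theta> = (\<theta> * t + (1 - \<theta>) * s, curve_exponent p q \<theta>)"

lemma inverse_curve_exponent:
  assumes "1 \<le> p" "1 \<le> q" "0 \<le> \<theta>" "\<theta> \<le> 1"
  shows "1 / curve_exponent p q \<theta> = ereal (1 - \<theta>) / p + ereal \<theta> / q"
proof (cases "p = \<infinity> \<or> q = \<infinity>")
  case True
  have nn: "0 \<le> p" "0 \<le> q"
    using assms by (cases p; cases q; auto)+
  have "0 \<le> ereal (1 - \<theta>) / p + ereal \<theta> / q"
    using assms nn by (intro add_nonneg_nonneg zero_le_divide_ereal) auto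
  moreover have "1 / (1 / x) = x" if "0 \<le> x" for x :: ereal
    using that by (cases x) (auto simp: one_ereal_def divide_ereal_def zero_ereal_def)
  ultimately show ?thesis
    using True by (simp add: curve_exponent_def)
next
  case False
  then obtain a b where ab: "p = ereal a" "q = ereal b"
    using assms by (cases p; cases q) auto
  have a: "1 \<le> a" "1 \<le> b" using assms ab by auto
  have "(1 - \<theta>) * b + \<theta> * a \<ge> (1 - \<theta>) * 1 + \<theta> * 1"
    using a assms by (intro add_mono mult_left_mono) auto
  then have "b + \<theta> * (a - b) > 0" by (simp add: algebra_simps)
  then show ?thesis
    using a False by (simp add: ab curve_exponent_def one_ereal_def field_simps)
qed

end

theory Submission
  imports Defs
begin

text \<open>
  Write \<open>n\<close> for the dimension and \<open>\<alpha> = s - n / p\<close>. Along the curve \<open>t\<close> decreases, \<open>q\<close> increases and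
  \<open>t - n / q\<close> does not increase, so one has to embed \<open>W\<^sup>s\<^sup>,\<^sup>p\<close> into \<open>W\<^sup>t\<^sup>,\<^sup>q\<close> for \<open>t < s\<close>, \<open>p \<le> q\<close> and
  \<open>t - n / q \<le> \<alpha>\<close>, where \<open>\<alpha> > 0\<close> whenever equality holds, \<open>q = \<infinity>\<close> or \<open>s = 1\<close>.

  By Lebesgue differentiation, for almost all \<open>x\<close> and \<open>y\<close> the difference \<open>u x - u y\<close> is bounded by sums of
  mean oscillations of \<open>u\<close> over balls with dyadic radii at most a multiple of \<open>r = dist x y\<close>. For \<open>\<alpha> > 0\<close>
  each oscillation is at most a multiple of a power of the radius with exponent \<open>\<alpha>\<close>, which yields
  Morrey's Hoelder bound. For \<open>s < 1\<close> the \<open>L\<^sup>q\<close> norm of the sum is at most a multiple of a power of \<open>r\<close> with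
  exponent \<open>\<alpha> + n / q\<close>, which settles the strict case \<open>t < \<alpha> + n / q\<close>, whatever the sign of \<open>\<alpha>\<close>. In the
  critical case \<open>t = \<alpha> + n / q\<close> Morrey's bound is inserted into \<open>q - p\<close> of the \<open>q\<close> factors
  \<open>\<bar>u x - u y\<bar>\<close> of the seminorm. For \<open>s = 1\<close> the difference of \<open>u\<close> at the end points of a segment
  is bounded by the integral of the weak gradient over the segment, and in the critical case the gradient
  is split at a height depending on the length of the segment.
\<close>


section \<open>Powers on the extended nonnegative reals\<close>

text \<open>The critical order \<open>t = \<alpha> + n / q\<close> is the obstacle. There the bound
  for translates has exactly the power of \<open>norm h\<close> for which the integral over small
  \<open>h\<close> in the seminorm diverges logarithmically, so decay of translates alone cannot
  reach it. Morrey's bound can, but intermediate points of the curve may have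
  \<open>\<alpha> \<le> 0\<close>, for instance near an end point of order 0 with finite exponent.
  This does no harm: \<open>t - n / q\<close> is affine in the curve parameter, hence either
  constant, and then \<open>\<alpha>\<close> stays positive, or strictly decreasing, and then the
  order is subcritical. Likewise a source of order one with \<open>t < s\<close> occurs only at the
  start of the curve, where \<open>s p > n\<close> makes \<open>\<alpha>\<close> positive.

  The estimates mix different powers of the norm of \<open>u\<close>. They are therefore proved for
  energies at most 1 and turned into linear bounds by scaling. They concern Borel functions and
  \<open>lborel\<close>; Lebesgue measurable functions, the chosen weak gradient and continuous
  representatives enter only when norms are compared with energies.\<close>

lemma ennpow_ennreal: "0 \<le> x \<Longrightarrow> ennpow (ennreal x) a = ennreal (x powr a)"
  by (simp add: ennpow_def)

lemma ennpow_top [simp]: "ennpow top a = top"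
  by (simp add: ennpow_def)

lemma ennpow_0 [simp]: "ennpow 0 a = 0"
  by (simp add: ennpow_def)

lemma ennpow_less_top [simp]: "ennpow x a < top \<longleftrightarrow> x < top"
  by (cases x) (auto simp: ennpow_def)

lemma ennpow_one [simp]: "ennpow x 1 = x"
  by (cases x) (auto simp: ennpow_def)

lemma ennpow_mono:
  assumes "x \<le> y" "0 \<le> a"
  shows "ennpow x a \<le> ennpow y a"
proof (cases y)
  case (real r)
  with assms show ?thesis
    by (cases x) (auto simp: ennpow_ennreal top_unique intro!: ennreal_leI powr_mono2)
qed auto

lemma ennpow_mult:
  assumes "0 < a"
  shows "ennpow (x * y) a = ennpow x a * ennpow y a"
proof (cases "x = top \<or> y = top")
  case True
  have pos: "ennpow z a \<noteq> 0" if "z \<noteq> 0" for z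
    using that by (cases z) (auto simp: ennpow_ennreal)
  show ?thesis
    using True pos[of x] pos[of y]
    by (cases "x = 0"; cases "y = 0") (auto simp: ennreal_mult_top ennreal_top_mult)
next
  case False
  then obtain b c where "x = ennreal b" "y = ennreal c" "0 \<le> b" "0 \<le> c"
    by (metis ennreal_cases)
  then show ?thesis
    by (simp add: ennpow_ennreal powr_mult ennreal_mult[symmetric])
qed

lemma ennpow_ennpow: "ennpow (ennpow x a) b = ennpow x (a * b)"
  by (cases x) (auto simp: ennpow_ennreal powr_powr)

lemma ennpow_borel [measurable (raw)]:
  assumes [measurable]: "f \<in> borel_measurable M"
  shows "(\<lambda>x. ennpow (f x) a) \<in> borel_measurable M"
  unfolding ennpow_def by measurable

text \<open>Comparison with twice the larger summand works for convex and concave powers alike; the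
  constant is not meant to be sharp.\<close>

lemma ennpow_add_le:
  assumes "0 < a"
  shows "ennpow (x + y) a \<le> ennreal (2 powr a) * (ennpow x a + ennpow y a)"
proof -
  have "x + y \<le> 2 * max x y"
    by (metis add_mono max.cobounded1 max.cobounded2 mult_2)
  then have "ennpow (x + y) a \<le> ennpow (ennreal 2 * max x y) a"
    using assms by (intro ennpow_mono) auto
  also have "\<dots> = ennreal (2 powr a) * ennpow (max x y) a"
    by (simp only: ennpow_mult[OF assms]) (simp only: ennpow_ennreal zero_le_numeral)
  also have "\<dots> \<le> ennreal (2 powr a) * (ennpow x a + ennpow y a)"
    by (intro mult_left_mono) (auto simp: max_def)
  finally show ?thesis .
qed

text \<open>The step by which a sup bound changes the exponent: \<open>q - p\<close> of the factors
  are bounded by \<open>c\<close>, the other \<open>p\<close> are kept. It is used with Morrey's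
  bound, with bounds on local means, and with \<open>c = 1\<close> for quantities at most 1.\<close>

lemma ennpow_interpolate:
  assumes "x \<le> ennreal c" "0 \<le> c" "p \<le> q" "0 < p"
  shows "ennpow x q \<le> ennreal (c powr (q - p)) * ennpow x p"
proof -
  obtain r where r: "x = ennreal r" "0 \<le> r" "r \<le> c"
    using assms(1,2) by (cases x) (auto simp: top_unique)
  have "r powr q = r powr (q - p) * r powr p"
    by (simp add: powr_add[symmetric])
  also have "\<dots> \<le> c powr (q - p) * r powr p"
    using r assms by (intro mult_right_mono powr_mono2) auto
  finally show ?thesis
    using r by (simp add: ennpow_ennreal ennreal_mult[symmetric] ennreal_leI)
qed

text \<open>Integrate \<open>a \<le> l + l powr (1 - p) * a powr p\<close> with the \<open>l\<close> that balances the two terms. This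
  loses a factor \<open>2 powr p\<close> against the sharp inequality but needs no integrability.\<close>

lemma nn_integral_Jensen:
  assumes [measurable]: "f \<in> borel_measurable M"
    and V: "emeasure M (space M) \<le> ennreal V" "0 < V" and p: "1 \<le> p"
  shows "ennpow (\<integral>\<^sup>+x. f x \<partial>M) p \<le> ennreal (2 powr p * V powr (p - 1)) * (\<integral>\<^sup>+x. ennpow (f x) p \<partial>M)"
proof (cases "\<integral>\<^sup>+x. ennpow (f x) p \<partial>M")
  case (real j)
  show ?thesis
  \<comment> \<open>The balancing height would be 0 for \<open>j = 0\<close>, so in this case
    \<open>f\<close> is shown to vanish almost everywhere.\<close>
  proof (cases "j = 0")
    case True
    have "AE x in M. ennpow (f x) p = 0"
      using real True by (intro nn_integral_0_iff_AE[THEN iffD1]) auto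
    moreover have "f x = 0" if "ennpow (f x) p = 0" for x
      using that p by (cases "f x") (auto simp: ennpow_ennreal)
    ultimately have "AE x in M. f x = 0"
      by (auto elim: eventually_mono)
    then have "(\<integral>\<^sup>+x. f x \<partial>M) = 0"
      by (subst nn_integral_0_iff_AE) auto
    then show ?thesis by simp
  next
    case False
    define l where "l = (j / V) powr (1 / p)"
    have l: "0 < l" and jl: "l powr p = j / V"
      using False real V p by (auto simp: l_def powr_powr)
    have pw: "f x \<le> ennreal l + ennreal (l powr (1 - p)) * ennpow (f x) p" for x
    proof (cases "f x")
      case (real a)
      have "a \<le> l + l powr (1 - p) * a powr p"
      proof (cases "a \<le> l")
        case False
        then have "l powr (p - 1) \<le> a powr (p - 1)"
          using l p by (intro powr_mono2) auto
        then have "l powr (1 - p) * (a * l powr (p - 1)) \<le> l powr (1 - p) * (a * a powr (p - 1))"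
          using False l by (intro mult_left_mono) auto
        also have "a * a powr (p - 1) = a powr p"
          using False l powr_add[of a 1 "p - 1"] by simp
        also have "l powr (1 - p) * (a * l powr (p - 1)) = a"
          using l powr_add[of l "1 - p" "p - 1"] by simp
        finally show ?thesis using l by simp
      qed (use l in \<open>simp add: add_increasing2\<close>)
      then show ?thesis
        using real l by (simp add: ennpow_ennreal ennreal_mult[symmetric] ennreal_plus[symmetric] ennreal_leI del: ennreal_plus)
    qed (use l in \<open>simp add: ennreal_mult_top\<close>)
    have "(\<integral>\<^sup>+x. f x \<partial>M) \<le> (\<integral>\<^sup>+x. ennreal l + ennreal (l powr (1 - p)) * ennpow (f x) p \<partial>M)"
      by (intro nn_integral_mono pw)
    also have "\<dots> = ennreal l * emeasure M (space M) + ennreal (l powr (1 - p)) * ennreal j"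
      by (subst nn_integral_add) (auto simp: nn_integral_cmult real)
    also have "\<dots> \<le> ennreal l * ennreal V + ennreal (l powr (1 - p)) * ennreal j"
      by (intro add_mono mult_left_mono V) auto
    also have "\<dots> = ennreal (l * V + l powr (1 - p) * j)"
      using l V real by (simp add: ennreal_mult[symmetric])
    also have "l powr (1 - p) * j = l powr (1 - p) * l powr p * V"
      using jl V by simp
    also have "l powr (1 - p) * l powr p = l"
      using l by (simp add: powr_add[symmetric])
    finally have "ennpow (\<integral>\<^sup>+x. f x \<partial>M) p \<le> ennpow (ennreal (2 * l * V)) p"
      using p by (intro ennpow_mono) (auto simp: mult_ac)
    also have "\<dots> = ennreal (2 powr p * (j / V) * V powr p)"
      using l V by (simp add: ennpow_ennreal powr_mult jl)
    also have "V powr p = V * V powr (p - 1)"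
      using V powr_add[of V 1 "p - 1"] by simp
    finally show ?thesis
      using V real by (simp add: ennreal_mult[symmetric] mult_ac)
  qed
next
  case top
  then show ?thesis using V by (simp add: ennreal_mult_top)
qed

section \<open>Power kernels\<close>

lemma dyadic_scale:
  fixes x :: real
  assumes "1 \<le> x"
  obtains k :: nat where "2 powr real k \<le> x" "x < 2 powr (real k + 1)"
proof -
  define k where "k = nat \<lfloor>log 2 x\<rfloor>"
  have "0 \<le> log 2 x" using assms by simp
  then have "real k = of_int \<lfloor>log 2 x\<rfloor>" by (simp add: k_def)
  then show ?thesis
    using that[of k] floor_log_eq_powr_iff[of x 2 "\<lfloor>log 2 x\<rfloor>"] assms by simp
qed

lemma emeasure_lborel_ball:
  "0 \<le> r \<Longrightarrow> emeasure lborel (ball (x::'a::euclidean_space) r) = ennreal (unit_ball_vol (real DIM('a)) * r ^ DIM('a))"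
  by (simp add: emeasure_ball)

lemma unit_ball_vol_DIM_pos: "0 < unit_ball_vol (real DIM('a::euclidean_space))"
  by simp

lemma suminf_ennreal_geometric:
  assumes "0 \<le> A" "0 \<le> q" "q < 1"
  shows "(\<Sum>k. ennreal (A * q ^ k)) = ennreal (A / (1 - q))"
proof -
  have "(\<lambda>k. A * q ^ k) sums (A * (1 / (1 - q)))"
    using assms by (intro sums_mult geometric_sums) auto
  then show ?thesis
    using assms by (subst suminf_ennreal_eq) auto
qed

text \<open>A dyadic substitute for polar coordinates. Where \<open>f\<close> is nonzero, a single
  term of a series of multiples of indicators of balls dominates it, and the integrals of the terms
  decay geometrically. Both kernel estimates below are instances, with radii going to 0 and to
  infinity respectively.\<close>

lemma nn_integral_dyadic_bound:
  fixes f :: "'a::euclidean_space \<Rightarrow> ennreal"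
  assumes A: "0 \<le> A" "0 < b" and r: "\<And>k. 0 < r k" and c: "\<And>k. 0 \<le> c k"
    and cr: "\<And>k. c k * r k ^ DIM('a) \<le> A * (2 powr (- b)) ^ k"
    and f: "\<And>x. f x \<noteq> 0 \<Longrightarrow> \<exists>k::nat. f x \<le> ennreal (c k) \<and> norm x < r k"
  shows "(\<integral>\<^sup>+x. f x \<partial>lborel) \<le> ennreal (unit_ball_vol (real DIM('a)) * A / (1 - 2 powr (- b)))"
proof -
  let ?V = "unit_ball_vol (real DIM('a))"
  have le: "f x \<le> (\<Sum>k. ennreal (c k) * indicator (ball 0 (r k)) x)" for x
  proof (cases "f x = 0")
    case False
    then obtain k where k: "f x \<le> ennreal (c k)" "norm x < r k" using f by blast
    then have "f x \<le> ennreal (c k) * indicator (ball 0 (r k)) x" by simp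
    also have "\<dots> = (\<Sum>j\<in>{k}. ennreal (c j) * indicator (ball 0 (r j)) x)" by (subst sum.insert) auto
    also have "\<dots> \<le> (\<Sum>k. ennreal (c k) * indicator (ball 0 (r k)) x)"
      by (intro sum_le_suminf) auto
    finally show ?thesis .
  qed simp
  have "(\<integral>\<^sup>+x. f x \<partial>lborel) \<le> (\<integral>\<^sup>+(x::'a). (\<Sum>k. ennreal (c k) * indicator (ball 0 (r k)) x) \<partial>lborel)"
    by (intro nn_integral_mono le)
  also have "\<dots> = (\<Sum>k. ennreal (c k * (?V * r k ^ DIM('a))))"
    by (subst nn_integral_suminf, measurable)
      (use r c in \<open>auto simp: nn_integral_cmult_indicator emeasure_lborel_ball less_imp_le ennreal_mult\<close>)
  also have "\<dots> \<le> (\<Sum>k. ennreal (?V * A * (2 powr (- b)) ^ k))"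
    using mult_left_mono[OF cr, of ?V]
    by (intro suminf_le ennreal_leI) (auto simp: mult_ac)
  also have "\<dots> = ennreal (?V * A / (1 - 2 powr (- b)))"
    using A by (intro suminf_ennreal_geometric) (auto simp: powr_less_one)
  finally show ?thesis .
qed

lemma powr_dyadic: "2 powr (real k * b) = (2 powr b) ^ k"
  by (metis mult.commute powr_powr powr_realpow powr_gt_zero zero_neq_numeral)

text \<open>The factor \<open>4 ^ n\<close> compares a ball of radius \<open>2 * \<rho>\<close> with
  the kernel at distance \<open>\<rho> / 2\<close>, and the denominator sums the geometric series.
  The integral outside a ball produces only \<open>2 ^ n\<close>, which is enlarged so that both
  estimates share one constant.\<close>

definition kernel_const :: "nat \<Rightarrow> real \<Rightarrow> real" where
  "kernel_const n b = unit_ball_vol (real n) * 4 ^ n / (1 - 2 powr (- b))"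

lemma kernel_const_nonneg: "0 < b \<Longrightarrow> 0 \<le> kernel_const n b"
  by (simp add: kernel_const_def less_imp_le powr_less_one)

lemma kernel_ball_bound:
  assumes b: "0 < b" and R: "0 < R"
  shows "(\<integral>\<^sup>+(h::'a). ennreal (norm h powr (b - real DIM('a::euclidean_space))) * indicator {h. norm h \<le> R} h \<partial>lborel)
           \<le> ennreal (kernel_const DIM('a) b * R powr b)"
proof -
  let ?n = "DIM('a)"
  define \<rho> where "\<rho> k = R * 2 powr (- real k)" for k :: nat
  have \<rho>: "0 < \<rho> k" for k using R by (simp add: \<rho>_def)
  have eq: "\<rho> k powr b * (\<rho> k / 2) powr (- real ?n) * (2 * \<rho> k) ^ ?n = 4 ^ ?n * R powr b * (2 powr (- b)) ^ k" for k
  proof -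
    have "(\<rho> k / 2) powr (- real ?n) * (2 * \<rho> k) ^ ?n = 4 ^ ?n"
      using \<rho>[of k] by (simp add: powr_minus powr_realpow power_divide power_mult_distrib divide_simps)
        (simp add: power_mult_distrib[symmetric])
    moreover have "\<rho> k powr b = R powr b * (2 powr (- b)) ^ k"
      using R by (simp add: \<rho>_def powr_mult powr_powr powr_dyadic[symmetric])
    ultimately show ?thesis by (simp add: mult_ac)
  qed
  have "(\<integral>\<^sup>+h. ennreal (norm h powr (b - real ?n)) * indicator {h::'a. norm h \<le> R} h \<partial>lborel)
      \<le> ennreal (unit_ball_vol (real ?n) * (4 ^ ?n * R powr b) / (1 - 2 powr (- b)))"
  proof (rule nn_integral_dyadic_bound[where r = "\<lambda>k. 2 * \<rho> k"
        and c = "\<lambda>k. \<rho> k powr b * (\<rho> k / 2) powr (- real ?n)"])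
    fix h :: 'a
    assume "ennreal (norm h powr (b - real ?n)) * indicator {h. norm h \<le> R} h \<noteq> 0"
    then have h: "0 < norm h" "norm h \<le> R" by (auto split: split_indicator_asm)
    then obtain k :: nat where k: "2 powr real k \<le> R / norm h" "R / norm h < 2 powr (real k + 1)"
      using dyadic_scale[of "R / norm h"] by auto
    have k': "norm h \<le> \<rho> k" "\<rho> k / 2 \<le> norm h"
      using k h by (auto simp: \<rho>_def powr_minus powr_add field_simps)
    \<comment> \<open>The exponent \<open>b - n\<close> has no fixed sign. The power
      \<open>b\<close> is therefore estimated at the outer radius of the shell and the power
      \<open>- n\<close> at the inner one.\<close>
    have "norm h powr (b - real ?n) = norm h powr b * norm h powr (- real ?n)"
      using h by (simp add: powr_add[symmetric])
    also have "\<dots> \<le> \<rho> k powr b * (\<rho> k / 2) powr (- real ?n)"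
      using k' h b \<rho>[of k] by (intro mult_mono powr_mono2 powr_mono2') auto
    finally show "\<exists>k. ennreal (norm h powr (b - real ?n)) * indicator {h. norm h \<le> R} h
        \<le> ennreal (\<rho> k powr b * (\<rho> k / 2) powr (- real ?n)) \<and> norm h < 2 * \<rho> k"
      using h k' \<rho>[of k] by (intro exI[of _ k]) (auto intro!: ennreal_leI)
  qed (use \<rho> b eq in auto)
  then show ?thesis
    by (simp add: kernel_const_def mult.assoc)
qed

lemma kernel_outside_bound:
  assumes b: "0 < b" and R: "0 < R"
  shows "(\<integral>\<^sup>+(h::'a). ennreal (norm h powr (- b - real DIM('a::euclidean_space))) * indicator {h. R \<le> norm h} h \<partial>lborel)
           \<le> ennreal (kernel_const DIM('a) b * R powr (- b))"
proof -
  let ?n = "DIM('a)"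
  define \<rho> where "\<rho> k = R * 2 powr (real k)" for k :: nat
  have \<rho>: "0 < \<rho> k" for k using R by (simp add: \<rho>_def)
  have eq: "\<rho> k powr (- b - real ?n) * (2 * \<rho> k) ^ ?n \<le> 4 ^ ?n * R powr (- b) * (2 powr (- b)) ^ k" for k
  proof -
    have "\<rho> k powr (- b - real ?n) * (2 * \<rho> k) ^ ?n = 2 ^ ?n * \<rho> k powr (- b)"
      using \<rho>[of k] by (simp add: powr_diff powr_minus powr_realpow power_mult_distrib field_simps)
    also have "\<rho> k powr (- b) = R powr (- b) * (2 powr (- b)) ^ k"
      using R by (simp add: \<rho>_def powr_mult powr_powr powr_dyadic[symmetric])
    also have "2 ^ ?n * \<dots> \<le> 4 ^ ?n * \<dots>"
      by (intro mult_right_mono power_mono) auto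
    finally show ?thesis by (simp add: mult_ac)
  qed
  have "(\<integral>\<^sup>+h. ennreal (norm h powr (- b - real ?n)) * indicator {h::'a. R \<le> norm h} h \<partial>lborel)
      \<le> ennreal (unit_ball_vol (real ?n) * (4 ^ ?n * R powr (- b)) / (1 - 2 powr (- b)))"
  proof (rule nn_integral_dyadic_bound[where r = "\<lambda>k. 2 * \<rho> k" and c = "\<lambda>k. \<rho> k powr (- b - real ?n)"])
    fix h :: 'a
    assume "ennreal (norm h powr (- b - real ?n)) * indicator {h. R \<le> norm h} h \<noteq> 0"
    then have h: "R \<le> norm h" by (auto split: split_indicator_asm)
    then obtain k :: nat where k: "2 powr real k \<le> norm h / R" "norm h / R < 2 powr (real k + 1)"
      using dyadic_scale[of "norm h / R"] R by auto
    have k': "\<rho> k \<le> norm h" "norm h < 2 * \<rho> k"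
      using k R by (auto simp: \<rho>_def powr_add field_simps)
    have "norm h powr (- b - real ?n) \<le> \<rho> k powr (- b - real ?n)"
      using k' b \<rho>[of k] by (intro powr_mono2') auto
    then show "\<exists>k. ennreal (norm h powr (- b - real ?n)) * indicator {h. R \<le> norm h} h
        \<le> ennreal (\<rho> k powr (- b - real ?n)) \<and> norm h < 2 * \<rho> k"
      using h k' by (intro exI[of _ k]) (auto intro!: ennreal_leI)
  qed (use \<rho> b eq in auto)
  then show ?thesis
    by (simp add: kernel_const_def mult.assoc)
qed


section \<open>Averages and mean oscillation\<close>

lemma average_minus_const:
  fixes u :: "'a::euclidean_space \<Rightarrow> real"
  assumes [measurable]: "S \<in> sets lborel" "u \<in> borel_measurable lborel"
    and S: "emeasure lborel S = ennreal s" "0 < s"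
    and u: "set_integrable lborel S u"
  shows "ennreal \<bar>(LINT z:S|lborel. u z) / s - c\<bar> \<le> ennreal (1 / s) * (\<integral>\<^sup>+z. ennreal \<bar>u z - c\<bar> * indicator S z \<partial>lborel)"
proof -
  have c: "set_integrable lborel S (\<lambda>_. c)"
    using S assms(1) by (simp add: set_integrable_def)
  have "(LINT z:S|lborel. u z - c) = (LINT z:S|lborel. u z) - c * s"
    using S u c by (subst set_integral_diff) (auto simp: set_lebesgue_integral_def measure_def)
  then have eq: "\<bar>(LINT z:S|lborel. u z) / s - c\<bar> = 1 / s * \<bar>LINT z:S|lborel. u z - c\<bar>"
    using S by (simp add: field_simps)
  have "set_integrable lborel S (\<lambda>z. u z - c)"
    by (intro set_integral_diff u c)
  then have "ennreal (norm (LINT z:S|lborel. u z - c)) \<le> (\<integral>\<^sup>+z. ennreal (norm (indicator S z *\<^sub>R (u z - c))) \<partial>lborel)"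
    unfolding set_lebesgue_integral_def set_integrable_def by (intro integral_norm_bound_ennreal)
  also have "\<dots> = (\<integral>\<^sup>+z. ennreal \<bar>u z - c\<bar> * indicator S z \<partial>lborel)"
    by (intro nn_integral_cong) (auto split: split_indicator)
  finally show ?thesis
    unfolding eq using S by (subst ennreal_mult) (auto intro: mult_left_mono)
qed

text \<open>One functional for two quantities: the kernel \<open>\<bar>u z - u w\<bar>\<close> gives
  the oscillation of \<open>u\<close>, the Gagliardo kernel the energy inside the ball. It is not
  divided by the squared volume; that normalisation enters with the cube averages.\<close>

definition ball_double :: "('a::euclidean_space \<Rightarrow> 'a \<Rightarrow> ennreal) \<Rightarrow> 'a \<Rightarrow> real \<Rightarrow> ennreal" where
  "ball_double K x \<rho> = (\<integral>\<^sup>+z. (\<integral>\<^sup>+w. K z w * (indicator (ball x \<rho>) z * indicator (ball x \<rho>) w) \<partial>lborel) \<partial>lborel)"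

abbreviation osc :: "('a::euclidean_space \<Rightarrow> real) \<Rightarrow> 'a \<Rightarrow> real \<Rightarrow> ennreal" where
  "osc u \<equiv> ball_double (\<lambda>z w. ennreal \<bar>u z - u w\<bar>)"

text \<open>Written through the distance, the indicator is visibly measurable jointly in the centre
  and the point, as needed when the centre is integrated.\<close>

lemma indicator_ball_dist: "indicator (ball x \<rho>) z = indicator {..<\<rho>} (dist x z)"
  by (auto simp: indicator_def)

lemma ball_double_measurable [measurable]:
  assumes [measurable]: "(\<lambda>(z, w). K z w) \<in> borel_measurable (borel \<Otimes>\<^sub>M borel)"
  shows "(\<lambda>x. ball_double K x \<rho>) \<in> borel_measurable borel"
  unfolding ball_double_def indicator_ball_dist by measurable

lemma ball_double_le:
  "ball_double K x \<rho> \<le> (\<integral>\<^sup>+z. (\<integral>\<^sup>+w. K z w \<partial>lborel) \<partial>lborel)"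
  unfolding ball_double_def by (intro nn_integral_mono) (auto split: split_indicator)

text \<open>One of the two indicators is dropped; by Tonelli each \<open>z\<close> is then counted
  with the volume of the centres \<open>x\<close> within \<open>\<rho>\<close> of it. This volume is
  the source of the gain \<open>n / q\<close> in the subcritical estimate.\<close>

lemma nn_integral_ball_double:
  fixes K :: "'a::euclidean_space \<Rightarrow> 'a \<Rightarrow> ennreal"
  assumes [measurable]: "(\<lambda>(z, w). K z w) \<in> borel_measurable (borel \<Otimes>\<^sub>M borel)" and "0 \<le> \<rho>"
  shows "(\<integral>\<^sup>+x. ball_double K x \<rho> \<partial>lborel)
           \<le> ennreal (unit_ball_vol (real DIM('a)) * \<rho> ^ DIM('a)) * (\<integral>\<^sup>+z. (\<integral>\<^sup>+w. K z w \<partial>lborel) \<partial>lborel)"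
proof -
  have "(\<integral>\<^sup>+x. ball_double K x \<rho> \<partial>lborel) \<le>
      (\<integral>\<^sup>+x. (\<integral>\<^sup>+z. (\<integral>\<^sup>+w. K z w * indicator {..<\<rho>} (dist x z) \<partial>lborel) \<partial>lborel) \<partial>lborel)"
    unfolding ball_double_def indicator_ball_dist
    by (intro nn_integral_mono) (auto split: split_indicator)
  also have "\<dots> = (\<integral>\<^sup>+x. (\<integral>\<^sup>+z. (\<integral>\<^sup>+w. K z w \<partial>lborel) * indicator {..<\<rho>} (dist x z) \<partial>lborel) \<partial>lborel)"
    by (simp add: nn_integral_multc)
  also have "\<dots> = (\<integral>\<^sup>+z. (\<integral>\<^sup>+x. (\<integral>\<^sup>+w. K z w \<partial>lborel) * indicator {..<\<rho>} (dist x z) \<partial>lborel) \<partial>lborel)"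
    by (subst lborel_pair.Fubini') (auto simp: split_beta')
  also have "\<dots> = (\<integral>\<^sup>+z. (\<integral>\<^sup>+w. K z w \<partial>lborel) * ennreal (unit_ball_vol (real DIM('a)) * \<rho> ^ DIM('a)) \<partial>lborel)"
  proof (intro nn_integral_cong)
    fix z :: 'a
    have "(\<integral>\<^sup>+x. (\<integral>\<^sup>+w. K z w \<partial>lborel) * indicator {..<\<rho>} (dist x z) \<partial>lborel)
        = (\<integral>\<^sup>+x. (\<integral>\<^sup>+w. K z w \<partial>lborel) * indicator (ball z \<rho>) x \<partial>lborel)"
      by (simp add: indicator_ball_dist dist_commute)
    also have "\<dots> = (\<integral>\<^sup>+w. K z w \<partial>lborel) * ennreal (unit_ball_vol (real DIM('a)) * \<rho> ^ DIM('a))"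
      using assms(2) by (subst nn_integral_cmult_indicator) (auto simp: emeasure_lborel_ball)
    finally show "(\<integral>\<^sup>+x. (\<integral>\<^sup>+w. K z w \<partial>lborel) * indicator {..<\<rho>} (dist x z) \<partial>lborel) = \<dots>" .
  qed
  also have "\<dots> = ennreal (unit_ball_vol (real DIM('a)) * \<rho> ^ DIM('a)) * (\<integral>\<^sup>+z. (\<integral>\<^sup>+w. K z w \<partial>lborel) \<partial>lborel)"
    by (subst nn_integral_multc) (auto simp: mult.commute)
  finally show ?thesis .
qed

text \<open>The average over \<open>T\<close> is a constant to be compared with the average over
  \<open>S\<close>, and for each \<open>z\<close> the value \<open>u z\<close> is a constant to be
  compared with the average over \<open>T\<close>. Both indicators are finally enlarged to the
  ball.\<close>

lemma average_diff_le_osc: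
  fixes u :: "'a::euclidean_space \<Rightarrow> real"
  assumes [measurable]: "S \<in> sets lborel" "T \<in> sets lborel" "u \<in> borel_measurable lborel"
    and S: "emeasure lborel S = ennreal s" "0 < s" "S \<subseteq> ball x \<rho>"
    and T: "emeasure lborel T = ennreal t" "0 < t" "T \<subseteq> ball x \<rho>"
    and u: "set_integrable lborel S u" "set_integrable lborel T u"
  shows "ennreal \<bar>(LINT z:S|lborel. u z) / s - (LINT z:T|lborel. u z) / t\<bar> \<le> ennreal (1 / (s * t)) * osc u x \<rho>"
proof -
  let ?c = "(LINT z:T|lborel. u z) / t"
  have "ennreal \<bar>(LINT z:S|lborel. u z) / s - ?c\<bar> \<le> ennreal (1 / s) * (\<integral>\<^sup>+z. ennreal \<bar>u z - ?c\<bar> * indicator S z \<partial>lborel)"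
    using S u assms(1,3) by (intro average_minus_const) auto
  also have "(\<integral>\<^sup>+z. ennreal \<bar>u z - ?c\<bar> * indicator S z \<partial>lborel)
      \<le> (\<integral>\<^sup>+z. ennreal (1 / t) * (\<integral>\<^sup>+w. ennreal \<bar>u z - u w\<bar> * (indicator (ball x \<rho>) z * indicator (ball x \<rho>) w) \<partial>lborel) \<partial>lborel)"
  proof (intro nn_integral_mono)
    fix z :: 'a
    have "ennreal \<bar>u z - ?c\<bar> = ennreal \<bar>?c - u z\<bar>" by (simp add: abs_minus_commute)
    also have "\<dots> \<le> ennreal (1 / t) * (\<integral>\<^sup>+w. ennreal \<bar>u w - u z\<bar> * indicator T w \<partial>lborel)"
      using T u assms(2,3) by (intro average_minus_const) auto
    finally have "ennreal \<bar>u z - ?c\<bar> * indicator S z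
       \<le> ennreal (1 / t) * (\<integral>\<^sup>+w. ennreal \<bar>u w - u z\<bar> * indicator T w \<partial>lborel) * indicator S z"
      by (rule mult_right_mono) simp
    also have "\<dots> = ennreal (1 / t) * (\<integral>\<^sup>+w. ennreal \<bar>u w - u z\<bar> * indicator T w * indicator S z \<partial>lborel)"
      by (subst nn_integral_multc) (auto simp: mult.assoc)
    also have "\<dots> \<le> ennreal (1 / t) * (\<integral>\<^sup>+w. ennreal \<bar>u z - u w\<bar> * (indicator (ball x \<rho>) z * indicator (ball x \<rho>) w) \<partial>lborel)"
      using S(3) T(3) by (intro mult_left_mono nn_integral_mono)
        (auto simp: abs_minus_commute split: split_indicator)
    finally show "ennreal \<bar>u z - ?c\<bar> * indicator S z
       \<le> ennreal (1 / t) * (\<integral>\<^sup>+w. ennreal \<bar>u z - u w\<bar> * (indicator (ball x \<rho>) z * indicator (ball x \<rho>) w) \<partial>lborel)" .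
  qed
  also have "\<dots> = ennreal (1 / t) * osc u x \<rho>"
    unfolding ball_double_def indicator_ball_dist by (subst nn_integral_cmult) auto
  finally show ?thesis
    using S T by (simp add: mult_left_mono mult.assoc[symmetric] ennreal_mult[symmetric])
qed

section \<open>Cube averages and their dyadic telescoping\<close>

text \<open>The point is a corner of the cube, not its centre, which is the shape of the averages in
  the Lebesgue differentiation theorem used below.\<close>

definition cube :: "'a::euclidean_space \<Rightarrow> real \<Rightarrow> 'a set" where
  "cube x r = cbox x (x + r *\<^sub>R One)"

definition cube_avg :: "('a::euclidean_space \<Rightarrow> real) \<Rightarrow> 'a \<Rightarrow> real \<Rightarrow> real" where
  "cube_avg u x r = (LINT z:cube x r|lborel. u z) / r ^ DIM('a)"

lemma cube_measurable [measurable]: "cube x r \<in> sets borel"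
  by (simp add: cube_def)

lemma emeasure_cube:
  "0 \<le> r \<Longrightarrow> emeasure lborel (cube (x::'a::euclidean_space) r) = ennreal (r ^ DIM('a))"
  unfolding cube_def by (subst emeasure_lborel_cbox) (auto simp: inner_simps)

text \<open>A point of the cube is within \<open>n * r\<close> of its corner in the
  \<open>l1\<close> norm, and the corner is within \<open>r\<close> of the centre of the ball; one
  more \<open>r\<close> makes the estimate strict, as the open ball requires.\<close>

definition ball_factor :: "'a::euclidean_space itself \<Rightarrow> real" where
  "ball_factor _ = real DIM('a) + 2"

lemma ball_factor_pos: "0 < ball_factor TYPE('a::euclidean_space)"
  by (simp add: ball_factor_def add_nonneg_pos)

lemma cube_subset_ball:
  fixes x y :: "'a::euclidean_space"
  assumes "0 < r" "dist x y \<le> r"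
  shows "cube y r \<subseteq> ball x (ball_factor TYPE('a) * r)"
proof
  fix z assume z: "z \<in> cube y r"
  have "norm (z - y) \<le> (\<Sum>i\<in>Basis. \<bar>(z - y) \<bullet> i\<bar>)" by (rule norm_le_l1)
  also have "\<dots> \<le> (\<Sum>i\<in>(Basis::'a set). r)"
    using z by (intro sum_mono) (auto simp: cube_def mem_box inner_simps)
  finally have "dist y z \<le> real DIM('a) * r" by (simp add: dist_norm norm_minus_commute)
  then have "dist x z \<le> r + real DIM('a) * r"
    using assms dist_triangle[of x z y] by simp
  then show "z \<in> ball x (ball_factor TYPE('a) * r)"
    using assms by (simp add: ball_factor_def algebra_simps)
qed

text \<open>The scale-invariant mean oscillations over the dyadic balls on which consecutive cube averages
  are compared.\<close>

definition osc_sum :: "('a::euclidean_space \<Rightarrow> real) \<Rightarrow> 'a \<Rightarrow> real \<Rightarrow> ennreal" where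
  "osc_sum u x r = (\<Sum>k. ennreal (1 / (r / 2 ^ k) ^ (2 * DIM('a))) * osc u x (ball_factor TYPE('a) * (r / 2 ^ k)))"

lemma osc_sum_measurable [measurable]:
  fixes u :: "'a::euclidean_space \<Rightarrow> real"
  assumes [measurable]: "u \<in> borel_measurable borel"
  shows "(\<lambda>x. osc_sum u x r) \<in> borel_measurable borel"
  unfolding osc_sum_def by measurable

text \<open>Stated for two corners and two sides because it is used twice: for consecutive dyadic
  cubes at one corner, and for equal cubes at two points whose distance is the side.\<close>

lemma cube_avg_diff:
  fixes u :: "'a::euclidean_space \<Rightarrow> real"
  assumes [measurable]: "u \<in> borel_measurable borel"
    and u: "\<And>y r. set_integrable lborel (cube y r) u"
    and r: "0 < r" "dist x y \<le> R" "0 < r'" "r \<le> R" "r' \<le> R"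
  shows "ennreal \<bar>cube_avg u x r - cube_avg u y r'\<bar> \<le> ennreal (1 / (r ^ DIM('a) * r' ^ DIM('a))) * osc u x (ball_factor TYPE('a) * R)"
  unfolding cube_avg_def
proof (rule average_diff_le_osc)
  have mono: "cube z s \<subseteq> cube z R" if "s \<le> R" for s and z :: 'a
    using that unfolding cube_def by (intro subset_box_imp) (auto simp: inner_simps)
  show "cube x r \<subseteq> ball x (ball_factor TYPE('a) * R)" "cube y r' \<subseteq> ball x (ball_factor TYPE('a) * R)"
    using mono[of r x] mono[of r' y] cube_subset_ball[of R x x] cube_subset_ball[of R x y] r by auto
qed (use r u in \<open>auto simp: emeasure_cube\<close>)

text \<open>The exceptional set must serve all \<open>r\<close> at once, since \<open>r\<close> will
  be the distance of a varying pair of points.\<close>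

lemma cube_avg_lebesgue:
  fixes u :: "'a::euclidean_space \<Rightarrow> real"
  assumes u: "\<And>y r. set_integrable lborel (cube y r) u"
  obtains N where "negligible N" "\<And>x r. x \<notin> N \<Longrightarrow> 0 < r \<Longrightarrow> (\<lambda>k. cube_avg u x (r / 2 ^ k)) \<longlonglongrightarrow> u x"
proof -
  have int: "u integrable_on cbox a b" for a b
  proof -
    define R where "R = (\<Sum>i\<in>Basis. \<bar>(b - a) \<bullet> i\<bar>)"
    have "b \<bullet> i \<le> a \<bullet> i + R" if "i \<in> Basis" for i
      using member_le_sum[OF that, of "\<lambda>i. \<bar>(b - a) \<bullet> i\<bar>"] by (simp add: R_def inner_simps)
    then have "cbox a b \<subseteq> cube a R"
      unfolding cube_def by (intro subset_box_imp) (auto simp: inner_simps)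
    then show ?thesis
      using set_borel_integral_eq_integral(1)[OF u] integrable_on_subcbox by (metis cube_def)
  qed
  obtain N where N: "negligible N"
    "\<And>x e. \<lbrakk>x \<notin> N; 0 < e\<rbrakk> \<Longrightarrow> \<exists>d>0. \<forall>h. 0 < h \<and> h < d \<longrightarrow>
        norm (integral (cbox x (x + h *\<^sub>R One)) u /\<^sub>R h ^ DIM('a) - u x) < e"
    using integrable_ccontinuous_explicit[OF int] by blast
  show ?thesis
  proof (rule that[OF N(1)], rule metric_LIMSEQ_I)
    fix x r and e :: real assume x: "x \<notin> N" and r: "0 < (r::real)" and e: "0 < e"
    obtain d where d: "0 < d" "\<And>h. 0 < h \<Longrightarrow> h < d \<Longrightarrow>
        norm (integral (cbox x (x + h *\<^sub>R One)) u /\<^sub>R h ^ DIM('a) - u x) < e"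
      using N(2)[OF x e] by blast
    have "(\<lambda>k. r * (1 / 2) ^ k) \<longlonglongrightarrow> r * 0"
      by (intro tendsto_mult tendsto_const LIMSEQ_power_zero) auto
    then have "\<forall>\<^sub>F k in sequentially. r * (1 / 2) ^ k < d"
      using d(1) order_tendstoD(2) by fastforce
    moreover have "r * (1 / 2) ^ k = r / 2 ^ k" for k
      by (simp add: power_one_over)
    ultimately obtain K where K: "\<And>k. K \<le> k \<Longrightarrow> r / 2 ^ k < d"
      unfolding eventually_sequentially by auto
    show "\<exists>K. \<forall>k\<ge>K. dist (cube_avg u x (r / 2 ^ k)) (u x) < e"
    proof (intro exI[of _ K] allI impI)
      fix k assume "K \<le> k"
      from d(2)[OF _ K[OF this]] r
      show "dist (cube_avg u x (r / 2 ^ k)) (u x) < e"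
        using set_borel_integral_eq_integral(2)[OF u, of x "r / 2 ^ k"]
        by (simp add: cube_avg_def cube_def dist_norm field_simps)
    qed
  qed
qed

text \<open>Telescoping over the dyadic sides. Consecutive cubes have volumes
  \<open>\<rho> ^ n\<close> and \<open>(\<rho> / 2) ^ n\<close>, whence the factor
  \<open>2 ^ n\<close> against the normalisation by \<open>\<rho> ^ (2 * n)\<close>.\<close>

lemma cube_avg_osc_sum:
  fixes u :: "'a::euclidean_space \<Rightarrow> real"
  assumes [measurable]: "u \<in> borel_measurable borel"
    and u: "\<And>y r. set_integrable lborel (cube y r) u"
    and lim: "(\<lambda>k. cube_avg u x (r / 2 ^ k)) \<longlonglongrightarrow> u x" and r: "0 < r"
  shows "ennreal \<bar>cube_avg u x r - u x\<bar> \<le> ennreal (2 ^ DIM('a)) * osc_sum u x r"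
proof -
  let ?a = "\<lambda>k. cube_avg u x (r / 2 ^ k)"
  let ?t = "\<lambda>k. ennreal (1 / (r / 2 ^ k) ^ (2 * DIM('a))) * osc u x (ball_factor TYPE('a) * (r / 2 ^ k))"
  have step: "ennreal \<bar>?a k - ?a (Suc k)\<bar> \<le> ennreal (2 ^ DIM('a)) * ?t k" for k
  proof -
    have "ennreal \<bar>?a k - ?a (Suc k)\<bar> \<le> ennreal (1 / ((r / 2 ^ k) ^ DIM('a) * (r / 2 ^ Suc k) ^ DIM('a))) * osc u x (ball_factor TYPE('a) * (r / 2 ^ k))"
      using r by (intro cube_avg_diff u) (auto simp: field_simps)
    also have "1 / ((r / 2 ^ k) ^ DIM('a) * (r / 2 ^ Suc k) ^ DIM('a)) = 2 ^ DIM('a) * (1 / (r / 2 ^ k) ^ (2 * DIM('a)))"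
    proof -
      have "r / 2 ^ Suc k = r / 2 ^ k / 2" by simp
      then show ?thesis
        by (simp only: power_divide[of "r / 2 ^ k" 2] mult_2 power_add) simp
    qed
    also have "ennreal \<dots> = ennreal (2 ^ DIM('a)) * ennreal (1 / (r / 2 ^ k) ^ (2 * DIM('a)))"
      by (rule ennreal_mult) (use r in auto)
    finally show ?thesis by (simp add: mult.assoc)
  qed
  have part: "ennreal \<bar>?a 0 - ?a m\<bar> \<le> ennreal (2 ^ DIM('a)) * osc_sum u x r" for m
  proof -
    have "ennreal \<bar>?a 0 - ?a m\<bar> \<le> (\<Sum>k<m. ennreal \<bar>?a k - ?a (Suc k)\<bar>)"
    proof (induction m)
      case (Suc m)
      have "ennreal \<bar>?a 0 - ?a (Suc m)\<bar> \<le> ennreal (\<bar>?a 0 - ?a m\<bar> + \<bar>?a m - ?a (Suc m)\<bar>)"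
        by (intro ennreal_leI) linarith
      also have "\<dots> = ennreal \<bar>?a 0 - ?a m\<bar> + ennreal \<bar>?a m - ?a (Suc m)\<bar>" by simp
      also have "\<dots> \<le> (\<Sum>k<m. ennreal \<bar>?a k - ?a (Suc k)\<bar>) + ennreal \<bar>?a m - ?a (Suc m)\<bar>"
        by (intro add_mono Suc order_refl)
      finally show ?case by simp
    qed simp
    also have "\<dots> \<le> (\<Sum>k<m. ennreal (2 ^ DIM('a)) * ?t k)"
      by (intro sum_mono step)
    also have "\<dots> = ennreal (2 ^ DIM('a)) * (\<Sum>k<m. ?t k)"
      by (simp add: sum_distrib_left)
    also have "\<dots> \<le> ennreal (2 ^ DIM('a)) * osc_sum u x r"
      unfolding osc_sum_def by (intro mult_left_mono sum_le_suminf) auto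
    finally show ?thesis .
  qed
  have "(\<lambda>m. ennreal \<bar>?a 0 - ?a m\<bar>) \<longlonglongrightarrow> ennreal \<bar>?a 0 - u x\<bar>"
    by (intro tendsto_ennrealI tendsto_intros lim)
  then have "ennreal \<bar>?a 0 - u x\<bar> \<le> ennreal (2 ^ DIM('a)) * osc_sum u x r"
    using part by (intro LIMSEQ_le_const2[of "\<lambda>m. ennreal \<bar>?a 0 - ?a m\<bar>"]) blast+
  then show ?thesis by simp
qed

text \<open>Between \<open>u x\<close> and \<open>u y\<close> the averages over the cubes with side
  \<open>dist x y\<close> at both points are inserted; their difference is controlled by the leading
  term of the series at \<open>x\<close>. The sum at \<open>x\<close> thus occurs twice, and
  doubling the one at \<open>y\<close> makes the bound symmetric. The last claim is the same
  argument at side 1, with the average itself bounded by an integral over a ball.\<close>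

lemma pointwise_osc_sum:
  fixes u :: "'a::euclidean_space \<Rightarrow> real"
  assumes [measurable]: "u \<in> borel_measurable borel"
    and u: "\<And>y r. set_integrable lborel (cube y r) u"
  obtains N where "negligible N"
    "\<And>x y. x \<notin> N \<Longrightarrow> y \<notin> N \<Longrightarrow> x \<noteq> y \<Longrightarrow>
       ennreal \<bar>u x - u y\<bar> \<le> ennreal (2 ^ (DIM('a) + 1)) * (osc_sum u x (dist x y) + osc_sum u y (dist x y))"
    "\<And>x. x \<notin> N \<Longrightarrow> ennreal \<bar>u x\<bar> \<le>
       (\<integral>\<^sup>+z. ennreal \<bar>u z\<bar> * indicator (ball x (ball_factor TYPE('a))) z \<partial>lborel) + ennreal (2 ^ DIM('a)) * osc_sum u x 1"
proof -
  obtain N where N: "negligible N" "\<And>x r. x \<notin> N \<Longrightarrow> 0 < r \<Longrightarrow> (\<lambda>k. cube_avg u x (r / 2 ^ k)) \<longlonglongrightarrow> u x"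
    using cube_avg_lebesgue[OF u] by blast
  note A = cube_avg_osc_sum[OF assms(1) u N(2)]
  show ?thesis
  proof (rule that[OF N(1)])
    fix x y assume x: "x \<notin> N" "y \<notin> N" "x \<noteq> y"
    define r where "r = dist x y"
    have r: "0 < r" using x by (simp add: r_def)
    let ?S = "\<lambda>x. osc_sum u x r"
    let ?c = "ennreal (2 ^ DIM('a))"
    have "ennreal \<bar>cube_avg u x r - cube_avg u y r\<bar> \<le> ennreal (1 / (r ^ DIM('a) * r ^ DIM('a))) * osc u x (ball_factor TYPE('a) * r)"
      by (rule cube_avg_diff[OF _ u]) (use r in \<open>auto simp: r_def\<close>)
    also have "\<dots> = (\<Sum>k<1. ennreal (1 / (r / 2 ^ k) ^ (2 * DIM('a))) * osc u x (ball_factor TYPE('a) * (r / 2 ^ k)))"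
      by (simp add: mult_2 power_add)
    also have "\<dots> \<le> ?S x"
      unfolding osc_sum_def by (rule sum_le_suminf) auto
    finally have 1: "ennreal \<bar>cube_avg u x r - cube_avg u y r\<bar> \<le> ?S x" .
    also have "1 * ?S x \<le> ?c * ?S x"
      by (intro mult_right_mono) (auto simp flip: ennreal_1 simp: one_le_power intro!: ennreal_leI)
    finally have 1: "ennreal \<bar>cube_avg u x r - cube_avg u y r\<bar> \<le> ?c * ?S x" by simp
    have "ennreal \<bar>u x - u y\<bar> \<le> ennreal (\<bar>cube_avg u x r - u x\<bar> + (\<bar>cube_avg u x r - cube_avg u y r\<bar> + \<bar>cube_avg u y r - u y\<bar>))"
      by (intro ennreal_leI) linarith
    also have "\<dots> = ennreal \<bar>cube_avg u x r - u x\<bar> + (ennreal \<bar>cube_avg u x r - cube_avg u y r\<bar> + ennreal \<bar>cube_avg u y r - u y\<bar>)"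
      by simp
    also have "\<dots> \<le> ?c * ?S x + (?c * ?S x + ?c * ?S y)"
      using x r by (intro add_mono A 1) auto
    also have "\<dots> \<le> ?c * ?S x + ?c * ?S x + (?c * ?S y + ?c * ?S y)"
      by (simp add: add.assoc add_increasing add_left_mono)
    also have "\<dots> = (?c + ?c) * (?S x + ?S y)"
      by (simp add: algebra_simps)
    also have "?c + ?c = ennreal (2 ^ (DIM('a) + 1))"
      by (simp flip: ennreal_plus)
    finally show "ennreal \<bar>u x - u y\<bar> \<le> ennreal (2 ^ (DIM('a) + 1)) * (osc_sum u x (dist x y) + osc_sum u y (dist x y))"
      by (simp add: r_def)
  next
    fix x assume x: "x \<notin> N"
    have "ennreal \<bar>cube_avg u x 1 - 0\<bar> \<le> ennreal (1 / 1) * (\<integral>\<^sup>+z. ennreal \<bar>u z - 0\<bar> * indicator (cube x 1) z \<partial>lborel)"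
      using average_minus_const[of "cube x 1" u 1 0] u by (simp add: emeasure_cube cube_avg_def)
    also have "\<dots> \<le> (\<integral>\<^sup>+z. ennreal \<bar>u z\<bar> * indicator (ball x (ball_factor TYPE('a))) z \<partial>lborel)"
      using cube_subset_ball[of 1 x x] by (auto intro!: nn_integral_mono split: split_indicator)
    finally have 1: "ennreal \<bar>cube_avg u x 1\<bar> \<le> \<dots>" by simp
    have "ennreal \<bar>u x\<bar> \<le> ennreal (\<bar>cube_avg u x 1\<bar> + \<bar>cube_avg u x 1 - u x\<bar>)"
      by (intro ennreal_leI) linarith
    also have "\<dots> = ennreal \<bar>cube_avg u x 1\<bar> + ennreal \<bar>cube_avg u x 1 - u x\<bar>"
      by simp
    also have "\<dots> \<le> (\<integral>\<^sup>+z. ennreal \<bar>u z\<bar> * indicator (ball x (ball_factor TYPE('a))) z \<partial>lborel) + ennreal (2 ^ DIM('a)) * osc_sum u x 1"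
      using x by (intro add_mono 1 A) auto
    finally show "ennreal \<bar>u x\<bar> \<le> \<dots>" .
  qed
qed


section \<open>Fractional seminorms and oscillation\<close>

lemma nn_integral_Jensen_on:
  assumes [measurable]: "f \<in> borel_measurable M" "A \<in> sets M"
    and V: "emeasure M A \<le> ennreal V" "0 < V" and p: "1 \<le> p"
  shows "ennpow (\<integral>\<^sup>+x. f x * indicator A x \<partial>M) p
    \<le> ennreal (2 powr p * V powr (p - 1)) * (\<integral>\<^sup>+x. ennpow (f x) p * indicator A x \<partial>M)"
proof -
  have sub: "A \<inter> space M = A"
    using sets.sets_into_space[OF assms(2)] by auto
  have "emeasure (restrict_space M A) (space (restrict_space M A)) \<le> ennreal V"
    using V by (simp add: emeasure_restrict_space space_restrict_space sub)
  moreover have "f \<in> borel_measurable (restrict_space M A)"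
    by (rule measurable_restrict_space1) simp
  ultimately have "ennpow (\<integral>\<^sup>+x. f x \<partial>restrict_space M A) p
    \<le> ennreal (2 powr p * V powr (p - 1)) * (\<integral>\<^sup>+x. ennpow (f x) p \<partial>restrict_space M A)"
    by (intro nn_integral_Jensen V p)
  then show ?thesis
    by (simp add: nn_integral_restrict_space sub)
qed

abbreviation gagliardo_kernel :: "real \<Rightarrow> real \<Rightarrow> ('a::euclidean_space \<Rightarrow> real) \<Rightarrow> 'a \<Rightarrow> 'a \<Rightarrow> ennreal" where
  "gagliardo_kernel s p u z w \<equiv> ennreal (\<bar>u z - u w\<bar> powr p / norm (z - w) powr (real DIM('a) + s * p))"

text \<open>Neither constant nor root is included, so that the energy is homogeneous of degree
  \<open>p\<close>. The integral is iterated, which allows null sets to be discarded in one variable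
  at a time.\<close>

definition gagliardo_energy :: "real \<Rightarrow> real \<Rightarrow> ('a::euclidean_space \<Rightarrow> real) \<Rightarrow> ennreal" where
  "gagliardo_energy s p u = (\<integral>\<^sup>+z. (\<integral>\<^sup>+w. gagliardo_kernel s p u z w \<partial>lborel) \<partial>lborel)"

definition Lp_energy :: "real \<Rightarrow> ('a::euclidean_space \<Rightarrow> real) \<Rightarrow> ennreal" where
  "Lp_energy p u = (\<integral>\<^sup>+z. ennreal (\<bar>u z\<bar> powr p) \<partial>lborel)"

text \<open>From \<open>a \<le> 1 + a powr p\<close>; it gives local integrability together with an
  explicit bound for functions of energy at most 1.\<close>

lemma nn_integral_le_Lp_energy:
  fixes u :: "'a::euclidean_space \<Rightarrow> real"
  assumes [measurable]: "u \<in> borel_measurable borel" "A \<in> sets borel" and p: "1 \<le> p" and u: "Lp_energy p u \<le> 1"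
  shows "(\<integral>\<^sup>+z. ennreal \<bar>u z\<bar> * indicator A z \<partial>lborel) \<le> emeasure lborel A + 1"
proof -
  have "\<bar>u z\<bar> \<le> 1 + \<bar>u z\<bar> powr p" for z
  proof (cases "\<bar>u z\<bar> \<le> 1")
    case False
    then have "\<bar>u z\<bar> powr 1 \<le> \<bar>u z\<bar> powr p" using p by (intro powr_mono) auto
    then show ?thesis using False by simp
  qed (simp add: add_increasing2)
  then have "ennreal \<bar>u z\<bar> \<le> 1 + ennreal (\<bar>u z\<bar> powr p)" for z
    by (metis ennreal_1 ennreal_leI ennreal_plus powr_ge_zero zero_le_one)
  then have "(\<integral>\<^sup>+z. ennreal \<bar>u z\<bar> * indicator A z \<partial>lborel) \<le> (\<integral>\<^sup>+z. indicator A z + ennreal (\<bar>u z\<bar> powr p) \<partial>lborel)"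
    by (intro nn_integral_mono) (auto split: split_indicator)
  also have "\<dots> = emeasure lborel A + Lp_energy p u"
    unfolding Lp_energy_def by (subst nn_integral_add) auto
  finally show ?thesis using u by (meson add_left_mono order_trans)
qed

lemma set_integrable_cube_Lp:
  fixes u :: "'a::euclidean_space \<Rightarrow> real"
  assumes [measurable]: "u \<in> borel_measurable borel" and p: "1 \<le> p" and u: "Lp_energy p u \<le> 1"
  shows "set_integrable lborel (cube y r) u"
  unfolding set_integrable_def
proof (rule integrableI_bounded)
  have "(\<integral>\<^sup>+z. ennreal (norm (indicator (cube y r) z *\<^sub>R u z)) \<partial>lborel) = (\<integral>\<^sup>+z. ennreal \<bar>u z\<bar> * indicator (cube y r) z \<partial>lborel)"
    by (intro nn_integral_cong) (auto split: split_indicator)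
  also have "\<dots> \<le> emeasure lborel (cube y r) + 1"
    by (intro nn_integral_le_Lp_energy[where p = p] p u) auto
  also have "\<dots> < \<infinity>"
    using emeasure_lborel_cbox_finite[of y "y + r *\<^sub>R One"] by (simp add: cube_def)
  finally show "(\<integral>\<^sup>+z. ennreal (norm (indicator (cube y r) z *\<^sub>R u z)) \<partial>lborel) < \<infinity>" .
qed measurable

text \<open>Jensen's inequality is applied once in each variable, which squares its
  constant.\<close>

lemma ball_double_Jensen:
  fixes K :: "'a::euclidean_space \<Rightarrow> 'a \<Rightarrow> ennreal"
  assumes [measurable]: "(\<lambda>(z, w). K z w) \<in> borel_measurable (borel \<Otimes>\<^sub>M borel)" and \<rho>: "0 < \<rho>" and p: "1 \<le> p"
  defines "V \<equiv> unit_ball_vol (real DIM('a)) * \<rho> ^ DIM('a)"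
  shows "ennpow (ball_double K x \<rho>) p
    \<le> ennreal ((2 powr p * V powr (p - 1))\<^sup>2) * ball_double (\<lambda>z w. ennpow (K z w) p) x \<rho>"
proof -
  let ?B = "ball x \<rho>"
  let ?c = "ennreal (2 powr p * V powr (p - 1))"
  have V: "0 < V" "emeasure lborel ?B \<le> ennreal V"
    using \<rho> by (auto simp: V_def emeasure_lborel_ball)
  have iter: "ball_double L x \<rho> = (\<integral>\<^sup>+z. (\<integral>\<^sup>+w. L z w * indicator ?B w \<partial>lborel) * indicator ?B z \<partial>lborel)"
    for L :: "'a \<Rightarrow> 'a \<Rightarrow> ennreal"
    unfolding ball_double_def by (intro nn_integral_cong) (auto split: split_indicator)
  have m: "(\<lambda>z. \<integral>\<^sup>+w. L z w * indicator ?B w \<partial>lborel) \<in> borel_measurable lborel"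
    if [measurable]: "(\<lambda>(z, w). L z w) \<in> borel_measurable (borel \<Otimes>\<^sub>M borel)" for L :: "'a \<Rightarrow> 'a \<Rightarrow> ennreal"
    unfolding indicator_ball_dist by measurable
  have "ennpow (ball_double K x \<rho>) p \<le> ?c * (\<integral>\<^sup>+z. ennpow (\<integral>\<^sup>+w. K z w * indicator ?B w \<partial>lborel) p * indicator ?B z \<partial>lborel)"
    unfolding iter by (intro nn_integral_Jensen_on V p m) auto
  also have "\<dots> \<le> ?c * (\<integral>\<^sup>+z. (?c * (\<integral>\<^sup>+w. ennpow (K z w) p * indicator ?B w \<partial>lborel)) * indicator ?B z \<partial>lborel)"
    by (intro mult_left_mono nn_integral_mono mult_right_mono nn_integral_Jensen_on V p) auto
  also have "\<dots> = ?c * (?c * ball_double (\<lambda>z w. ennpow (K z w) p) x \<rho>)"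
    unfolding iter mult.assoc by (subst nn_integral_cmult) 
      (use m[of "\<lambda>z w. ennpow (K z w) p"] in \<open>auto intro!: borel_measurable_times_ennreal borel_measurable_indicator\<close>)
  finally show ?thesis
    by (simp add: mult.assoc[symmetric] ennreal_mult[symmetric] power2_eq_square)
qed

text \<open>After Jensen's inequality each term is multiplied and divided by
  \<open>norm (z - w) powr (n + s * p)\<close>, and the multiplying factor is at most
  \<open>(2 * \<rho>) powr (n + s * p)\<close> in the ball. The exponent of \<open>\<rho>\<close>
  becomes \<open>(2 * n * (p - 1) + n + s * p) / p\<close>. The energy on the right stays localised
  to the ball: Morrey's bound only needs it to be at most 1, but the subcritical estimate integrates
  it over \<open>x\<close>.\<close>

lemma osc_gagliardo:
  assumes p: "1 \<le> p" and s: "0 < s"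
  obtains C where "0 < C" "\<And>(u::'a::euclidean_space \<Rightarrow> real) x \<rho>. u \<in> borel_measurable borel \<Longrightarrow> 0 < \<rho> \<Longrightarrow>
    osc u x \<rho> \<le> ennreal (C * \<rho> powr (2 * real DIM('a) + (s - real DIM('a) / p))) *
      ennpow (ball_double (gagliardo_kernel s p u) x \<rho>) (1 / p)"
proof -
  let ?n = "real DIM('a)" let ?V = "unit_ball_vol (real DIM('a))"
  define C0 where "C0 = (2 powr p * ?V powr (p - 1))\<^sup>2 * 2 powr (?n + s * p)"
  have V: "0 < ?V" by simp
  have C0: "0 < C0"
    unfolding C0_def by (intro mult_pos_pos zero_less_power) (use less_imp_neq[OF V] in auto)
  show ?thesis
  proof (rule that[of "C0 powr (1 / p)"])
    fix u :: "'a \<Rightarrow> real" and x :: 'a and \<rho> :: real assume [measurable]: "u \<in> borel_measurable borel" and \<rho>: "0 < \<rho>"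
    let ?F = "ball_double (gagliardo_kernel s p u) x \<rho>"
    let ?e = "2 * ?n + (s - ?n / p)"
    have le: "ennpow (ennreal \<bar>u z - u w\<bar>) p * (indicator (ball x \<rho>) z * indicator (ball x \<rho>) w)
        \<le> ennreal ((2 * \<rho>) powr (?n + s * p)) * (gagliardo_kernel s p u z w * (indicator (ball x \<rho>) z * indicator (ball x \<rho>) w))"
      for z w :: 'a
    proof (cases "z \<in> ball x \<rho> \<and> w \<in> ball x \<rho>")
      case True
      have "\<bar>u z - u w\<bar> powr p \<le> (2 * \<rho>) powr (?n + s * p) * (\<bar>u z - u w\<bar> powr p / norm (z - w) powr (?n + s * p))"
      proof (cases "z = w")
        case False
        have "norm (z - w) \<le> 2 * \<rho>"
          using True dist_triangle2[of z w x] by (simp add: dist_norm dist_commute)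
          (smt (verit) dist_commute dist_norm)
        then have "norm (z - w) powr (?n + s * p) \<le> (2 * \<rho>) powr (?n + s * p)"
          using s p by (intro powr_mono2) auto
        then have "\<bar>u z - u w\<bar> powr p * norm (z - w) powr (?n + s * p) \<le> \<bar>u z - u w\<bar> powr p * (2 * \<rho>) powr (?n + s * p)"
          by (intro mult_left_mono) auto
        then show ?thesis using False by (simp add: field_simps)
      qed simp
      then show ?thesis
        using True by (simp add: ennpow_ennreal ennreal_mult[symmetric] ennreal_leI)
    qed auto
    have "ennpow (osc u x \<rho>) p \<le> ennreal ((2 powr p * (?V * \<rho> ^ DIM('a)) powr (p - 1))\<^sup>2) *
        ball_double (\<lambda>z w. ennpow (ennreal \<bar>u z - u w\<bar>) p) x \<rho>"
      by (intro ball_double_Jensen \<rho> p) measurable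
    also have "ball_double (\<lambda>z w. ennpow (ennreal \<bar>u z - u w\<bar>) p) x \<rho> \<le> (\<integral>\<^sup>+z. (\<integral>\<^sup>+w. ennreal ((2 * \<rho>) powr (?n + s * p)) * (gagliardo_kernel s p u z w * (indicator (ball x \<rho>) z * indicator (ball x \<rho>) w)) \<partial>lborel) \<partial>lborel)"
      unfolding ball_double_def by (intro nn_integral_mono le)
    also have "\<dots> = ennreal ((2 * \<rho>) powr (?n + s * p)) * ?F"
      unfolding ball_double_def indicator_ball_dist by (simp add: nn_integral_cmult)
    finally have "ennpow (osc u x \<rho>) p \<le> ennreal ((2 powr p * (?V * \<rho> ^ DIM('a)) powr (p - 1))\<^sup>2 * (2 * \<rho>) powr (?n + s * p)) * ?F"
      by (simp add: ennreal_mult mult_left_mono mult.assoc)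
    also have "(2 powr p * (?V * \<rho> ^ DIM('a)) powr (p - 1))\<^sup>2 * (2 * \<rho>) powr (?n + s * p) = C0 * \<rho> powr (?e * p)"
    proof -
      have "((\<rho> ^ DIM('a)) powr (p - 1))\<^sup>2 = \<rho> powr (2 * ?n * (p - 1))"
        using \<rho> by (simp add: powr_powr power2_eq_square powr_add[symmetric] flip: powr_realpow)
          (simp add: algebra_simps)
      then have "((\<rho> ^ DIM('a)) powr (p - 1))\<^sup>2 * \<rho> powr (?n + s * p) = \<rho> powr (2 * ?n * (p - 1) + (?n + s * p))"
        by (simp add: powr_add)
      also have "2 * ?n * (p - 1) + (?n + s * p) = ?e * p"
        using p by (simp add: field_simps)
      finally show ?thesis
        using \<rho> by (simp add: C0_def powr_mult power_mult_distrib mult_ac)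
    qed
    finally have "ennpow (ennpow (osc u x \<rho>) p) (1 / p) \<le> ennpow (ennreal (C0 * \<rho> powr (?e * p)) * ?F) (1 / p)"
      using p by (intro ennpow_mono) auto
    also have "\<dots> = ennpow (ennreal (C0 * \<rho> powr (?e * p))) (1 / p) * ennpow ?F (1 / p)"
      using p by (intro ennpow_mult) auto
    also have "ennpow (ennreal (C0 * \<rho> powr (?e * p))) (1 / p) = ennreal (C0 powr (1 / p) * \<rho> powr ?e)"
      using p C0 by (simp add: ennpow_ennreal powr_mult powr_powr)
    finally show "osc u x \<rho> \<le> ennreal (C0 powr (1 / p) * \<rho> powr ?e) * ennpow ?F (1 / p)"
      using p by (simp add: ennpow_ennpow)
  qed (use C0 in simp)
qed

text \<open>The part \<open>2 * n\<close> of the exponent cancels the normalisation of the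
  oscillation, leaving \<open>\<alpha>\<close>. The factor \<open>\<phi>\<close> is constant for
  Morrey's bound and the root of the local energy for the subcritical estimate.\<close>

lemma osc_sum_le:
  fixes u :: "'a::euclidean_space \<Rightarrow> real"
  assumes "0 \<le> C" and osc: "\<And>\<rho>. 0 < \<rho> \<Longrightarrow> osc u x \<rho> \<le> ennreal (C * \<rho> powr (2 * real DIM('a) + \<alpha>)) * \<phi> \<rho>" and r: "0 < r"
  shows "osc_sum u x r \<le> (\<Sum>k. ennreal (C * ball_factor TYPE('a) powr (2 * real DIM('a) + \<alpha>) * (r / 2 ^ k) powr \<alpha>) *
           \<phi> (ball_factor TYPE('a) * (r / 2 ^ k)))"
  unfolding osc_sum_def
proof (intro suminf_le)
  fix k :: nat
  let ?\<kappa> = "ball_factor TYPE('a)"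
  define t where "t = r / 2 ^ k"
  have t: "0 < t" and \<kappa>: "0 < ?\<kappa>" using r ball_factor_pos by (auto simp: t_def)
  have "ennreal (1 / t ^ (2 * DIM('a))) * osc u x (?\<kappa> * t)
      \<le> ennreal (1 / t ^ (2 * DIM('a))) * (ennreal (C * (?\<kappa> * t) powr (2 * real DIM('a) + \<alpha>)) * \<phi> (?\<kappa> * t))"
    using t \<kappa> by (intro mult_left_mono osc) auto
  also have "\<dots> = ennreal (1 / t ^ (2 * DIM('a)) * (C * (?\<kappa> * t) powr (2 * real DIM('a) + \<alpha>))) * \<phi> (?\<kappa> * t)"
    using assms(1) t by (simp add: ennreal_mult[symmetric] mult.assoc[symmetric])
  also have "1 / t ^ (2 * DIM('a)) * (C * (?\<kappa> * t) powr (2 * real DIM('a) + \<alpha>)) = C * ?\<kappa> powr (2 * real DIM('a) + \<alpha>) * t powr \<alpha>"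
  proof -
    have "t powr (2 * real DIM('a) + \<alpha>) = t ^ (2 * DIM('a)) * t powr \<alpha>"
      using t by (simp add: powr_add flip: powr_realpow)
    then show ?thesis
      using t \<kappa> by (simp add: powr_mult)
  qed
  finally show "ennreal (1 / (r / 2 ^ k) ^ (2 * DIM('a))) * osc u x (?\<kappa> * (r / 2 ^ k))
     \<le> ennreal (C * ?\<kappa> powr (2 * real DIM('a) + \<alpha>) * (r / 2 ^ k) powr \<alpha>) * \<phi> (?\<kappa> * (r / 2 ^ k))"
    by (simp add: t_def)
qed auto

lemma dyadic_powr: "0 < (r::real) \<Longrightarrow> (r / 2 ^ k) powr \<alpha> = r powr \<alpha> * (2 powr (- \<alpha>)) ^ k"
  by (simp add: powr_divide powr_dyadic[symmetric] powr_minus field_simps)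
    (simp add: powr_powr mult.commute[of \<alpha>] flip: powr_realpow)

text \<open>The series is geometric with ratio \<open>2 powr (- \<alpha>)\<close>; this is where
  \<open>\<alpha> > 0\<close> enters Morrey's bound.\<close>

lemma osc_sum_Morrey:
  fixes u :: "'a::euclidean_space \<Rightarrow> real"
  assumes C: "0 \<le> C" and \<alpha>: "0 < \<alpha>" and osc: "\<And>\<rho>. 0 < \<rho> \<Longrightarrow> osc u x \<rho> \<le> ennreal (C * \<rho> powr (2 * real DIM('a) + \<alpha>))" and r: "0 < r"
  shows "osc_sum u x r \<le> ennreal (C * ball_factor TYPE('a) powr (2 * real DIM('a) + \<alpha>) / (1 - 2 powr (- \<alpha>)) * r powr \<alpha>)"
proof -
  let ?D = "C * ball_factor TYPE('a) powr (2 * real DIM('a) + \<alpha>)"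
  have "osc_sum u x r \<le> (\<Sum>k. ennreal (?D * (r / 2 ^ k) powr \<alpha>) * 1)"
    using osc by (intro osc_sum_le[where \<phi> = "\<lambda>_. 1"] C r) simp
  also have "\<dots> = (\<Sum>k. ennreal (?D * r powr \<alpha> * (2 powr (- \<alpha>)) ^ k))"
    using r by (simp add: dyadic_powr mult.assoc)
  also have "\<dots> = ennreal (?D * r powr \<alpha> / (1 - 2 powr (- \<alpha>)))"
    using \<alpha> C by (intro suminf_ennreal_geometric) (auto simp: powr_less_one)
  finally show ?thesis by simp
qed

text \<open>Every \<open>c k\<close> is at most the \<open>q\<close>-th root of the sum of all
  \<open>ennpow (c k) q\<close>, so the geometric weights can be summed directly. This works for
  every positive \<open>q\<close>.\<close>

lemma ennpow_suminf_le:
  assumes e: "0 < e" "e < 1" and q: "0 < q"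
  shows "ennpow (\<Sum>k. ennreal (e ^ k) * c k) q \<le> ennreal ((1 / (1 - e)) powr q) * (\<Sum>k. ennpow (c k) q)"
proof -
  define T where "T = ennpow (\<Sum>k. ennpow (c k) q) (1 / q)"
  have c: "c k \<le> T" for k
  proof -
    have "ennpow (c k) q = (\<Sum>k\<in>{k}. ennpow (c k) q)" by simp
    also have "\<dots> \<le> (\<Sum>k. ennpow (c k) q)" by (intro sum_le_suminf) auto
    finally have "ennpow (ennpow (c k) q) (1 / q) \<le> T"
      unfolding T_def using q by (intro ennpow_mono) auto
    then show ?thesis using q by (simp add: ennpow_ennpow)
  qed
  have "(\<Sum>k. ennreal (e ^ k) * c k) \<le> (\<Sum>k. ennreal (1 * e ^ k) * T)"
    by (intro suminf_le mult_mono) (auto simp: c)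
  also have "\<dots> = ennreal (1 / (1 - e)) * T"
    unfolding ennreal_suminf_multc by (subst suminf_ennreal_geometric) (use e in auto)
  finally have "ennpow (\<Sum>k. ennreal (e ^ k) * c k) q \<le> ennpow (ennreal (1 / (1 - e)) * T) q"
    using q by (intro ennpow_mono) auto
  also have "\<dots> = ennpow (ennreal (1 / (1 - e))) q * ennpow T q"
    by (rule ennpow_mult[OF q])
  also have "\<dots> = ennreal ((1 / (1 - e)) powr q) * (\<Sum>k. ennpow (c k) q)"
    using e q by (simp add: T_def ennpow_ennpow ennpow_ennreal)
  finally show ?thesis .
qed

lemma gagliardo_kernel_measurable [measurable]:
  fixes u :: "'a::euclidean_space \<Rightarrow> real"
  assumes [measurable]: "u \<in> borel_measurable borel"
  shows "(\<lambda>(z, w). gagliardo_kernel s p u z w) \<in> borel_measurable (borel \<Otimes>\<^sub>M borel)"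
  by measurable

text \<open>The \<open>k\<close>-th term, at scale \<open>\<rho> = r / 2 ^ k\<close>, is of size
  \<open>\<rho> powr \<alpha>\<close> times the \<open>p\<close>-th root of the local energy
  \<open>F k\<close>. As \<open>F k \<le> 1\<close> and \<open>q / p \<ge> 1\<close>, the
  \<open>q\<close>-th power of that root is at most \<open>F k\<close>, whose integral over
  \<open>x\<close> is of order \<open>\<rho> ^ n\<close>. In \<open>L^q\<close> the term is thus of
  size \<open>\<rho> powr (\<alpha> + n / q)\<close>, which can be summed even for negative
  \<open>\<alpha>\<close>.\<close>

lemma osc_sum_subcritical:
  assumes p: "1 \<le> p" "p \<le> q" and s: "0 < s" and \<delta>: "0 < s - real DIM('a) / p + real DIM('a) / q"
  obtains C where "0 < C" "\<And>(u::'a::euclidean_space \<Rightarrow> real) r. u \<in> borel_measurable borel \<Longrightarrow>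
    gagliardo_energy s p u \<le> 1 \<Longrightarrow> 0 < r \<Longrightarrow>
    (\<integral>\<^sup>+x. ennpow (osc_sum u x r) q \<partial>lborel) \<le> ennreal (C * r powr (q * (s - real DIM('a) / p + real DIM('a) / q)))"
proof -
  let ?n = "real DIM('a)" let ?\<kappa> = "ball_factor TYPE('a)"
  define \<alpha> where "\<alpha> = s - ?n / p"
  define \<delta> where "\<delta> = \<alpha> + ?n / q"
  \<comment> \<open>Half of the decay \<open>2 powr (- \<delta>)\<close> of the terms pays for the
    weights of the series; the other half, raised to the power \<open>q\<close>, remains as the
    ratio \<open>e powr q\<close>.\<close>
  define e where "e = 2 powr (- (\<delta> / 2))"
  have \<delta>: "0 < \<delta>" using \<delta> by (simp add: \<alpha>_def \<delta>_def)
  have e: "0 < e" "e < 1" using \<delta> by (auto simp: e_def powr_less_one)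
  have q: "0 < q" "1 \<le> q" using p by auto
  obtain C0 where C0: "0 < C0" "\<And>(u::'a \<Rightarrow> real) x \<rho>. u \<in> borel_measurable borel \<Longrightarrow> 0 < \<rho> \<Longrightarrow>
    osc u x \<rho> \<le> ennreal (C0 * \<rho> powr (2 * ?n + \<alpha>)) * ennpow (ball_double (gagliardo_kernel s p u) x \<rho>) (1 / p)"
    unfolding \<alpha>_def using osc_gagliardo[OF p(1) s] by blast
  define C1 where "C1 = C0 * ?\<kappa> powr (2 * ?n + \<alpha>)"
  define A where "A = C1 powr q * (unit_ball_vol ?n * ?\<kappa> ^ DIM('a))"
  define C where "C = (1 / (1 - e)) powr q * (A / (1 - e powr q))"
  have eq: "0 < e powr q" "e powr q < 1" using e q by (auto simp: powr_less_one powr01_less_one)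
  have C1: "0 < C1" using C0 ball_factor_pos[where 'a = 'a] by (simp add: C1_def)
  have A: "0 < A" using C1 ball_factor_pos[where 'a = 'a] by (simp add: A_def)
  show ?thesis
  proof (rule that[of C])
    show "0 < C" using A e eq by (simp add: C_def)
    fix u :: "'a \<Rightarrow> real" and r :: real
    assume [measurable]: "u \<in> borel_measurable borel" and G: "gagliardo_energy s p u \<le> 1" and r: "0 < r"
    define F where "F k x = ball_double (gagliardo_kernel s p u) x (?\<kappa> * (r / 2 ^ k))" for k :: nat and x
    have [measurable]: "F k \<in> borel_measurable borel" for k unfolding F_def by measurable
    have F1: "F k x \<le> 1" for k x
      using ball_double_le[of "gagliardo_kernel s p u" x] G unfolding F_def gagliardo_energy_def by (meson order_trans)
    have IF: "(\<integral>\<^sup>+x. F k x \<partial>lborel) \<le> ennreal (unit_ball_vol ?n * (?\<kappa> * (r / 2 ^ k)) ^ DIM('a))" for k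
    proof -
      have "(\<integral>\<^sup>+x. F k x \<partial>lborel) \<le> ennreal (unit_ball_vol ?n * (?\<kappa> * (r / 2 ^ k)) ^ DIM('a)) * gagliardo_energy s p u"
        unfolding F_def gagliardo_energy_def using r ball_factor_pos[where 'a = 'a]
        by (intro nn_integral_ball_double gagliardo_kernel_measurable) (auto simp: less_imp_le)
      also have "\<dots> \<le> ennreal (unit_ball_vol ?n * (?\<kappa> * (r / 2 ^ k)) ^ DIM('a)) * 1"
        by (intro mult_left_mono G) auto
      finally show ?thesis by (simp only: mult_1_right)
    qed
    define c where "c k x = ennreal (C1 * (r / 2 ^ k) powr \<alpha> / e ^ k) * ennpow (F k x) (1 / p)" for k x
    have le: "osc_sum u x r \<le> (\<Sum>k. ennreal (e ^ k) * c k x)" for x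
    proof -
      have "osc_sum u x r \<le> (\<Sum>k. ennreal (C1 * (r / 2 ^ k) powr \<alpha>) * ennpow (F k x) (1 / p))"
        unfolding C1_def F_def using C0 r by (intro osc_sum_le) auto
      also have "\<dots> = (\<Sum>k. ennreal (e ^ k) * c k x)"
        using e C1 by (intro suminf_cong) (simp add: c_def mult.assoc[symmetric] ennreal_mult[symmetric])
      finally show ?thesis .
    qed
    have cq: "ennpow (c k x) q \<le> ennreal ((C1 * (r / 2 ^ k) powr \<alpha> / e ^ k) powr q) * F k x" for k x
    proof -
      have "ennpow (c k x) q = ennreal ((C1 * (r / 2 ^ k) powr \<alpha> / e ^ k) powr q) * ennpow (F k x) (1 / p * q)"
        using q e C1 by (simp add: c_def ennpow_mult ennpow_ennreal ennpow_ennpow)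
      moreover have "ennpow (F k x) (1 / p * q) \<le> ennreal (1 powr (1 / p * q - 1)) * ennpow (F k x) 1"
        using p F1[of k x] by (intro ennpow_interpolate) auto
      ultimately show ?thesis by (simp add: mult_left_mono)
    qed
    have coef: "(C1 * (r / 2 ^ k) powr \<alpha> / e ^ k) powr q * (unit_ball_vol ?n * (?\<kappa> * (r / 2 ^ k)) ^ DIM('a))
        = A * r powr (q * \<delta>) * (e powr q) ^ k" for k
    proof -
      define t where "t = r / 2 ^ k"
      have t: "0 < t" using r by (simp add: t_def)
      have ek: "(e ^ k) powr q = (e powr q) ^ k"
        using e by (simp add: powr_powr mult.commute flip: powr_realpow)
      have "(C1 * t powr \<alpha> / e ^ k) powr q * (unit_ball_vol ?n * (?\<kappa> * t) ^ DIM('a))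
          = A * (t powr (\<alpha> * q) * t ^ DIM('a)) / (e powr q) ^ k"
        using t e C1 by (simp add: A_def powr_mult powr_divide powr_powr power_mult_distrib ek)
      also have "t powr (\<alpha> * q) * t ^ DIM('a) = t powr (q * \<delta>)"
        using t q by (simp add: \<delta>_def algebra_simps powr_add flip: powr_realpow)
      also have "t powr (q * \<delta>) = r powr (q * \<delta>) * ((e powr q) ^ k * (e powr q) ^ k)"
        unfolding t_def dyadic_powr[OF r] e_def
        by (simp add: powr_powr powr_add[symmetric] mult.commute[of \<delta>] flip: power_mult_distrib)
      finally show ?thesis using e by (simp add: t_def)
    qed
    have [measurable]: "c k \<in> borel_measurable borel" for k unfolding c_def by measurable
    have "(\<integral>\<^sup>+x. ennpow (osc_sum u x r) q \<partial>lborel)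
        \<le> (\<integral>\<^sup>+x. ennreal ((1 / (1 - e)) powr q) * (\<Sum>k. ennpow (c k x) q) \<partial>lborel)"
    proof (rule nn_integral_mono)
      fix x
      have "ennpow (osc_sum u x r) q \<le> ennpow (\<Sum>k. ennreal (e ^ k) * c k x) q"
        using q by (intro ennpow_mono le) auto
      also have "\<dots> \<le> ennreal ((1 / (1 - e)) powr q) * (\<Sum>k. ennpow (c k x) q)"
        using e q by (intro ennpow_suminf_le)
      finally show "ennpow (osc_sum u x r) q \<le> \<dots>" .
    qed
    also have "\<dots> = ennreal ((1 / (1 - e)) powr q) * (\<Sum>k. \<integral>\<^sup>+x. ennpow (c k x) q \<partial>lborel)"
      by (simp add: nn_integral_cmult nn_integral_suminf)
    also have "\<dots> \<le> ennreal ((1 / (1 - e)) powr q) * (\<Sum>k. ennreal (A * r powr (q * \<delta>) * (e powr q) ^ k))"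
    proof (intro mult_left_mono suminf_le)
      fix k
      have "(\<integral>\<^sup>+x. ennpow (c k x) q \<partial>lborel) \<le> (\<integral>\<^sup>+x. ennreal ((C1 * (r / 2 ^ k) powr \<alpha> / e ^ k) powr q) * F k x \<partial>lborel)"
        by (intro nn_integral_mono cq)
      also have "\<dots> \<le> ennreal ((C1 * (r / 2 ^ k) powr \<alpha> / e ^ k) powr q) * ennreal (unit_ball_vol ?n * (?\<kappa> * (r / 2 ^ k)) ^ DIM('a))"
        by (subst nn_integral_cmult) (measurable, intro mult_left_mono IF, simp)
      also have "\<dots> = ennreal (A * r powr (q * \<delta>) * (e powr q) ^ k)"
        using coef[of k] r ball_factor_pos[where 'a = 'a] by (subst ennreal_mult[symmetric]) auto
      finally show "(\<integral>\<^sup>+x. ennpow (c k x) q \<partial>lborel) \<le> \<dots>" .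
    qed auto
    also have "(\<Sum>k. ennreal (A * r powr (q * \<delta>) * (e powr q) ^ k)) = ennreal (A * r powr (q * \<delta>) / (1 - e powr q))"
      using A eq by (intro suminf_ennreal_geometric) auto
    also have "ennreal ((1 / (1 - e)) powr q) * \<dots> = ennreal (C * r powr (q * \<delta>))"
      using A eq e by (subst ennreal_mult[symmetric]) (auto simp: C_def mult_ac)
    finally show "(\<integral>\<^sup>+x. ennpow (osc_sum u x r) q \<partial>lborel) \<le> ennreal (C * r powr (q * (s - ?n / p + ?n / q)))"
      by (simp add: \<delta>_def \<alpha>_def)
  qed
qed


section \<open>Translates\<close>

lemma divide_powr: "x / y powr c = y powr (- c) * (x::real)"
  by (simp add: powr_minus divide_inverse mult.commute)

lemma AE_not_negligible: "negligible N \<Longrightarrow> AE x in lborel. x \<notin> N"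
  by (metis AE_completion_iff AE_not_in Collect_mem_eq negligible_iff_null_sets)

lemma nn_integral_translate:
  fixes f :: "'a::euclidean_space \<Rightarrow> ennreal"
  assumes [measurable]: "f \<in> borel_measurable borel"
  shows "(\<integral>\<^sup>+x. f (x + h) \<partial>lborel) = (\<integral>\<^sup>+x. f x \<partial>lborel)"
proof -
  have "(\<integral>\<^sup>+x. f x \<partial>lborel) = (\<integral>\<^sup>+x. f x \<partial>distr lborel borel ((+) h))"
    by (simp add: lborel_distr_plus)
  also have "\<dots> = (\<integral>\<^sup>+x. f (h + x) \<partial>lborel)"
    by (subst nn_integral_distr) auto
  finally show ?thesis by (simp add: add.commute)
qed

lemma AE_translate:
  fixes N :: "'a::euclidean_space set"
  assumes "negligible N"
  shows "AE x in lborel. x + h \<notin> N"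
proof -
  have "negligible ((+) (- h) ` N)"
    by (rule negligible_translation[OF assms])
  then have "AE x in lborel. x \<notin> (+) (- h) ` N"
    by (rule AE_not_negligible)
  then show ?thesis
    by (rule eventually_mono) (auto simp: image_iff algebra_simps)
qed

definition translate_energy :: "real \<Rightarrow> ('a::euclidean_space \<Rightarrow> real) \<Rightarrow> 'a \<Rightarrow> ennreal" where
  "translate_energy q u h = (\<integral>\<^sup>+x. ennreal (\<bar>u (x + h) - u x\<bar> powr q) \<partial>lborel)"

lemma translate_energy_measurable [measurable]:
  assumes [measurable]: "u \<in> borel_measurable borel"
  shows "translate_energy q u \<in> borel_measurable borel"
  unfolding translate_energy_def by measurable

text \<open>The substitution \<open>w = z + h\<close> writes the energy as a weighted integral of
  translate energies, so bounds on translates become bounds on seminorms.\<close>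

lemma gagliardo_energy_translates:
  fixes u :: "'a::euclidean_space \<Rightarrow> real"
  assumes [measurable]: "u \<in> borel_measurable borel"
  shows "gagliardo_energy s p u = (\<integral>\<^sup>+h. ennreal (norm h powr (- (real DIM('a) + s * p))) * translate_energy p u h \<partial>lborel)"
proof -
  have "gagliardo_energy s p u = (\<integral>\<^sup>+z. (\<integral>\<^sup>+h. gagliardo_kernel s p u z (h + z) \<partial>lborel) \<partial>lborel)"
    unfolding gagliardo_energy_def by (intro nn_integral_cong nn_integral_translate[symmetric]) measurable
  also have "\<dots> = (\<integral>\<^sup>+z. (\<integral>\<^sup>+h. ennreal (norm h powr (- (real DIM('a) + s * p))) * ennreal (\<bar>u (z + h) - u z\<bar> powr p) \<partial>lborel) \<partial>lborel)"
    by (intro nn_integral_cong)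
      (simp add: divide_powr ennreal_mult[symmetric] abs_minus_commute add.commute del: minus_add_distrib)
  also have "\<dots> = (\<integral>\<^sup>+h. (\<integral>\<^sup>+z. ennreal (norm h powr (- (real DIM('a) + s * p))) * ennreal (\<bar>u (z + h) - u z\<bar> powr p) \<partial>lborel) \<partial>lborel)"
    by (subst lborel_pair.Fubini') measurable
  also have "\<dots> = (\<integral>\<^sup>+h. ennreal (norm h powr (- (real DIM('a) + s * p))) * translate_energy p u h \<partial>lborel)"
    unfolding translate_energy_def by (intro nn_integral_cong nn_integral_cmult) measurable
  finally show ?thesis .
qed

lemma translate_energy_le_Lp:
  fixes u :: "'a::euclidean_space \<Rightarrow> real"
  assumes [measurable]: "u \<in> borel_measurable borel" and q: "0 < q"
  shows "translate_energy q u h \<le> ennreal (2 powr (q + 1)) * Lp_energy q u"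
proof -
  have "ennreal (\<bar>u (x + h) - u x\<bar> powr q) \<le> ennreal (2 powr q) * (ennreal (\<bar>u (x + h)\<bar> powr q) + ennreal (\<bar>u x\<bar> powr q))" for x
  proof -
    have "ennreal (\<bar>u (x + h) - u x\<bar> powr q) \<le> ennpow (ennreal \<bar>u (x + h)\<bar> + ennreal \<bar>u x\<bar>) q"
      unfolding ennreal_plus[OF abs_ge_zero abs_ge_zero, symmetric]
      using q by (subst ennpow_ennreal) (auto intro!: ennreal_leI powr_mono2)
    also have "\<dots> \<le> ennreal (2 powr q) * (ennpow (ennreal \<bar>u (x + h)\<bar>) q + ennpow (ennreal \<bar>u x\<bar>) q)"
      by (rule ennpow_add_le[OF q])
    finally show ?thesis by (simp add: ennpow_ennreal)
  qed
  then have "translate_energy q u h \<le> (\<integral>\<^sup>+x. ennreal (2 powr q) * (ennreal (\<bar>u (x + h)\<bar> powr q) + ennreal (\<bar>u x\<bar> powr q)) \<partial>lborel)"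
    unfolding translate_energy_def by (intro nn_integral_mono) auto
  also have "\<dots> = ennreal (2 powr q) * ((\<integral>\<^sup>+x. ennreal (\<bar>u (x + h)\<bar> powr q) \<partial>lborel) + Lp_energy q u)"
    unfolding Lp_energy_def by (simp add: nn_integral_cmult nn_integral_add)
  also have "(\<integral>\<^sup>+x. ennreal (\<bar>u (x + h)\<bar> powr q) \<partial>lborel) = Lp_energy q u"
    unfolding Lp_energy_def by (subst nn_integral_translate[symmetric, where h = h]) auto
  also have "ennreal (2 powr q) * (Lp_energy q u + Lp_energy q u) = ennreal (2 powr q) * 2 * Lp_energy q u"
    by (simp add: mult_2[symmetric] mult.assoc)
  also have "ennreal (2 powr q) * 2 = ennreal (2 powr (q + 1))"
    by (simp add: powr_add ennreal_mult'')
  finally show ?thesis .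
qed

text \<open>Small and large \<open>h\<close> need different information. Near 0 the decay of the
  translates leaves the power \<open>q * (\<delta> - t) - n\<close>, integrable because
  \<open>t < \<delta>\<close>; for \<open>norm h > 1\<close> the \<open>L^q\<close> norm leaves
  \<open>- (q * t) - n\<close>, integrable because \<open>t > 0\<close>.\<close>

lemma gagliardo_energy_of_translates:
  fixes u :: "'a::euclidean_space \<Rightarrow> real"
  assumes [measurable]: "u \<in> borel_measurable borel" and q: "0 < q" and t: "0 < t" "t < \<delta>"
    and A: "0 \<le> A" "\<And>h. h \<noteq> 0 \<Longrightarrow> norm h \<le> 1 \<Longrightarrow> translate_energy q u h \<le> ennreal (A * norm h powr (q * \<delta>))"
    and B: "0 \<le> B" "Lp_energy q u \<le> ennreal B"
  shows "gagliardo_energy t q u \<le> ennreal (A * kernel_const DIM('a) (q * (\<delta> - t)) + 2 powr (q + 1) * B * kernel_const DIM('a) (q * t))"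
proof -
  let ?n = "real DIM('a)"
  let ?k1 = "\<lambda>h::'a. ennreal (norm h powr (q * (\<delta> - t) - ?n)) * indicator {h. norm h \<le> 1} h"
  let ?k2 = "\<lambda>h::'a. ennreal (norm h powr (- (q * t) - ?n)) * indicator {h. 1 \<le> norm h} h"
  have le: "ennreal (norm h powr (- (?n + t * q))) * translate_energy q u h
      \<le> ennreal A * ?k1 h + ennreal (2 powr (q + 1) * B) * ?k2 h" for h
  proof (cases "h = 0")
    case False
    show ?thesis
    proof (cases "norm h \<le> 1")
      case True
      have "ennreal (norm h powr (- (?n + t * q))) * translate_energy q u h
          \<le> ennreal (norm h powr (- (?n + t * q))) * ennreal (A * norm h powr (q * \<delta>))"
        by (intro mult_left_mono A False True) auto
      also have "\<dots> = ennreal (A * (norm h powr (- (?n + t * q)) * norm h powr (q * \<delta>)))"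
        using A by (subst ennreal_mult[symmetric]) (auto simp: mult_ac)
      also have "norm h powr (- (?n + t * q)) * norm h powr (q * \<delta>) = norm h powr (q * (\<delta> - t) - ?n)"
        by (simp add: powr_add[symmetric] algebra_simps)
      finally show ?thesis
        using True A by (simp add: ennreal_mult add_increasing2)
    next
      case False
      have "translate_energy q u h \<le> ennreal (2 powr (q + 1)) * ennreal B"
        by (rule order_trans[OF translate_energy_le_Lp]) (use q B in \<open>auto intro: mult_left_mono\<close>)
      then have "ennreal (norm h powr (- (?n + t * q))) * translate_energy q u h
          \<le> ennreal (norm h powr (- (?n + t * q))) * (ennreal (2 powr (q + 1)) * ennreal B)"
        by (rule mult_left_mono) simp
      moreover have e: "- (?n + t * q) = - (q * t) - ?n" by simp
      ultimately show ?thesis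
        using False B unfolding e by (simp add: ennreal_mult mult_ac)
    qed
  qed simp
  have "gagliardo_energy t q u \<le> (\<integral>\<^sup>+h. ennreal A * ?k1 h + ennreal (2 powr (q + 1) * B) * ?k2 h \<partial>lborel)"
    unfolding gagliardo_energy_translates[OF assms(1)] by (intro nn_integral_mono le)
  also have "\<dots> = ennreal A * (\<integral>\<^sup>+h. ?k1 h \<partial>lborel) + ennreal (2 powr (q + 1) * B) * (\<integral>\<^sup>+h. ?k2 h \<partial>lborel)"
    by (subst nn_integral_add, measurable) (simp add: nn_integral_cmult)
  also have "\<dots> \<le> ennreal A * ennreal (kernel_const DIM('a) (q * (\<delta> - t)) * 1 powr (q * (\<delta> - t)))
      + ennreal (2 powr (q + 1) * B) * ennreal (kernel_const DIM('a) (q * t) * 1 powr (- (q * t)))"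
    using q t by (intro add_mono mult_left_mono kernel_ball_bound kernel_outside_bound) auto
  also have "\<dots> = ennreal (A * kernel_const DIM('a) (q * (\<delta> - t)) + 2 powr (q + 1) * B * kernel_const DIM('a) (q * t))"
    using A B q t kernel_const_nonneg[of "q * (\<delta> - t)" "DIM('a)"] kernel_const_nonneg[of "q * t" "DIM('a)"]
    by (simp add: ennreal_mult)
  finally show ?thesis .
qed

section \<open>Subcritical and critical fractional embeddings\<close>

lemma nn_integral_ball_average:
  fixes f :: "'a::euclidean_space \<Rightarrow> ennreal"
  assumes [measurable]: "f \<in> borel_measurable borel" and "0 \<le> \<rho>"
  shows "(\<integral>\<^sup>+x. (\<integral>\<^sup>+z. f z * indicator (ball x \<rho>) z \<partial>lborel) \<partial>lborel)
    = ennreal (unit_ball_vol (real DIM('a)) * \<rho> ^ DIM('a)) * (\<integral>\<^sup>+z. f z \<partial>lborel)"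
proof -
  have "(\<integral>\<^sup>+x. (\<integral>\<^sup>+z. f z * indicator (ball x \<rho>) z \<partial>lborel) \<partial>lborel) = (\<integral>\<^sup>+z. (\<integral>\<^sup>+x. f z * indicator (ball x \<rho>) z \<partial>lborel) \<partial>lborel)"
    unfolding indicator_ball_dist by (subst lborel_pair.Fubini') (auto simp: split_beta')
  also have "\<dots> = (\<integral>\<^sup>+z. f z * ennreal (unit_ball_vol (real DIM('a)) * \<rho> ^ DIM('a)) \<partial>lborel)"
  proof (rule nn_integral_cong)
    fix z :: 'a
    have "(\<integral>\<^sup>+x. f z * indicator (ball x \<rho>) z \<partial>lborel) = (\<integral>\<^sup>+x. f z * indicator (ball z \<rho>) x \<partial>lborel)"
      by (simp add: indicator_ball_dist dist_commute)
    then show "(\<integral>\<^sup>+x. f z * indicator (ball x \<rho>) z \<partial>lborel) = f z * ennreal (unit_ball_vol (real DIM('a)) * \<rho> ^ DIM('a))"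
      using assms(2) by (simp add: nn_integral_cmult_indicator emeasure_lborel_ball)
  qed
  finally show ?thesis by (simp add: nn_integral_multc mult.commute)
qed

text \<open>Translates follow from the pointwise bound with the oscillation sums at
  \<open>r = norm h\<close>. The \<open>L^q\<close> norm uses scale 1: the oscillation sum is
  treated in the same way, and the local integral of \<open>\<bar>u\<bar>\<close> is interpolated
  between its sup bound \<open>V + 1\<close> and \<open>L^p\<close>.\<close>

lemma subcritical_bounds:
  assumes p: "1 \<le> p" "p \<le> q" and s: "0 < s" and \<delta>: "\<delta> = s - real DIM('a) / p + real DIM('a) / q" "0 < \<delta>"
  obtains C where "0 < C" "\<And>(u::'a::euclidean_space \<Rightarrow> real). u \<in> borel_measurable borel \<Longrightarrow>
    Lp_energy p u \<le> 1 \<Longrightarrow> gagliardo_energy s p u \<le> 1 \<Longrightarrow>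
    Lp_energy q u \<le> ennreal C \<and> (\<forall>h. h \<noteq> 0 \<longrightarrow> translate_energy q u h \<le> ennreal (C * norm h powr (q * \<delta>)))"
proof -
  let ?n = "DIM('a)"
  let ?\<kappa> = "ball_factor TYPE('a)"
  have q: "0 < q" "1 \<le> q" using p by auto
  obtain C0 where C0: "0 < C0" "\<And>(u::'a \<Rightarrow> real) r. u \<in> borel_measurable borel \<Longrightarrow>
    gagliardo_energy s p u \<le> 1 \<Longrightarrow> 0 < r \<Longrightarrow>
    (\<integral>\<^sup>+x. ennpow (osc_sum u x r) q \<partial>lborel) \<le> ennreal (C0 * r powr (q * \<delta>))"
    using osc_sum_subcritical[where 'a = 'a, OF p s] \<delta> by metis
  define V where "V = unit_ball_vol (real ?n) * ?\<kappa> ^ ?n"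
  have V: "0 < V" using ball_factor_pos[where 'a = 'a] by (simp add: V_def)
  define A where "A = (2 ^ (?n + 1)) powr q * 2 powr q * (2 * C0)"
  define B where "B = 2 powr q * ((V + 1) powr (q - p) * (2 powr p * V powr (p - 1) * V) + (2 ^ ?n) powr q * C0)"
  have AB: "0 \<le> A" "0 \<le> B" using C0 V by (auto simp: A_def B_def)
  show ?thesis
  proof (rule that[of "A + B + 1"])
    fix u :: "'a \<Rightarrow> real"
    assume um [measurable]: "u \<in> borel_measurable borel" and u: "Lp_energy p u \<le> 1" and G: "gagliardo_energy s p u \<le> 1"
    obtain N where N: "negligible N"
      "\<And>x y. x \<notin> N \<Longrightarrow> y \<notin> N \<Longrightarrow> x \<noteq> y \<Longrightarrow>
         ennreal \<bar>u x - u y\<bar> \<le> ennreal (2 ^ (?n + 1)) * (osc_sum u x (dist x y) + osc_sum u y (dist x y))"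
      "\<And>x. x \<notin> N \<Longrightarrow> ennreal \<bar>u x\<bar> \<le>
         (\<integral>\<^sup>+z. ennreal \<bar>u z\<bar> * indicator (ball x ?\<kappa>) z \<partial>lborel) + ennreal (2 ^ ?n) * osc_sum u x 1"
      using pointwise_osc_sum[OF um set_integrable_cube_Lp[OF um p(1) u]] by blast
    have "translate_energy q u h \<le> ennreal (A * norm h powr (q * \<delta>))" if h: "h \<noteq> 0" for h
    proof -
      let ?S = "\<lambda>x. ennpow (osc_sum u x (norm h)) q"
      let ?c = "ennreal ((2 ^ (?n + 1)) powr q * 2 powr q)"
      have "translate_energy q u h \<le> (\<integral>\<^sup>+x. ?c * (?S (x + h) + ?S x) \<partial>lborel)"
        unfolding translate_energy_def
      proof (rule nn_integral_mono_AE)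
        show "AE x in lborel. ennreal (\<bar>u (x + h) - u x\<bar> powr q) \<le> ?c * (?S (x + h) + ?S x)"
          using AE_not_negligible[OF N(1)] AE_translate[OF N(1), of h]
        proof eventually_elim
          case (elim x)
          have "ennreal (\<bar>u (x + h) - u x\<bar> powr q) = ennpow (ennreal \<bar>u (x + h) - u x\<bar>) q"
            by (simp add: ennpow_ennreal)
          also have "\<dots> \<le> ennpow (ennreal (2 ^ (?n + 1)) * (osc_sum u (x + h) (norm h) + osc_sum u x (norm h))) q"
            using N(2)[of "x + h" x] elim h q by (intro ennpow_mono) (auto simp: dist_norm)
          also have "\<dots> = ennreal ((2 ^ (?n + 1)) powr q) * ennpow (osc_sum u (x + h) (norm h) + osc_sum u x (norm h)) q"
            using q by (simp only: ennpow_mult) (simp add: ennpow_ennreal)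
          also have "\<dots> \<le> ennreal ((2 ^ (?n + 1)) powr q) * (ennreal (2 powr q) * (?S (x + h) + ?S x))"
            by (intro mult_left_mono ennpow_add_le q) auto
          finally show ?case by (simp add: ennreal_mult mult.assoc)
        qed
      qed
      also have "\<dots> = ?c * ((\<integral>\<^sup>+x. ?S (x + h) \<partial>lborel) + (\<integral>\<^sup>+x. ?S x \<partial>lborel))"
        by (simp add: nn_integral_cmult nn_integral_add)
      also have "(\<integral>\<^sup>+x. ?S (x + h) \<partial>lborel) = (\<integral>\<^sup>+x. ?S x \<partial>lborel)"
        by (rule nn_integral_translate) measurable
      also have "?c * ((\<integral>\<^sup>+x. ?S x \<partial>lborel) + (\<integral>\<^sup>+x. ?S x \<partial>lborel))
          \<le> ?c * (ennreal (C0 * norm h powr (q * \<delta>)) + ennreal (C0 * norm h powr (q * \<delta>)))"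
        using h by (intro mult_left_mono add_mono C0(2) um G) auto
      also have "\<dots> = ennreal (A * norm h powr (q * \<delta>))"
        using C0(1) by (simp add: A_def ennreal_mult[symmetric] ennreal_plus[symmetric] mult_ac del: ennreal_plus)
      finally show ?thesis .
    qed
    moreover have "Lp_energy q u \<le> ennreal B"
    proof -
      let ?J = "\<lambda>x. \<integral>\<^sup>+z. ennreal \<bar>u z\<bar> * indicator (ball x ?\<kappa>) z \<partial>lborel"
      let ?P = "\<lambda>x. \<integral>\<^sup>+z. ennreal (\<bar>u z\<bar> powr p) * indicator (ball x ?\<kappa>) z \<partial>lborel"
      let ?S = "\<lambda>x. ennpow (osc_sum u x 1) q"
      let ?c1 = "(V + 1) powr (q - p) * (2 powr p * V powr (p - 1))"
      let ?c2 = "(2 ^ ?n) powr q"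
      have ball: "emeasure lborel (ball x ?\<kappa>) = ennreal V" for x :: 'a
        using ball_factor_pos[where 'a = 'a] by (simp add: V_def emeasure_lborel_ball less_imp_le)
      have J: "ennpow (?J x) q \<le> ennreal ?c1 * ?P x" for x
      proof -
        have "?J x \<le> emeasure lborel (ball x ?\<kappa>) + 1"
          by (intro nn_integral_le_Lp_energy[where p = p] p u) auto
        then have "?J x \<le> ennreal (V + 1)"
          using V by (simp add: ball)
        then have "ennpow (?J x) q \<le> ennreal ((V + 1) powr (q - p)) * ennpow (?J x) p"
          using V p by (intro ennpow_interpolate) auto
        also have "ennpow (?J x) p \<le> ennreal (2 powr p * V powr (p - 1)) * (\<integral>\<^sup>+z. ennpow (ennreal \<bar>u z\<bar>) p * indicator (ball x ?\<kappa>) z \<partial>lborel)"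
          using V p by (intro nn_integral_Jensen_on) (auto simp: ball)
        finally show ?thesis
          by (simp add: mult_left_mono ennpow_ennreal ennreal_mult mult.assoc)
      qed
      have [measurable]: "?P \<in> borel_measurable borel"
        unfolding indicator_ball_dist by measurable
      have "Lp_energy q u \<le> (\<integral>\<^sup>+x. ennreal (2 powr q) * (ennreal ?c1 * ?P x + ennreal ?c2 * ?S x) \<partial>lborel)"
        unfolding Lp_energy_def
      proof (rule nn_integral_mono_AE)
        show "AE x in lborel. ennreal (\<bar>u x\<bar> powr q) \<le> ennreal (2 powr q) * (ennreal ?c1 * ?P x + ennreal ?c2 * ?S x)"
          using AE_not_negligible[OF N(1)]
        proof eventually_elim
          case (elim x)
          have "ennreal (\<bar>u x\<bar> powr q) = ennpow (ennreal \<bar>u x\<bar>) q"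
            by (simp add: ennpow_ennreal)
          also have "\<dots> \<le> ennpow (?J x + ennreal (2 ^ ?n) * osc_sum u x 1) q"
            using q by (intro ennpow_mono N(3) elim) auto
          also have "\<dots> \<le> ennreal (2 powr q) * (ennpow (?J x) q + ennpow (ennreal (2 ^ ?n) * osc_sum u x 1) q)"
            by (rule ennpow_add_le[OF q(1)])
          also have "ennpow (ennreal (2 ^ ?n) * osc_sum u x 1) q = ennreal ?c2 * ?S x"
            using q by (simp only: ennpow_mult) (simp add: ennpow_ennreal)
          finally show ?case
            by (rule order_trans) (intro mult_left_mono add_mono J order_refl, simp)
        qed
      qed
      also have "\<dots> = ennreal (2 powr q) * (ennreal ?c1 * (\<integral>\<^sup>+x. ?P x \<partial>lborel) + ennreal ?c2 * (\<integral>\<^sup>+x. ?S x \<partial>lborel))"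
        by (simp add: nn_integral_cmult nn_integral_add)
      also have "\<dots> \<le> ennreal (2 powr q) * (ennreal ?c1 * ennreal V + ennreal ?c2 * ennreal C0)"
      proof (intro mult_left_mono add_mono)
        have "(\<integral>\<^sup>+x. ?P x \<partial>lborel) = ennreal V * Lp_energy p u"
          unfolding V_def Lp_energy_def using ball_factor_pos[where 'a = 'a] by (intro nn_integral_ball_average) auto
        also have "\<dots> \<le> ennreal V * 1" by (intro mult_left_mono u) auto
        finally show "(\<integral>\<^sup>+x. ?P x \<partial>lborel) \<le> ennreal V" by simp
        show "(\<integral>\<^sup>+x. ?S x \<partial>lborel) \<le> ennreal C0"
          using C0(2)[OF um G, of 1] by simp
      qed auto
      also have "\<dots> = ennreal B"
        using V C0(1) by (simp add: B_def ennreal_mult[symmetric] ennreal_plus[symmetric] mult.assoc del: ennreal_plus)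
      finally show ?thesis .
    qed
    moreover have "A * norm h powr (q * \<delta>) \<le> (A + B + 1) * norm h powr (q * \<delta>)" for h :: 'a
      using AB by (intro mult_right_mono) auto
    ultimately show "Lp_energy q u \<le> ennreal (A + B + 1) \<and>
        (\<forall>h. h \<noteq> 0 \<longrightarrow> translate_energy q u h \<le> ennreal ((A + B + 1) * norm h powr (q * \<delta>)))"
      using AB by (meson add_increasing add_increasing2 ennreal_leI order_refl order_trans zero_le_one)
  qed (use AB in auto)
qed

section \<open>Hoelder bounds almost everywhere and the critical fractional case\<close>

text \<open>A null set is allowed because the pointwise estimates hold only off one and integrals do
  not see it; a continuous representative is constructed only for targets with
  \<open>q = \<infinity>\<close>. One constant bounds both the Hoelder quotient and the function
  itself.\<close>

definition holder_ae :: "real \<Rightarrow> real \<Rightarrow> ('a::euclidean_space \<Rightarrow> real) \<Rightarrow> bool" where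
  "holder_ae H \<alpha> u \<longleftrightarrow> (\<exists>N. negligible N \<and> (\<forall>x y. x \<notin> N \<longrightarrow> y \<notin> N \<longrightarrow> \<bar>u x - u y\<bar> \<le> H * dist x y powr \<alpha>)
     \<and> (\<forall>x. x \<notin> N \<longrightarrow> \<bar>u x\<bar> \<le> H))"

text \<open>Isolates the part of Morrey's argument that depends only on the growth of the
  oscillation, so that it serves both the fractional seminorm and the gradient.\<close>

lemma Morrey_osc:
  assumes p: "1 \<le> p" and C: "0 \<le> C" and \<alpha>: "0 < \<alpha>"
  obtains H where "0 < H" "\<And>(u::'a::euclidean_space \<Rightarrow> real). u \<in> borel_measurable borel \<Longrightarrow> Lp_energy p u \<le> 1 \<Longrightarrow>
    (\<And>x \<rho>. 0 < \<rho> \<Longrightarrow> osc u x \<rho> \<le> ennreal (C * \<rho> powr (2 * real DIM('a) + \<alpha>))) \<Longrightarrow> holder_ae H \<alpha> u"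
proof -
  let ?n = "DIM('a)"
  let ?\<kappa> = "ball_factor TYPE('a)"
  define D where "D = C * ?\<kappa> powr (2 * real ?n + \<alpha>) / (1 - 2 powr (- \<alpha>))"
  define V where "V = unit_ball_vol (real ?n) * ?\<kappa> ^ ?n"
  \<comment> \<open>The term \<open>2 ^ (n + 2) * D\<close> comes from \<open>2 ^ (n + 1)\<close>
    times two oscillation sums, and \<open>V + 1\<close> bounds the local integral of
    \<open>\<bar>u\<bar>\<close>.\<close>
  define H where "H = 2 ^ (?n + 2) * D + (V + 1)"
  have D: "0 \<le> D" unfolding D_def using C \<alpha> by (intro divide_nonneg_nonneg) (auto simp: powr_less_one less_imp_le)
  have V: "0 < V" using ball_factor_pos[where 'a = 'a] by (simp add: V_def)
  show ?thesis
  proof (rule that[of H])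
    show "0 < H" unfolding H_def using D V by (intro add_nonneg_pos) auto
    fix u :: "'a \<Rightarrow> real"
    assume um [measurable]: "u \<in> borel_measurable borel" and u: "Lp_energy p u \<le> 1"
      and osc: "\<And>x \<rho>. 0 < \<rho> \<Longrightarrow> osc u x \<rho> \<le> ennreal (C * \<rho> powr (2 * real ?n + \<alpha>))"
    have S: "osc_sum u x r \<le> ennreal (D * r powr \<alpha>)" if "0 < r" for x r
      unfolding D_def by (rule osc_sum_Morrey[OF C \<alpha> osc that])
    obtain N where N: "negligible N"
      "\<And>x y. x \<notin> N \<Longrightarrow> y \<notin> N \<Longrightarrow> x \<noteq> y \<Longrightarrow>
         ennreal \<bar>u x - u y\<bar> \<le> ennreal (2 ^ (?n + 1)) * (osc_sum u x (dist x y) + osc_sum u y (dist x y))"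
      "\<And>x. x \<notin> N \<Longrightarrow> ennreal \<bar>u x\<bar> \<le>
         (\<integral>\<^sup>+z. ennreal \<bar>u z\<bar> * indicator (ball x ?\<kappa>) z \<partial>lborel) + ennreal (2 ^ ?n) * osc_sum u x 1"
      using pointwise_osc_sum[OF um set_integrable_cube_Lp[OF um p u]] by blast
    show "holder_ae H \<alpha> u"
      unfolding holder_ae_def
    proof (intro exI[of _ N] conjI N(1) allI impI)
      fix x y assume x: "x \<notin> N" "y \<notin> N"
      show "\<bar>u x - u y\<bar> \<le> H * dist x y powr \<alpha>"
      proof (cases "x = y")
        case False
        let ?d = "dist x y powr \<alpha>"
        have "ennreal \<bar>u x - u y\<bar> \<le> ennreal (2 ^ (?n + 1)) * (osc_sum u x (dist x y) + osc_sum u y (dist x y))"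
          by (rule N(2)[OF x False])
        also have "\<dots> \<le> ennreal (2 ^ (?n + 1)) * (ennreal (D * ?d) + ennreal (D * ?d))"
          using False by (intro mult_left_mono add_mono S) auto
        also have "\<dots> = ennreal (2 ^ (?n + 1) * (D * ?d + D * ?d))"
          using D by (simp add: ennreal_mult[symmetric] ennreal_plus[symmetric] del: ennreal_plus)
        finally have "\<bar>u x - u y\<bar> \<le> 2 ^ (?n + 2) * D * ?d"
          using D by (simp add: ennreal_le_iff algebra_simps)
        also have "\<dots> \<le> H * ?d"
          using V by (intro mult_right_mono) (auto simp: H_def)
        finally show ?thesis .
      qed simp
    next
      fix x assume x: "x \<notin> N"
      have "ennreal \<bar>u x\<bar> \<le> (\<integral>\<^sup>+z. ennreal \<bar>u z\<bar> * indicator (ball x ?\<kappa>) z \<partial>lborel) + ennreal (2 ^ ?n) * osc_sum u x 1"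
        by (rule N(3)[OF x])
      also have "\<dots> \<le> (emeasure lborel (ball x ?\<kappa>) + 1) + ennreal (2 ^ ?n) * ennreal (D * 1 powr \<alpha>)"
        by (intro add_mono mult_left_mono S nn_integral_le_Lp_energy[where p = p] p u) auto
      also have "\<dots> = ennreal (V + 1 + 2 ^ ?n * D)"
        using D V ball_factor_pos[where 'a = 'a] by (simp add: V_def emeasure_lborel_ball less_imp_le ennreal_mult)
      finally have "\<bar>u x\<bar> \<le> V + 1 + 2 ^ ?n * D"
        using D V by (subst (asm) ennreal_le_iff) auto
      also have "2 ^ ?n * D \<le> 2 ^ (?n + 2) * D"
        using D by (intro mult_right_mono power_increasing) auto
      finally show "\<bar>u x\<bar> \<le> H" by (simp add: H_def)
    qed
  qed
qed

lemma gagliardo_Morrey: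
  assumes p: "1 \<le> p" and s: "0 < s" and \<alpha>: "\<alpha> = s - real DIM('a) / p" "0 < \<alpha>"
  obtains H where "0 < H" "\<And>(u::'a::euclidean_space \<Rightarrow> real). u \<in> borel_measurable borel \<Longrightarrow> Lp_energy p u \<le> 1 \<Longrightarrow>
    gagliardo_energy s p u \<le> 1 \<Longrightarrow> holder_ae H \<alpha> u"
proof -
  obtain C where C: "0 < C" "\<And>(u::'a \<Rightarrow> real) x \<rho>. u \<in> borel_measurable borel \<Longrightarrow> 0 < \<rho> \<Longrightarrow>
    osc u x \<rho> \<le> ennreal (C * \<rho> powr (2 * real DIM('a) + \<alpha>)) * ennpow (ball_double (gagliardo_kernel s p u) x \<rho>) (1 / p)"
    unfolding \<alpha>(1) using osc_gagliardo[OF p s] by blast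
  show ?thesis
  proof (rule Morrey_osc[OF p less_imp_le[OF C(1)] \<alpha>(2), where 'a = 'a])
    fix H
    assume H: "0 < H" "\<And>(u::'a \<Rightarrow> real). u \<in> borel_measurable borel \<Longrightarrow> Lp_energy p u \<le> 1 \<Longrightarrow>
      (\<And>x \<rho>. 0 < \<rho> \<Longrightarrow> osc u x \<rho> \<le> ennreal (C * \<rho> powr (2 * real DIM('a) + \<alpha>))) \<Longrightarrow> holder_ae H \<alpha> u"
    show ?thesis
    proof (rule that[OF H(1)], rule H(2))
      fix u :: "'a \<Rightarrow> real" and x and \<rho> :: real
      assume um: "u \<in> borel_measurable borel" and G: "gagliardo_energy s p u \<le> 1" and \<rho>: "0 < \<rho>"
      have "ball_double (gagliardo_kernel s p u) x \<rho> \<le> 1"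
        using ball_double_le[of "gagliardo_kernel s p u"] G unfolding gagliardo_energy_def by (meson order_trans)
      then have "ennpow (ball_double (gagliardo_kernel s p u) x \<rho>) (1 / p) \<le> ennpow (ennreal 1) (1 / p)"
        using p by (intro ennpow_mono) auto
      then have "ennreal (C * \<rho> powr (2 * real DIM('a) + \<alpha>)) * ennpow (ball_double (gagliardo_kernel s p u) x \<rho>) (1 / p)
          \<le> ennreal (C * \<rho> powr (2 * real DIM('a) + \<alpha>)) * 1"
        by (intro mult_left_mono) (auto simp: ennpow_def)
      with C(2)[OF um \<rho>, of x] show "osc u x \<rho> \<le> ennreal (C * \<rho> powr (2 * real DIM('a) + \<alpha>))"
        by (simp only: mult_1_right)
    qed auto
  qed
qed

lemma Lp_energy_interpolate:
  fixes u :: "'a::euclidean_space \<Rightarrow> real"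
  assumes "holder_ae H \<alpha> u" "0 < p" "p \<le> q" "0 \<le> H" and [measurable]: "u \<in> borel_measurable borel"
  shows "Lp_energy q u \<le> ennreal (H powr (q - p)) * Lp_energy p u"
proof -
  obtain N where N: "negligible N" "\<And>x. x \<notin> N \<Longrightarrow> \<bar>u x\<bar> \<le> H"
    using assms(1) unfolding holder_ae_def by blast
  have "Lp_energy q u \<le> (\<integral>\<^sup>+x. ennreal (H powr (q - p)) * ennreal (\<bar>u x\<bar> powr p) \<partial>lborel)"
    unfolding Lp_energy_def
  proof (rule nn_integral_mono_AE)
    show "AE x in lborel. ennreal (\<bar>u x\<bar> powr q) \<le> ennreal (H powr (q - p)) * ennreal (\<bar>u x\<bar> powr p)"
      using AE_not_negligible[OF N(1)]
    proof eventually_elim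
      case (elim x)
      then show ?case
        using ennpow_interpolate[of "ennreal \<bar>u x\<bar>" H p q] N(2) assms by (simp add: ennpow_ennreal ennreal_leI)
    qed
  qed
  then show ?thesis by (simp add: Lp_energy_def nn_integral_cmult)
qed

text \<open>The kernel of order \<open>t\<close> is dominated pointwise by the kernel of order
  \<open>s\<close>, as the powers of the distance add up to
  \<open>\<alpha> * (q - p) - (n + t * q) = - (n + s * p)\<close>. No integral over small distances
  has to converge on its own, which is why the critical order is within reach.\<close>

lemma gagliardo_critical:
  fixes u :: "'a::euclidean_space \<Rightarrow> real"
  assumes H: "holder_ae H \<alpha> u" "0 \<le> H" and p: "0 < p" "p \<le> q" and [measurable]: "u \<in> borel_measurable borel"
    and \<alpha>: "\<alpha> = s - real DIM('a) / p" "t = \<alpha> + real DIM('a) / q"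
  shows "gagliardo_energy t q u \<le> ennreal (H powr (q - p)) * gagliardo_energy s p u"
proof -
  let ?n = "real DIM('a)"
  obtain N where N: "negligible N" "\<And>x y. x \<notin> N \<Longrightarrow> y \<notin> N \<Longrightarrow> \<bar>u x - u y\<bar> \<le> H * dist x y powr \<alpha>"
    using H unfolding holder_ae_def by blast
  have le: "gagliardo_kernel t q u z w \<le> ennreal (H powr (q - p)) * gagliardo_kernel s p u z w"
    if "z \<notin> N" "w \<notin> N" for z w :: 'a
  proof (cases "z = w")
    case False
    define d where "d = norm (z - w)"
    have d: "0 < d" using False by (simp add: d_def)
    have "ennpow (ennreal \<bar>u z - u w\<bar>) q \<le> ennreal ((H * d powr \<alpha>) powr (q - p)) * ennpow (ennreal \<bar>u z - u w\<bar>) p"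
      using N(2)[OF that] p H by (intro ennpow_interpolate) (auto simp: d_def dist_norm intro: ennreal_leI)
    then have "\<bar>u z - u w\<bar> powr q \<le> (H * d powr \<alpha>) powr (q - p) * \<bar>u z - u w\<bar> powr p"
      using H by (simp add: ennpow_ennreal ennreal_mult[symmetric] ennreal_le_iff)
    then have "\<bar>u z - u w\<bar> powr q / d powr (?n + t * q) \<le> (H * d powr \<alpha>) powr (q - p) * \<bar>u z - u w\<bar> powr p / d powr (?n + t * q)"
      by (rule divide_right_mono) simp
    also have "\<dots> = H powr (q - p) * (\<bar>u z - u w\<bar> powr p * (d powr (\<alpha> * (q - p)) * d powr (- (?n + t * q))))"
      using H d by (simp add: powr_mult powr_powr divide_powr mult_ac del: minus_add_distrib)
    also have "d powr (\<alpha> * (q - p)) * d powr (- (?n + t * q)) = d powr (- (?n + s * p))"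
    proof -
      have "\<alpha> * (q - p) + (- (?n + t * q)) = - (?n + s * p)"
        using p by (simp add: \<alpha> field_simps)
      then show ?thesis by (simp only: powr_add[symmetric])
    qed
    finally show ?thesis
      using H by (simp add: ennreal_mult[symmetric] ennreal_leI d_def divide_powr mult_ac del: minus_add_distrib)
  qed simp
  have "gagliardo_energy t q u \<le> (\<integral>\<^sup>+z. (\<integral>\<^sup>+w. ennreal (H powr (q - p)) * gagliardo_kernel s p u z w \<partial>lborel) \<partial>lborel)"
    unfolding gagliardo_energy_def
    by (rule nn_integral_mono_AE, rule eventually_mono[OF AE_not_negligible[OF N(1)]],
        rule nn_integral_mono_AE, rule eventually_mono[OF AE_not_negligible[OF N(1)]], rule le)
  also have "\<dots> = ennreal (H powr (q - p)) * gagliardo_energy s p u"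
    unfolding gagliardo_energy_def by (simp add: nn_integral_cmult)
  finally show ?thesis .
qed


section \<open>Embeddings of first order\<close>

definition seg :: "('a::euclidean_space \<Rightarrow> ennreal) \<Rightarrow> 'a \<Rightarrow> 'a \<Rightarrow> ennreal" where
  "seg f x h = (\<integral>\<^sup>+\<tau>. f (x + \<tau> *\<^sub>R h) * indicator {0..1::real} \<tau> \<partial>lborel)"

text \<open>All that is used of a weak gradient, with \<open>g\<close> in the role of its norm. The
  null set may depend on \<open>h\<close>, which suffices because only integrals in \<open>x\<close>
  at fixed \<open>h\<close> are estimated.\<close>

definition translate_gradient :: "('a::euclidean_space \<Rightarrow> real) \<Rightarrow> ('a \<Rightarrow> real) \<Rightarrow> bool" where
  "translate_gradient u g \<longleftrightarrow>
     (\<forall>h. AE x in lborel. ennreal \<bar>u (x + h) - u x\<bar> \<le> ennreal (norm h) * seg (\<lambda>z. ennreal (g z)) x h)"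

lemma seg_measurable [measurable]:
  assumes [measurable]: "f \<in> borel_measurable borel"
  shows "(\<lambda>x. seg f x h) \<in> borel_measurable borel"
  unfolding seg_def by measurable

lemma nn_integral_seg:
  assumes [measurable]: "f \<in> borel_measurable borel"
  shows "(\<integral>\<^sup>+x. seg f x h \<partial>lborel) = (\<integral>\<^sup>+x. f x \<partial>lborel)"
proof -
  have "(\<integral>\<^sup>+x. seg f x h \<partial>lborel) = (\<integral>\<^sup>+\<tau>. (\<integral>\<^sup>+x. f (x + \<tau> *\<^sub>R h) * indicator {0..1::real} \<tau> \<partial>lborel) \<partial>lborel)"
    unfolding seg_def by (rule lborel_pair.Fubini') measurable
  also have "\<dots> = (\<integral>\<^sup>+\<tau>. (\<integral>\<^sup>+x. f x \<partial>lborel) * indicator {0..1::real} \<tau> \<partial>lborel)"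
    by (intro nn_integral_cong) (simp add: nn_integral_multc nn_integral_translate)
  also have "\<dots> = (\<integral>\<^sup>+x. f x \<partial>lborel)"
    by (simp add: nn_integral_cmult_indicator)
  finally show ?thesis .
qed

lemma nn_integral_seg_power:
  assumes [measurable]: "f \<in> borel_measurable borel" and q: "1 \<le> q"
  shows "(\<integral>\<^sup>+x. ennpow (seg f x h) q \<partial>lborel) \<le> ennreal (2 powr q) * (\<integral>\<^sup>+x. ennpow (f x) q \<partial>lborel)"
proof -
  have "ennpow (seg f x h) q \<le> ennreal (2 powr q) * seg (\<lambda>x. ennpow (f x) q) x h" for x
    using nn_integral_Jensen_on[of "\<lambda>\<tau>. f (x + \<tau> *\<^sub>R h)" lborel "{0..1::real}" 1 q] q
    by (simp add: seg_def)
  then have "(\<integral>\<^sup>+x. ennpow (seg f x h) q \<partial>lborel) \<le> (\<integral>\<^sup>+x. ennreal (2 powr q) * seg (\<lambda>x. ennpow (f x) q) x h \<partial>lborel)"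
    by (intro nn_integral_mono) auto
  also have "\<dots> = ennreal (2 powr q) * (\<integral>\<^sup>+x. ennpow (f x) q \<partial>lborel)"
    by (simp add: nn_integral_cmult nn_integral_seg)
  finally show ?thesis .
qed

lemma Lp_energy_ennpow: "Lp_energy q u = (\<integral>\<^sup>+x. ennpow (ennreal \<bar>u x\<bar>) q \<partial>lborel)"
  by (simp add: Lp_energy_def ennpow_ennreal)

text \<open>The classical estimate of difference quotients by the gradient; the factor
  \<open>2 powr p\<close> is the loss in Jensen's inequality on the unit interval.\<close>

lemma translate_energy_gradient:
  fixes u g :: "'a::euclidean_space \<Rightarrow> real"
  assumes [measurable]: "u \<in> borel_measurable borel" "g \<in> borel_measurable borel"
    and g: "\<And>x. 0 \<le> g x" and tg: "translate_gradient u g" and p: "1 \<le> p" and G: "Lp_energy p g \<le> 1"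
  shows "translate_energy p u h \<le> ennreal (2 powr p * norm h powr p)"
proof -
  let ?g = "\<lambda>z. ennreal (g z)"
  have "translate_energy p u h \<le> (\<integral>\<^sup>+x. ennreal (norm h powr p) * ennpow (seg ?g x h) p \<partial>lborel)"
    unfolding translate_energy_def
  proof (rule nn_integral_mono_AE)
    show "AE x in lborel. ennreal (\<bar>u (x + h) - u x\<bar> powr p) \<le> ennreal (norm h powr p) * ennpow (seg ?g x h) p"
      using tg[unfolded translate_gradient_def, rule_format, of h]
    proof eventually_elim
      case (elim x)
      then have "ennpow (ennreal \<bar>u (x + h) - u x\<bar>) p \<le> ennpow (ennreal (norm h) * seg ?g x h) p"
        using p by (intro ennpow_mono) auto
      then show ?case using p by (simp add: ennpow_mult ennpow_ennreal)
    qed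
  qed
  also have "\<dots> = ennreal (norm h powr p) * (\<integral>\<^sup>+x. ennpow (seg ?g x h) p \<partial>lborel)"
    by (rule nn_integral_cmult) measurable
  also have "\<dots> \<le> ennreal (norm h powr p) * (ennreal (2 powr p) * (\<integral>\<^sup>+x. ennpow (?g x) p \<partial>lborel))"
    by (intro mult_left_mono nn_integral_seg_power p) auto
  also have "(\<integral>\<^sup>+x. ennpow (?g x) p \<partial>lborel) = Lp_energy p g"
    by (simp add: Lp_energy_ennpow g)
  also have "ennreal (norm h powr p) * (ennreal (2 powr p) * Lp_energy p g) \<le> ennreal (norm h powr p) * (ennreal (2 powr p) * 1)"
    by (intro mult_left_mono G) auto
  finally show ?thesis by (simp add: ennreal_mult mult.commute)
qed

text \<open>A Poincare type inequality. With \<open>w = z + h\<close> and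
  \<open>norm h < 2 * \<rho>\<close> the difference is controlled by \<open>g\<close> on a segment
  inside the ball, so integration in \<open>z\<close> yields the integral of \<open>g\<close> over
  the ball and integration in \<open>h\<close> the volume of the ball of radius
  \<open>2 * \<rho>\<close>.\<close>

lemma osc_gradient:
  fixes u g :: "'a::euclidean_space \<Rightarrow> real"
  assumes [measurable]: "u \<in> borel_measurable borel" "g \<in> borel_measurable borel"
    and tg: "translate_gradient u g" and \<rho>: "0 < \<rho>"
  shows "osc u x \<rho> \<le> ennreal (2 * \<rho> * (unit_ball_vol (real DIM('a)) * (2 * \<rho>) ^ DIM('a))) *
    (\<integral>\<^sup>+z. ennreal (g z) * indicator (ball x \<rho>) z \<partial>lborel)"
proof -
  let ?B = "ball x \<rho>"
  define I where "I = (\<integral>\<^sup>+z. ennreal (g z) * indicator ?B z \<partial>lborel)"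
  define f where "f z = ennreal (g z) * indicator ?B z" for z
  have [measurable]: "f \<in> borel_measurable borel"
    unfolding f_def indicator_ball_dist by measurable
  let ?K = "\<lambda>z w. ennreal \<bar>u z - u w\<bar> * (indicator ?B z * indicator ?B w)"
  have Km [measurable]: "(\<lambda>(z, w). ?K z w) \<in> borel_measurable (borel \<Otimes>\<^sub>M borel)"
    unfolding indicator_ball_dist by measurable
  have "osc u x \<rho> = (\<integral>\<^sup>+z. (\<integral>\<^sup>+h. ?K z (h + z) \<partial>lborel) \<partial>lborel)"
    unfolding ball_double_def indicator_ball_dist
    by (intro nn_integral_cong nn_integral_translate[symmetric]) measurable
  also have "\<dots> = (\<integral>\<^sup>+h. (\<integral>\<^sup>+z. ?K z (h + z) \<partial>lborel) \<partial>lborel)"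
    unfolding indicator_ball_dist by (rule lborel_pair.Fubini') measurable
  also have "\<dots> \<le> (\<integral>\<^sup>+(h::'a). ennreal (2 * \<rho>) * I * indicator (ball 0 (2 * \<rho>)) h \<partial>lborel)"
  proof (rule nn_integral_mono)
    fix h :: 'a
    show "(\<integral>\<^sup>+z. ?K z (h + z) \<partial>lborel) \<le> ennreal (2 * \<rho>) * I * indicator (ball 0 (2 * \<rho>)) h"
    proof (cases "norm h < 2 * \<rho>")
      case True
      have "(\<integral>\<^sup>+z. ?K z (h + z) \<partial>lborel) \<le> (\<integral>\<^sup>+z. ennreal (2 * \<rho>) * seg f z h \<partial>lborel)"
      proof (rule nn_integral_mono_AE)
        show "AE z in lborel. ?K z (h + z) \<le> ennreal (2 * \<rho>) * seg f z h"
          using tg[unfolded translate_gradient_def, rule_format, of h]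
        proof eventually_elim
          case (elim z)
          show ?case
          proof (cases "z \<in> ?B \<and> h + z \<in> ?B")
            case in_ball: True
            \<comment> \<open>Convexity of the ball permits the cut-off of \<open>g\<close> before
              integrating in \<open>z\<close>, which is what keeps the bound local.\<close>
            have "z + \<tau> *\<^sub>R h \<in> ?B" if "\<tau> \<in> {0..1}" for \<tau>
            proof -
              have "(1 - \<tau>) *\<^sub>R z + \<tau> *\<^sub>R (h + z) \<in> ?B"
                using convexD_alt[OF convex_ball, of z x \<rho> "h + z" \<tau>] in_ball that by auto
              then show ?thesis by (simp add: algebra_simps)
            qed
            then have "seg (\<lambda>z. ennreal (g z)) z h = seg f z h"
              unfolding seg_def f_def by (intro nn_integral_cong) (auto split: split_indicator)
            then have "ennreal \<bar>u (z + h) - u z\<bar> \<le> ennreal (norm h) * seg f z h"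
              using elim by simp
            also have "\<dots> \<le> ennreal (2 * \<rho>) * seg f z h"
              using True by (intro mult_right_mono ennreal_leI) auto
            finally show ?thesis
              using in_ball by (simp add: add.commute abs_minus_commute)
          qed auto
        qed
      qed
      also have "\<dots> = ennreal (2 * \<rho>) * (\<integral>\<^sup>+z. f z \<partial>lborel)"
        by (simp add: nn_integral_cmult nn_integral_seg)
      finally show ?thesis using True by (simp add: f_def I_def)
    next
      case False
      have "?K z (h + z) = 0" for z
      proof -
        have "\<not> (z \<in> ?B \<and> h + z \<in> ?B)"
          using False dist_triangle_half_l[of x "h + z" "2 * \<rho>" z]
          by (auto simp: dist_norm norm_minus_commute dist_commute)
            (smt (verit) add_diff_cancel_right' dist_commute dist_norm dist_triangle2)
        then show ?thesis by auto
      qed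
      then show ?thesis by (simp only: nn_integral_const) simp
    qed
  qed
  also have "\<dots> = ennreal (2 * \<rho>) * I * ennreal (unit_ball_vol (real DIM('a)) * (2 * \<rho>) ^ DIM('a))"
    using \<rho> by (subst nn_integral_cmult_indicator) (auto simp: emeasure_lborel_ball)
  also have "\<dots> = ennreal (2 * \<rho> * (unit_ball_vol (real DIM('a)) * (2 * \<rho>) ^ DIM('a))) * I"
    using \<rho> by (simp add: ennreal_mult mult_ac)
  finally show ?thesis by (simp add: I_def)
qed

lemma gradient_Morrey:
  assumes p: "1 \<le> p" and \<alpha>: "\<alpha> = 1 - real DIM('a) / p" "0 < \<alpha>"
  obtains H where "0 < H" "\<And>(u::'a::euclidean_space \<Rightarrow> real) g. u \<in> borel_measurable borel \<Longrightarrow> g \<in> borel_measurable borel \<Longrightarrow>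
    (\<And>x. 0 \<le> g x) \<Longrightarrow> translate_gradient u g \<Longrightarrow> Lp_energy p u \<le> 1 \<Longrightarrow> Lp_energy p g \<le> 1 \<Longrightarrow> holder_ae H \<alpha> u"
proof -
  let ?n = "DIM('a)"
  define V where "V = unit_ball_vol (real ?n)"
  have V: "0 < V" by (simp add: V_def)
  \<comment> \<open>\<open>2 * V * 2 ^ n\<close> comes from \<open>osc_gradient\<close>, the last
    factor from Jensen's inequality for \<open>g\<close> over the ball. The corresponding powers of
    \<open>\<rho>\<close> are \<open>1 + n\<close> and \<open>n * (1 - 1 / p)\<close>, with sum
    \<open>2 * n + \<alpha>\<close>.\<close>
  define C where "C = 2 * V * 2 ^ ?n * (2 * V powr (1 - 1 / p))"
  have C: "0 \<le> C" using V by (simp add: C_def)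
  show ?thesis
  proof (rule Morrey_osc[OF p C \<alpha>(2), where 'a = 'a])
    fix H
    assume H: "0 < H" "\<And>(u::'a \<Rightarrow> real). u \<in> borel_measurable borel \<Longrightarrow> Lp_energy p u \<le> 1 \<Longrightarrow>
      (\<And>x \<rho>. 0 < \<rho> \<Longrightarrow> osc u x \<rho> \<le> ennreal (C * \<rho> powr (2 * real DIM('a) + \<alpha>))) \<Longrightarrow> holder_ae H \<alpha> u"
    show ?thesis
    proof (rule that[OF H(1)], rule H(2))
      fix u g :: "'a \<Rightarrow> real" and x and \<rho> :: real
      assume [measurable]: "u \<in> borel_measurable borel" "g \<in> borel_measurable borel"
        and g: "\<And>x. 0 \<le> g x" and tg: "translate_gradient u g" and G: "Lp_energy p g \<le> 1" and \<rho>: "0 < \<rho>"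
      let ?I = "\<integral>\<^sup>+z. ennreal (g z) * indicator (ball x \<rho>) z \<partial>lborel"
      let ?W = "V * \<rho> ^ ?n"
      have W: "0 < ?W" using V \<rho> by simp
      have "ennpow ?I p \<le> ennreal (2 powr p * ?W powr (p - 1)) * (\<integral>\<^sup>+z. ennpow (ennreal (g z)) p * indicator (ball x \<rho>) z \<partial>lborel)"
        using W p \<rho> by (intro nn_integral_Jensen_on) (auto simp: emeasure_lborel_ball V_def)
      also have "(\<integral>\<^sup>+z. ennpow (ennreal (g z)) p * indicator (ball x \<rho>) z \<partial>lborel) \<le> Lp_energy p g"
        unfolding Lp_energy_ennpow by (intro nn_integral_mono) (auto simp: g split: split_indicator)
      also have "\<dots> \<le> 1" by (rule G)
      finally have "ennpow ?I p \<le> ennreal (2 powr p * ?W powr (p - 1))"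
        by (simp add: mult_left_mono)
      then have "ennpow (ennpow ?I p) (1 / p) \<le> ennpow (ennreal (2 powr p * ?W powr (p - 1))) (1 / p)"
        using p by (intro ennpow_mono) (auto simp: mult_left_mono)
      also have "\<dots> = ennreal (2 * ?W powr ((p - 1) * (1 / p)))"
        using W p by (simp add: ennpow_ennreal powr_mult powr_powr)
      finally have I: "?I \<le> ennreal (2 * ?W powr ((p - 1) * (1 / p)))"
        using p by (simp add: ennpow_ennpow)
      have "osc u x \<rho> \<le> ennreal (2 * \<rho> * (V * (2 * \<rho>) ^ ?n)) * ?I"
        unfolding V_def by (intro osc_gradient tg \<rho>) auto
      also have "\<dots> \<le> ennreal (2 * \<rho> * (V * (2 * \<rho>) ^ ?n)) * ennreal (2 * ?W powr ((p - 1) * (1 / p)))"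
        by (intro mult_left_mono I) auto
      also have "\<dots> = ennreal (2 * \<rho> * (V * (2 * \<rho>) ^ ?n) * (2 * ?W powr ((p - 1) * (1 / p))))"
        using V \<rho> by (intro ennreal_mult[symmetric]) auto
      also have "2 * \<rho> * (V * (2 * \<rho>) ^ ?n) * (2 * ?W powr ((p - 1) * (1 / p))) = C * \<rho> powr (2 * real ?n + \<alpha>)"
      proof -
        have e: "(p - 1) * (1 / p) = 1 - 1 / p" using p by (simp add: field_simps)
        have "?W powr (1 - 1 / p) = V powr (1 - 1 / p) * \<rho> powr (real ?n * (1 - 1 / p))"
          using V \<rho> by (simp add: powr_mult powr_powr flip: powr_realpow)
        moreover have "\<rho> * \<rho> ^ ?n * \<rho> powr (real ?n * (1 - 1 / p)) = \<rho> powr (2 * real ?n + \<alpha>)"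
        proof -
          have "\<rho> * \<rho> ^ ?n = \<rho> powr (1 + real ?n)"
            using \<rho> by (simp add: powr_add powr_realpow)
          moreover have "1 + real ?n + real ?n * (1 - 1 / p) = 2 * real ?n + \<alpha>"
            by (simp add: \<alpha> algebra_simps)
          ultimately show ?thesis by (simp only: powr_add[symmetric])
        qed
        ultimately show ?thesis
          unfolding e C_def by (simp add: power_mult_distrib mult_ac)
      qed
      finally show "osc u x \<rho> \<le> ennreal (C * \<rho> powr (2 * real ?n + \<alpha>))" .
    qed auto
  qed
qed

section \<open>The critical case of first order\<close>

text \<open>If \<open>l\<close> dominates, all \<open>q\<close> factors are bounded by it; if
  \<open>m\<close> dominates, a single factor is bounded by \<open>m\<close> and the others by
  \<open>K\<close>. The large part of the gradient is thus needed only to the first power.\<close>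

lemma min_max_split_power:
  fixes d l m :: ennreal
  assumes d: "d \<le> l + m" and K: "d \<le> ennreal K" "0 \<le> K" and q: "1 \<le> q"
  shows "ennpow d q \<le> ennreal (2 powr q) * ennpow l q + ennreal (2 * K powr (q - 1)) * m"
proof (cases "m \<le> l")
  case True
  have "d \<le> ennreal 2 * l"
    using d True by (metis add_left_mono ennreal_numeral mult_2 order_trans zero_le_numeral)
  then have "ennpow d q \<le> ennpow (ennreal 2 * l) q"
    using q by (intro ennpow_mono) auto
  also have "\<dots> = ennreal (2 powr q) * ennpow l q"
    using q by (subst ennpow_mult) (auto simp: ennpow_ennreal simp del: ennreal_numeral)
  finally show ?thesis by (rule order_trans) simp
next
  case False
  have dm: "d \<le> 2 * m"
    using d False by (metis add_right_mono linear mult_2 order_trans)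
  have "ennpow d q \<le> ennreal (K powr (q - 1)) * ennpow d 1"
    using K q by (intro ennpow_interpolate) auto
  also have "\<dots> \<le> ennreal (K powr (q - 1)) * (2 * m)"
    using dm by (simp add: mult_left_mono)
  also have "\<dots> = ennreal (2 * K powr (q - 1)) * m"
    by (simp add: ennreal_mult mult_ac)
  finally show ?thesis by (rule order_trans) simp
qed

text \<open>The gradient is split at the height \<open>norm h powr (- n / p)\<close>. Where the small part dominates,
  Jensen's inequality in \<open>L\<^sup>q\<close> suffices; where the large part dominates, Morrey's bound is used for
  \<open>q - 1\<close> of the factors. After exchanging the integrals over \<open>x\<close> and \<open>h\<close> both parts
  contribute a multiple of \<open>g powr p\<close>.\<close>

lemma gradient_critical:
  fixes u g :: "'a::euclidean_space \<Rightarrow> real"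
  assumes [measurable]: "u \<in> borel_measurable borel" "g \<in> borel_measurable borel"
    and g: "\<And>x. 0 \<le> g x" and tg: "translate_gradient u g" and G: "Lp_energy p g \<le> 1"
    and H: "holder_ae H \<alpha> u" "0 \<le> H" and p: "1 < p" "p < q"
    and \<alpha>: "\<alpha> = 1 - real DIM('a) / p" "t = \<alpha> + real DIM('a) / q"
  shows "gagliardo_energy t q u \<le> ennreal (4 powr q * kernel_const DIM('a) (q * (1 - t)) +
    2 * H powr (q - 1) * kernel_const DIM('a) (real DIM('a) * (1 - 1 / p)))"
proof -
  let ?n = "real DIM('a)"
  \<comment> \<open>Morrey's bound leaves the kernel \<open>norm h powr (- \<beta> - n)\<close> for
    the large part; it is integrable away from 0 because \<open>p > 1\<close>. The small part gets
    \<open>norm h powr (q * (1 - t) - n)\<close>, integrable near 0 because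
    \<open>t < 1\<close>.\<close>
  define \<beta> where "\<beta> = ?n * (1 - 1 / p)"
  define low where "low r x = (if g x \<le> r powr (- (?n / p)) then ennreal (g x) else 0)" for r x
  define high where "high r x = (if g x \<le> r powr (- (?n / p)) then 0 else ennreal (g x))" for r x
  have [measurable]: "low r \<in> borel_measurable borel" "high r \<in> borel_measurable borel" for r
    unfolding low_def high_def by measurable
  have [measurable]: "(\<lambda>(h, x). low (norm h) x) \<in> borel_measurable ((borel::'a measure) \<Otimes>\<^sub>M borel)"
    "(\<lambda>(h, x). high (norm h) x) \<in> borel_measurable ((borel::'a measure) \<Otimes>\<^sub>M borel)"
    unfolding low_def high_def by measurable
  have pq: "0 < p" "0 < q" "1 \<le> q" using p by auto
  have "?n / q < ?n / p" using p by (intro divide_strict_left_mono) auto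
  then have t1: "0 < q * (1 - t)" using pq by (simp add: \<alpha>)
  have \<beta>: "0 < \<beta>" using p by (simp add: \<beta>_def)
  let ?c = "2 * H powr (q - 1)"
  have trans: "translate_energy q u h \<le> ennreal (4 powr q * norm h powr q) * (\<integral>\<^sup>+x. ennpow (low (norm h) x) q \<partial>lborel)
      + ennreal (?c * norm h powr (\<alpha> * (q - 1) + 1)) * (\<integral>\<^sup>+x. high (norm h) x \<partial>lborel)" for h
  proof -
    define r where "r = norm h"
    have r: "0 \<le> r" by (simp add: r_def)
    obtain N where N: "negligible N" "\<And>x y. x \<notin> N \<Longrightarrow> y \<notin> N \<Longrightarrow> \<bar>u x - u y\<bar> \<le> H * dist x y powr \<alpha>"
      using H unfolding holder_ae_def by blast
    let ?rhs = "\<lambda>x. ennreal (2 powr q * r powr q) * ennpow (seg (low r) x h) q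
        + ennreal (?c * r powr (\<alpha> * (q - 1) + 1)) * seg (high r) x h"
    have "translate_energy q u h \<le> (\<integral>\<^sup>+x. ?rhs x \<partial>lborel)"
      unfolding translate_energy_def
    proof (rule nn_integral_mono_AE)
      show "AE x in lborel. ennreal (\<bar>u (x + h) - u x\<bar> powr q) \<le> ?rhs x"
        using tg[unfolded translate_gradient_def, rule_format, of h] AE_not_negligible[OF N(1)] AE_translate[OF N(1), of h]
      proof eventually_elim
        case (elim x)
        have "seg (\<lambda>z. ennreal (g z)) x h = (\<integral>\<^sup>+\<tau>. low r (x + \<tau> *\<^sub>R h) * indicator {0..1::real} \<tau> + high r (x + \<tau> *\<^sub>R h) * indicator {0..1} \<tau> \<partial>lborel)"
          unfolding seg_def by (intro nn_integral_cong) (auto simp: low_def high_def split: split_indicator)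
        also have "\<dots> = seg (low r) x h + seg (high r) x h"
          unfolding seg_def by (rule nn_integral_add) measurable
        finally have "ennreal \<bar>u (x + h) - u x\<bar> \<le> ennreal r * seg (low r) x h + ennreal r * seg (high r) x h"
          using elim(1) by (simp add: r_def distrib_left)
        moreover have "ennreal \<bar>u (x + h) - u x\<bar> \<le> ennreal (H * r powr \<alpha>)"
          using N(2)[of "x + h" x] elim by (intro ennreal_leI) (simp add: dist_norm r_def)
        ultimately have "ennpow (ennreal \<bar>u (x + h) - u x\<bar>) q \<le> ennreal (2 powr q) * ennpow (ennreal r * seg (low r) x h) q
            + ennreal (2 * (H * r powr \<alpha>) powr (q - 1)) * (ennreal r * seg (high r) x h)"
          using H pq by (intro min_max_split_power) auto
        also have "ennpow (ennreal r * seg (low r) x h) q = ennreal (r powr q) * ennpow (seg (low r) x h) q"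
          using pq r by (simp add: ennpow_mult ennpow_ennreal)
        also have "ennreal (2 * (H * r powr \<alpha>) powr (q - 1)) * (ennreal r * seg (high r) x h)
            = ennreal (?c * r powr (\<alpha> * (q - 1) + 1)) * seg (high r) x h"
        proof -
          have "2 * (H * r powr \<alpha>) powr (q - 1) * r = ?c * r powr (\<alpha> * (q - 1) + 1)"
            using H r by (simp add: powr_mult powr_powr powr_add)
          then show ?thesis
            using H r by (simp only: mult.assoc[symmetric] flip: ennreal_mult'')
        qed
        finally show ?case
          by (simp add: ennpow_ennreal ennreal_mult mult.assoc)
      qed
    qed
    also have "\<dots> = ennreal (2 powr q * r powr q) * (\<integral>\<^sup>+x. ennpow (seg (low r) x h) q \<partial>lborel)
        + ennreal (?c * r powr (\<alpha> * (q - 1) + 1)) * (\<integral>\<^sup>+x. seg (high r) x h \<partial>lborel)"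
      by (subst nn_integral_add, measurable) (simp add: nn_integral_cmult)
    also have "\<dots> \<le> ennreal (2 powr q * r powr q) * (ennreal (2 powr q) * (\<integral>\<^sup>+x. ennpow (low r x) q \<partial>lborel))
        + ennreal (?c * r powr (\<alpha> * (q - 1) + 1)) * (\<integral>\<^sup>+x. high r x \<partial>lborel)"
      using pq by (intro add_mono mult_left_mono nn_integral_seg_power) (auto simp: nn_integral_seg)
    also have "ennreal (2 powr q * r powr q) * (ennreal (2 powr q) * (\<integral>\<^sup>+x. ennpow (low r x) q \<partial>lborel))
        = ennreal (4 powr q * r powr q) * (\<integral>\<^sup>+x. ennpow (low r x) q \<partial>lborel)"
    proof -
      have "(4::real) powr q = 2 powr q * 2 powr q" by (simp flip: powr_mult)
      then show ?thesis by (simp add: ennreal_mult mult_ac)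
    qed
    finally show ?thesis by (simp add: r_def)
  qed
  \<comment> \<open>Raising the splitting height to the power \<open>p / n\<close> turns a condition
    on \<open>g x\<close> into one on \<open>norm h\<close>: for fixed \<open>x\<close> the small
    part lives on \<open>norm h \<le> R\<close> and the large part on \<open>norm h \<ge> R\<close>,
    where \<open>R = g x powr (- (p / n))\<close>.\<close>
  have inv: "(norm h powr (- (?n / p))) powr (p / ?n) = 1 / norm h" for h :: 'a
  proof -
    have "- (?n / p) * (p / ?n) = - 1" using pq by simp
    then show ?thesis unfolding powr_powr by (simp add: powr_minus divide_inverse)
  qed
  let ?k1 = "\<lambda>h::'a. ennreal (norm h powr (q * (1 - t) - ?n))"
  let ?k2 = "\<lambda>h::'a. ennreal (norm h powr (- \<beta> - ?n))"
  have "gagliardo_energy t q u \<le> (\<integral>\<^sup>+h. ennreal (4 powr q) * (\<integral>\<^sup>+x. ?k1 h * ennpow (low (norm h) x) q \<partial>lborel)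
      + ennreal ?c * (\<integral>\<^sup>+x. ?k2 h * high (norm h) x \<partial>lborel) \<partial>lborel)"
    unfolding gagliardo_energy_translates[OF assms(1)]
  proof (rule nn_integral_mono)
    fix h :: 'a
    let ?L = "\<integral>\<^sup>+x. ennpow (low (norm h) x) q \<partial>lborel" and ?M = "\<integral>\<^sup>+x. high (norm h) x \<partial>lborel"
    let ?w = "norm h powr (- (?n + t * q))"
    have "ennreal ?w * translate_energy q u h \<le> ennreal ?w * (ennreal (4 powr q * norm h powr q) * ?L
      + ennreal (?c * norm h powr (\<alpha> * (q - 1) + 1)) * ?M)"
      by (intro mult_left_mono trans) simp
    also have "\<dots> = ennreal (4 powr q * (?w * norm h powr q)) * ?L + ennreal (?c * (?w * norm h powr (\<alpha> * (q - 1) + 1))) * ?M"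
      by (simp add: distrib_left ennreal_mult mult_ac)
    also have "?w * norm h powr q = norm h powr (q * (1 - t) - ?n)"
    proof -
      have "- (?n + t * q) + q = q * (1 - t) - ?n" by (simp add: algebra_simps)
      then show ?thesis by (simp only: powr_add[symmetric])
    qed
    also have "?w * norm h powr (\<alpha> * (q - 1) + 1) = norm h powr (- \<beta> - ?n)"
    proof -
      have "- (?n + t * q) + (\<alpha> * (q - 1) + 1) = - \<beta> - ?n" using pq by (simp add: \<alpha> \<beta>_def field_simps)
      then show ?thesis by (simp only: powr_add[symmetric])
    qed
    finally show "ennreal ?w * translate_energy q u h \<le> ennreal (4 powr q) * (\<integral>\<^sup>+x. ?k1 h * ennpow (low (norm h) x) q \<partial>lborel)
      + ennreal ?c * (\<integral>\<^sup>+x. ?k2 h * high (norm h) x \<partial>lborel)"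
      by (simp add: nn_integral_cmult ennreal_mult mult.assoc)
  qed
  also have "\<dots> = ennreal (4 powr q) * (\<integral>\<^sup>+h. (\<integral>\<^sup>+x. ?k1 h * ennpow (low (norm h) x) q \<partial>lborel) \<partial>lborel)
      + ennreal ?c * (\<integral>\<^sup>+h. (\<integral>\<^sup>+x. ?k2 h * high (norm h) x \<partial>lborel) \<partial>(lborel :: 'a measure))"
    by (subst nn_integral_add, measurable) (simp add: nn_integral_cmult)
  also have "(\<integral>\<^sup>+h. (\<integral>\<^sup>+x. ?k1 h * ennpow (low (norm h) x) q \<partial>lborel) \<partial>(lborel :: 'a measure))
      = (\<integral>\<^sup>+x. (\<integral>\<^sup>+h. ?k1 h * ennpow (low (norm h) x) q \<partial>(lborel :: 'a measure)) \<partial>lborel)"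
    by (rule lborel_pair.Fubini') measurable
  also have "(\<integral>\<^sup>+h. (\<integral>\<^sup>+x. ?k2 h * high (norm h) x \<partial>lborel) \<partial>(lborel :: 'a measure))
      = (\<integral>\<^sup>+x. (\<integral>\<^sup>+h. ?k2 h * high (norm h) x \<partial>(lborel :: 'a measure)) \<partial>lborel)"
    by (rule lborel_pair.Fubini') measurable
  also have "ennreal (4 powr q) * (\<integral>\<^sup>+x. (\<integral>\<^sup>+h. ?k1 h * ennpow (low (norm h) x) q \<partial>(lborel :: 'a measure)) \<partial>lborel)
      + ennreal ?c * (\<integral>\<^sup>+x. (\<integral>\<^sup>+h. ?k2 h * high (norm h) x \<partial>(lborel :: 'a measure)) \<partial>lborel)
    \<le> ennreal (4 powr q) * (\<integral>\<^sup>+x. ennreal (kernel_const DIM('a) (q * (1 - t))) * ennreal (\<bar>g x\<bar> powr p) \<partial>lborel)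
      + ennreal ?c * (\<integral>\<^sup>+x. ennreal (kernel_const DIM('a) \<beta>) * ennreal (\<bar>g x\<bar> powr p) \<partial>lborel)"
  proof (intro add_mono mult_left_mono nn_integral_mono)
    fix x
    show "(\<integral>\<^sup>+h. ?k1 h * ennpow (low (norm h) x) q \<partial>(lborel :: 'a measure)) \<le> ennreal (kernel_const DIM('a) (q * (1 - t))) * ennreal (\<bar>g x\<bar> powr p)"
    proof (cases "g x = 0")
      case False
      then have a: "0 < g x" using g[of x] by simp
      define R where "R = g x powr (- (p / ?n))"
      have R: "0 < R" using a by (simp add: R_def)
      have "(\<integral>\<^sup>+h. ?k1 h * ennpow (low (norm h) x) q \<partial>(lborel :: 'a measure))
          \<le> (\<integral>\<^sup>+h. ennreal (g x powr q) * (?k1 h * indicator {h. norm h \<le> R} h) \<partial>(lborel :: 'a measure))"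
      proof (rule nn_integral_mono)
        fix h :: 'a
        show "?k1 h * ennpow (low (norm h) x) q \<le> ennreal (g x powr q) * (?k1 h * indicator {h. norm h \<le> R} h)"
        proof (cases "h \<noteq> 0 \<and> g x \<le> norm h powr (- (?n / p))")
          case True
          have "g x powr (p / ?n) \<le> (norm h powr (- (?n / p))) powr (p / ?n)"
            using True a pq by (intro powr_mono2) auto
          also have "\<dots> = 1 / norm h" by (rule inv)
          finally have "norm h \<le> R"
            using True a by (simp add: R_def powr_minus field_simps)
          then show ?thesis
            using True a by (simp add: low_def ennpow_ennreal mult.commute)
        qed (auto simp: low_def)
      qed
      also have "\<dots> = ennreal (g x powr q) * (\<integral>\<^sup>+h. ?k1 h * indicator {h. norm h \<le> R} h \<partial>(lborel :: 'a measure))"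
        by (rule nn_integral_cmult) measurable
      also have "\<dots> \<le> ennreal (g x powr q) * ennreal (kernel_const DIM('a) (q * (1 - t)) * R powr (q * (1 - t)))"
        using R t1 by (intro mult_left_mono kernel_ball_bound) auto
      also have "\<dots> = ennreal (kernel_const DIM('a) (q * (1 - t)) * (g x powr q * R powr (q * (1 - t))))"
        using kernel_const_nonneg[OF t1, of "DIM('a)"] by (simp add: ennreal_mult[symmetric] mult_ac)
      \<comment> \<open>As \<open>1 - t = n / p - n / q\<close>, the power of \<open>R\<close>
        contributes \<open>p - q\<close> to the exponent of \<open>g x\<close>.\<close>
      also have "g x powr q * R powr (q * (1 - t)) = g x powr p"
      proof -
        have "q + (- (p / ?n)) * (q * (1 - t)) = p"
          using pq by (simp add: \<alpha> field_simps)
        then show ?thesis unfolding R_def powr_powr powr_add[symmetric] by simp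
      qed
      finally show ?thesis
        using a kernel_const_nonneg[OF t1, of "DIM('a)"] by (simp add: ennreal_mult)
    qed (simp add: low_def)
    show "(\<integral>\<^sup>+h. ?k2 h * high (norm h) x \<partial>(lborel :: 'a measure)) \<le> ennreal (kernel_const DIM('a) \<beta>) * ennreal (\<bar>g x\<bar> powr p)"
    proof (cases "g x = 0")
      case False
      then have a: "0 < g x" using g[of x] by simp
      define R where "R = g x powr (- (p / ?n))"
      have R: "0 < R" using a by (simp add: R_def)
      have "(\<integral>\<^sup>+h. ?k2 h * high (norm h) x \<partial>(lborel :: 'a measure))
          \<le> (\<integral>\<^sup>+h. ennreal (g x) * (?k2 h * indicator {h. R \<le> norm h} h) \<partial>(lborel :: 'a measure))"
      proof (rule nn_integral_mono)
        fix h :: 'a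
        show "?k2 h * high (norm h) x \<le> ennreal (g x) * (?k2 h * indicator {h. R \<le> norm h} h)"
        proof (cases "h \<noteq> 0 \<and> norm h powr (- (?n / p)) < g x")
          case True
          have "(norm h powr (- (?n / p))) powr (p / ?n) \<le> g x powr (p / ?n)"
            using True pq by (intro powr_mono2) auto
          then have "1 / norm h \<le> g x powr (p / ?n)" by (simp only: inv)
          then have "R \<le> norm h"
            using True a by (simp add: R_def powr_minus field_simps)
          then show ?thesis
            using True by (simp add: high_def mult.commute)
        qed (auto simp: high_def)
      qed
      also have "\<dots> = ennreal (g x) * (\<integral>\<^sup>+h. ?k2 h * indicator {h. R \<le> norm h} h \<partial>(lborel :: 'a measure))"
        by (rule nn_integral_cmult) measurable
      also have "\<dots> \<le> ennreal (g x) * ennreal (kernel_const DIM('a) \<beta> * R powr (- \<beta>))"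
        using R \<beta> by (intro mult_left_mono kernel_outside_bound) auto
      also have "\<dots> = ennreal (kernel_const DIM('a) \<beta> * (g x powr 1 * R powr (- \<beta>)))"
        using a kernel_const_nonneg[OF \<beta>, of "DIM('a)"] by (simp add: ennreal_mult[symmetric] mult_ac)
      also have "g x powr 1 * R powr (- \<beta>) = g x powr p"
      proof -
        have "1 + (- (p / ?n)) * (- \<beta>) = p"
          using pq by (simp add: \<beta>_def field_simps)
        then show ?thesis unfolding R_def powr_powr powr_add[symmetric] by simp
      qed
      finally show ?thesis
        using a kernel_const_nonneg[OF \<beta>, of "DIM('a)"] by (simp add: ennreal_mult)
    qed (simp add: high_def)
  qed auto
  also have "\<dots> = ennreal (4 powr q) * (ennreal (kernel_const DIM('a) (q * (1 - t))) * Lp_energy p g)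
      + ennreal ?c * (ennreal (kernel_const DIM('a) \<beta>) * Lp_energy p g)"
    by (simp add: nn_integral_cmult Lp_energy_def)
  also have "\<dots> \<le> ennreal (4 powr q) * (ennreal (kernel_const DIM('a) (q * (1 - t))) * 1)
      + ennreal ?c * (ennreal (kernel_const DIM('a) \<beta>) * 1)"
    by (intro add_mono mult_left_mono G) auto
  also have "\<dots> = ennreal (4 powr q * kernel_const DIM('a) (q * (1 - t)) + ?c * kernel_const DIM('a) \<beta>)"
    using kernel_const_nonneg[OF \<beta>, of "DIM('a)"] kernel_const_nonneg[OF t1, of "DIM('a)"] by (simp add: ennreal_mult)
  finally show ?thesis by (simp add: \<beta>_def)
qed


section \<open>Test functions\<close>

text \<open>\<open>Ck (Suc k)\<close> speaks of derivatives only, so the inclusion is an induction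
  whose base is that differentiability implies continuity. The product rule needs it, as it leaves
  one factor undifferentiated.\<close>

lemma Ck_Suc_imp: "Ck (Suc k) \<phi> \<Longrightarrow> Ck k \<phi>"
proof (induction k arbitrary: \<phi>)
  case 0
  then show ?case
    by (auto intro!: differentiable_imp_continuous_on simp: differentiable_on_def differentiable_at_withinI)
next
  case (Suc k)
  from Suc.prems have "\<forall>x. \<phi> differentiable at x" "\<forall>v. Ck (Suc k) (\<lambda>x. frechet_derivative \<phi> (at x) v)"
    by auto
  then show ?case using Suc.IH by simp
qed

lemma Ck_derivI:
  assumes "\<And>x. (\<phi> has_derivative \<phi>' x) (at x)" "\<And>v. Ck k (\<lambda>x. \<phi>' x v)"
  shows "Ck (Suc k) \<phi>"
  using assms by (auto simp: differentiable_def simp flip: frechet_derivative_at[OF assms(1)])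

lemma Ck_derivD:
  assumes "Ck (Suc k) \<phi>"
  shows "(\<phi> has_derivative frechet_derivative \<phi> (at x)) (at x)" "Ck k (\<lambda>x. frechet_derivative \<phi> (at x) v)"
  using assms by (auto simp: frechet_derivative_works[symmetric])

lemma Ck_const: "Ck k (\<lambda>x. c)"
proof (induction k arbitrary: c)
  case (Suc k)
  show ?case
    by (rule Ck_derivI[where \<phi>' = "\<lambda>x v. 0"]) (auto intro: Suc)
qed simp

lemma Ck_add: "Ck k f \<Longrightarrow> Ck k g \<Longrightarrow> Ck k (\<lambda>x. f x + g x)"
proof (induction k arbitrary: f g)
  case (Suc k)
  show ?case
    by (rule Ck_derivI, rule has_derivative_add[OF Ck_derivD(1)[OF Suc.prems(1)] Ck_derivD(1)[OF Suc.prems(2)]])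
      (rule Suc.IH[OF Ck_derivD(2)[OF Suc.prems(1)] Ck_derivD(2)[OF Suc.prems(2)]])
qed (auto intro: continuous_intros)

lemma Ck_mult: "Ck k f \<Longrightarrow> Ck k g \<Longrightarrow> Ck k (\<lambda>x. f x * g x)"
proof (induction k arbitrary: f g)
  case (Suc k)
  show ?case
    by (rule Ck_derivI, rule has_derivative_mult[OF Ck_derivD(1)[OF Suc.prems(1)] Ck_derivD(1)[OF Suc.prems(2)]])
      (rule Ck_add[OF Suc.IH[OF Ck_Suc_imp[OF Suc.prems(1)] Ck_derivD(2)[OF Suc.prems(2)]]
            Suc.IH[OF Ck_derivD(2)[OF Suc.prems(1)] Ck_Suc_imp[OF Suc.prems(2)]]])
qed (auto intro: continuous_intros)

lemma Ck_prod: "finite I \<Longrightarrow> (\<And>i. i \<in> I \<Longrightarrow> Ck k (f i)) \<Longrightarrow> Ck k (\<lambda>x. \<Prod>i\<in>I. f i x)"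
  by (induction I rule: finite_induct) (auto intro!: Ck_const Ck_mult)

lemma Ck_translate: "Ck k \<phi> \<Longrightarrow> Ck k (\<lambda>x. \<phi> (x + c))"
proof (induction k arbitrary: \<phi>)
  case 0
  then show ?case
    by (auto intro!: continuous_on_compose2[of UNIV \<phi>] continuous_intros)
next
  case (Suc k)
  have "((\<lambda>x. \<phi> (x + c)) has_derivative frechet_derivative \<phi> (at (x + c))) (at x)" for x
  proof -
    have "((\<lambda>x. x + c) has_derivative (\<lambda>v. v)) (at x)"
      by (auto intro!: derivative_eq_intros)
    from has_derivative_compose[OF this Ck_derivD(1)[OF Suc.prems]] show ?thesis .
  qed
  then show ?case
    by (rule Ck_derivI) (rule Suc.IH[OF Ck_derivD(2)[OF Suc.prems]])
qed

text \<open>The powers of \<open>y\<close> make this family closed under differentiation up to linear combinations.\<close>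

definition flat_exp :: "real \<Rightarrow> nat \<Rightarrow> real \<Rightarrow> real" where
  "flat_exp d m y = (if 0 < y then exp (- d / y) / y ^ m else 0)"

lemma power_le_fact_exp:
  fixes x :: real
  assumes "0 \<le> x"
  shows "x ^ n \<le> fact n * exp x"
proof -
  have "(\<Sum>k\<in>{n}. x ^ k /\<^sub>R fact k) \<le> (\<Sum>k. x ^ k /\<^sub>R fact k)"
    using assms by (intro sum_le_suminf summable_exp_generic) auto
  then show ?thesis
    by (simp add: exp_def field_simps)
qed

text \<open>This is \<open>power_le_fact_exp\<close> at \<open>d / y\<close> with power
  \<open>m + 2\<close>. The quadratic order in \<open>y\<close> makes the difference quotient at 0
  tend to 0, so the derivative formula extends across the origin.\<close>

lemma flat_exp_bound:
  assumes "0 < d"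
  shows "\<bar>flat_exp d m y\<bar> \<le> fact (m + 2) / d ^ (m + 2) * y\<^sup>2"
proof (cases "0 < y")
  case True
  have "(d / y) ^ (m + 2) \<le> fact (m + 2) * exp (d / y)"
    using assms True by (intro power_le_fact_exp) auto
  then have "d ^ (m + 2) \<le> fact (m + 2) * exp (d / y) * y ^ (m + 2)"
    using True by (simp add: power_divide field_simps)
  then have "d ^ (m + 2) * exp (- d / y) \<le> fact (m + 2) * exp (d / y) * y ^ (m + 2) * exp (- d / y)"
    by (rule mult_right_mono) simp
  also have "\<dots> = fact (m + 2) * y ^ (m + 2) * (exp (d / y) * exp (- d / y))"
    by (simp only: mult_ac)
  also have "exp (d / y) * exp (- d / y) = 1"
    by (simp flip: exp_add)
  finally have "exp (- d / y) / y ^ m \<le> fact (m + 2) / d ^ (m + 2) * y\<^sup>2"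
    using assms True by (simp add: field_simps power2_eq_square)
  then show ?thesis using True by (simp add: flat_exp_def)
qed (use assms in \<open>simp add: flat_exp_def\<close>)

lemma flat_exp_deriv:
  assumes d: "0 < d"
  shows "(flat_exp d m has_real_derivative d * flat_exp d (m + 2) y - real m * flat_exp d (m + 1) y) (at y)"
proof -
  consider "0 < y" | "y < 0" | "y = 0" by linarith
  then show ?thesis
  proof cases
    case 1
    have "((\<lambda>y. exp (- d / y) / y ^ m) has_real_derivative
        (exp (- d / y) * (d / y\<^sup>2) * y ^ m - exp (- d / y) * (real m * y ^ (m - 1))) / (y ^ m * y ^ m)) (at y)"
      using 1 by (auto intro!: derivative_eq_intros simp: power2_eq_square)
    also have "(exp (- d / y) * (d / y\<^sup>2) * y ^ m - exp (- d / y) * (real m * y ^ (m - 1))) / (y ^ m * y ^ m)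
        = d * flat_exp d (m + 2) y - real m * flat_exp d (m + 1) y"
      using 1 by (cases m) (simp_all add: flat_exp_def power2_eq_square field_simps)
    finally show ?thesis
      by (rule has_field_derivative_transform_within_open[where S = "{0<..}"]) (use 1 in \<open>auto simp: flat_exp_def\<close>)
  next
    case 2
    have "((\<lambda>y. 0) has_real_derivative 0) (at y)" by simp
    then have "(flat_exp d m has_real_derivative 0) (at y)"
      by (rule has_field_derivative_transform_within_open[where S = "{..<0}"]) (use 2 in \<open>auto simp: flat_exp_def\<close>)
    then show ?thesis using 2 by (simp add: flat_exp_def)
  next
    case 3
    define C where "C = fact (m + 2) / d ^ (m + 2)"
    have "(\<lambda>h. (flat_exp d m (0 + h) - flat_exp d m 0) / h) \<midarrow>0\<rightarrow> 0"
    proof (rule Lim_null_comparison)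
      have "(\<lambda>h. C * \<bar>h\<bar>) \<midarrow>0\<rightarrow> C * \<bar>0\<bar>"
        by (intro tendsto_intros)
      then show "(\<lambda>h. C * \<bar>h\<bar>) \<midarrow>0\<rightarrow> 0" by simp
      show "\<forall>\<^sub>F h in at 0. norm ((flat_exp d m (0 + h) - flat_exp d m 0) / h) \<le> C * \<bar>h\<bar>"
      proof (rule eventually_at_filter[THEN iffD2], rule always_eventually, intro allI impI)
        fix h :: real assume h: "h \<noteq> 0"
        have "\<bar>flat_exp d m h\<bar> \<le> C * (\<bar>h\<bar> * \<bar>h\<bar>)"
          using flat_exp_bound[OF d, of m h] by (simp add: C_def power2_eq_square)
        then show "norm ((flat_exp d m (0 + h) - flat_exp d m 0) / h) \<le> C * \<bar>h\<bar>"
          using h by (simp add: flat_exp_def[of d m 0] abs_divide divide_le_eq mult.assoc)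
      qed
    qed
    then show ?thesis using 3 by (simp add: DERIV_def flat_exp_def)
  qed
qed

text \<open>The derivative is a combination of members with indices \<open>m + 1\<close> and
  \<open>m + 2\<close>, hence the induction runs over all \<open>m\<close> at once. The affine
  argument covers both faces of a box in each coordinate.\<close>

lemma Ck_flat_exp:
  assumes d: "0 < d"
  shows "Ck k (\<lambda>x. flat_exp d m (x \<bullet> v + b))"
proof (induction k arbitrary: m)
  case 0
  have "continuous_on UNIV (flat_exp d m)"
    using flat_exp_deriv[OF d] by (intro DERIV_continuous_on) (auto intro: has_field_derivative_at_within)
  then show ?case
    by (auto intro!: continuous_on_compose2[of UNIV "flat_exp d m"] continuous_intros)
next
  case (Suc k)
  let ?D = "\<lambda>y. d * flat_exp d (m + 2) y + (- real m) * flat_exp d (m + 1) y"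
  have "((\<lambda>x. flat_exp d m (x \<bullet> v + b)) has_derivative (\<lambda>w. (w \<bullet> v) * ?D (x \<bullet> v + b))) (at x)" for x
  proof -
    have "((\<lambda>x. x \<bullet> v + b) has_derivative (\<lambda>w. w \<bullet> v)) (at x)"
      by (auto intro!: derivative_eq_intros)
    moreover have "(flat_exp d m has_derivative (\<lambda>w. w * ?D (x \<bullet> v + b))) (at (x \<bullet> v + b))"
      using flat_exp_deriv[OF d, of m "x \<bullet> v + b"] by (simp add: has_field_derivative_def mult.commute[of _ "_ - _"] mult_commute_abs)
    ultimately show ?thesis
      using has_derivative_compose by fastforce
  qed
  then show ?case
    by (rule Ck_derivI) (intro Ck_mult Ck_add Ck_const Suc)
qed

section \<open>Cut-offs for boxes and the fundamental lemma\<close>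

text \<open>Two one-sided cut-offs for each coordinate give, for \<open>d > 0\<close>, a smooth
  function that is positive exactly in the open box; it tends to the indicator of the box as
  \<open>d\<close> tends to 0.\<close>

definition box_bump :: "'a::euclidean_space \<Rightarrow> 'a \<Rightarrow> real \<Rightarrow> 'a \<Rightarrow> real" where
  "box_bump a b d x = (\<Prod>i\<in>Basis. flat_exp d 0 (x \<bullet> i + - (a \<bullet> i)) * flat_exp d 0 (x \<bullet> (- i) + b \<bullet> i))"

lemma test_functions_UNIV: "\<phi> \<in> test_functions UNIV \<longleftrightarrow> (\<forall>k. Ck k \<phi>) \<and> bounded {x. \<phi> x \<noteq> 0}"
  by (auto simp: test_functions_def)

lemma box_bump_nonzero: "box_bump a b d x \<noteq> 0 \<Longrightarrow> x \<in> box a b"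
  by (auto simp: box_bump_def flat_exp_def mem_box split: if_splits)

lemma box_bump_test:
  assumes "0 < d"
  shows "box_bump a b d \<in> test_functions UNIV"
  unfolding test_functions_UNIV
proof (intro conjI allI)
  show "bounded {x. box_bump a b d x \<noteq> 0}"
    by (rule bounded_subset[OF bounded_box[of a b]]) (auto dest: box_bump_nonzero)
  have eq: "box_bump a b d = (\<lambda>x. \<Prod>i\<in>Basis. flat_exp d 0 (x \<bullet> i + - (a \<bullet> i)) * flat_exp d 0 (x \<bullet> (- i) + b \<bullet> i))"
    by (simp add: box_bump_def fun_eq_iff)
  show "Ck k (box_bump a b d)" for k
    unfolding eq by (intro Ck_prod Ck_mult Ck_flat_exp assms finite_Basis)
qed

lemma box_bump_bounds: "0 < d \<Longrightarrow> 0 \<le> box_bump a b d x \<and> box_bump a b d x \<le> indicator (cbox a b) x"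
proof -
  assume d: "0 < d"
  have fe: "0 \<le> flat_exp d 0 y" "flat_exp d 0 y \<le> 1" for y
    using d by (auto simp: flat_exp_def)
  have "box_bump a b d x \<le> 1"
    unfolding box_bump_def using fe by (intro prod_le_1) (auto intro: mult_le_one)
  moreover have "0 \<le> box_bump a b d x"
    unfolding box_bump_def using fe by (intro prod_nonneg) auto
  moreover have "x \<in> cbox a b" if "box_bump a b d x \<noteq> 0"
    using box_bump_nonzero[OF that] box_subset_cbox by blast
  ultimately show ?thesis by (auto split: split_indicator)
qed

lemma box_bump_tendsto: "(\<lambda>k. box_bump a b (1 / real (Suc k)) x) \<longlonglongrightarrow> indicator (box a b) x"
proof (cases "x \<in> box a b")
  case True
  have fe: "(\<lambda>k. flat_exp (1 / real (Suc k)) 0 y) \<longlonglongrightarrow> 1" if "0 < y" for y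
  proof -
    have "(\<lambda>k. exp (- (1 / real (Suc k)) / y)) \<longlonglongrightarrow> exp (- 0 / y)"
      using that by (intro tendsto_intros LIMSEQ_Suc lim_1_over_n) auto
    then show ?thesis using that by (simp add: flat_exp_def)
  qed
  have "(\<lambda>k. box_bump a b (1 / real (Suc k)) x) \<longlonglongrightarrow> (\<Prod>i\<in>(Basis::'a set). 1 * 1)"
    unfolding box_bump_def using True by (intro tendsto_prod tendsto_mult fe) (auto simp: mem_box)
  then show ?thesis using True by simp
next
  case False
  then have "box_bump a b d x = 0" for d using box_bump_nonzero by blast
  then show ?thesis using False by simp
qed

lemma Ck_0_borel: "Ck k \<phi> \<Longrightarrow> \<phi> \<in> borel_measurable borel"
proof (induction k)
  case (Suc k)
  then show ?case using Ck_Suc_imp by blast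
qed (simp add: borel_measurable_continuous_onI)

text \<open>The cut-offs approximate the indicator of a box under a common integrable bound, so all
  cube averages of \<open>f\<close> vanish; Lebesgue differentiation then recovers \<open>f\<close>.
  No mollification is involved.\<close>

lemma fundamental_lemma:
  fixes f :: "'a::euclidean_space \<Rightarrow> real"
  assumes [measurable]: "f \<in> borel_measurable borel"
    and f: "\<And>y r. set_integrable lborel (cube y r) f"
    and zero: "\<And>\<phi>. \<phi> \<in> test_functions UNIV \<Longrightarrow> (LINT x|lborel. f x * \<phi> x) = 0"
  shows "AE x in lborel. f x = 0"
proof -
  have avg: "cube_avg f y r = 0" for y r
  proof -
    define a b where "a = y" and "b = y + r *\<^sub>R One"
    have cube: "cube y r = cbox a b" by (simp add: cube_def a_def b_def)
    have [measurable]: "box_bump a b (1 / real (Suc k)) \<in> borel_measurable borel" for k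
      using box_bump_test[of "1 / real (Suc k)" a b] Ck_0_borel by (auto simp: test_functions_UNIV)
    have "(\<lambda>k. LINT x|lborel. f x * box_bump a b (1 / real (Suc k)) x) \<longlonglongrightarrow> (LINT x|lborel. f x * indicator (box a b) x)"
    proof (rule integral_dominated_convergence)
      show "integrable lborel (\<lambda>x. \<bar>f x\<bar> * indicator (cbox a b) x)"
        using integrable_abs[OF f[of y r, unfolded set_integrable_def cube]] by (simp add: abs_mult mult.commute)
      show "AE x in lborel. (\<lambda>k. f x * box_bump a b (1 / real (Suc k)) x) \<longlonglongrightarrow> f x * indicator (box a b) x"
        by (intro AE_I2 tendsto_mult tendsto_const box_bump_tendsto)
      show "AE x in lborel. norm (f x * box_bump a b (1 / real (Suc k)) x) \<le> \<bar>f x\<bar> * indicator (cbox a b) x" for k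
        using box_bump_bounds[of "1 / real (Suc k)" a b] by (intro AE_I2) (auto simp: abs_mult intro!: mult_left_mono)
    qed measurable
    moreover have "(LINT x|lborel. f x * box_bump a b (1 / real (Suc k)) x) = 0" for k
      by (intro zero box_bump_test) simp
    ultimately have "(LINT x|lborel. f x * indicator (box a b) x) = 0"
      by (simp add: LIMSEQ_const_iff)
    moreover have "(LINT x|lborel. f x * indicator (box a b) x) = (LINT x:cube y r|lborel. f x)"
      unfolding set_lebesgue_integral_def cube
    proof (rule integral_cong_AE)
      show "AE x in lborel. f x * indicat_real (box a b) x = indicat_real (cbox a b) x *\<^sub>R f x"
        using AE_not_negligible[OF negligible_frontier_interval[of a b]] box_subset_cbox[of a b]
        by (auto elim!: eventually_mono split: split_indicator)
    qed measurable
    ultimately show ?thesis by (simp add: cube_avg_def)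
  qed
  obtain N where N: "negligible N" "\<And>x r. x \<notin> N \<Longrightarrow> 0 < r \<Longrightarrow> (\<lambda>k. cube_avg f x (r / 2 ^ k)) \<longlonglongrightarrow> f x"
    using cube_avg_lebesgue[OF f] by blast
  show ?thesis
    using AE_not_negligible[OF N(1)]
  proof eventually_elim
    case (elim x)
    from N(2)[OF this, of 1] show ?case by (simp add: avg LIMSEQ_const_iff)
  qed
qed


section \<open>Weak gradients control translates\<close>

text \<open>Local integrability is expressed through cubes, the form required by the differentiation
  lemma.\<close>

definition loc_int :: "('a::euclidean_space \<Rightarrow> real) \<Rightarrow> bool" where
  "loc_int f \<longleftrightarrow> f \<in> borel_measurable borel \<and> (\<forall>y r. set_integrable lborel (cube y r) f)"

text \<open>Collects what the integrability arguments use of test functions and of their derivatives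
  alike.\<close>

definition bump :: "('a::euclidean_space \<Rightarrow> real) \<Rightarrow> bool" where
  "bump \<psi> \<longleftrightarrow> continuous_on UNIV \<psi> \<and> bounded {x. \<psi> x \<noteq> 0}"

lemma loc_int_borel: "loc_int f \<Longrightarrow> f \<in> borel_measurable borel"
  by (simp add: loc_int_def)

lemma bump_borel: "bump \<psi> \<Longrightarrow> \<psi> \<in> borel_measurable borel"
  by (simp add: bump_def borel_measurable_continuous_onI)

lemma bumpE:
  assumes "bump \<psi>"
  obtains M R where "0 < M" "\<And>x. \<bar>\<psi> x\<bar> \<le> M" "\<And>x. \<psi> x \<noteq> 0 \<Longrightarrow> norm x \<le> R"
proof -
  obtain R where R: "\<And>x. \<psi> x \<noteq> 0 \<Longrightarrow> norm x \<le> R"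
    using assms unfolding bump_def bounded_iff by blast
  have "compact (\<psi> ` cball 0 R)"
    using assms unfolding bump_def by (intro compact_continuous_image compact_cball) (rule continuous_on_subset, auto)
  then obtain M where M: "\<And>y. y \<in> \<psi> ` cball 0 R \<Longrightarrow> norm y \<le> M"
    using compact_imp_bounded bounded_iff by metis
  have "\<bar>\<psi> x\<bar> \<le> \<bar>M\<bar> + 1" for x
  proof (cases "\<psi> x = 0")
    case False
    then have "x \<in> cball 0 R" using R by simp
    from M[OF imageI[OF this]] show ?thesis by simp
  qed simp
  then show ?thesis
    using that[of "\<bar>M\<bar> + 1" R] R by auto
qed

lemma cube_contains:
  fixes x :: "'a::euclidean_space"
  assumes "norm x \<le> R"
  shows "x \<in> cube (- R *\<^sub>R One) (2 * R)"
  using assms Basis_le_norm[of _ x] unfolding cube_def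
  by (fastforce simp: mem_box inner_simps abs_le_iff)

lemma cube_bound:
  fixes y :: "'a::euclidean_space"
  obtains R where "\<And>x. x \<in> cube y r \<Longrightarrow> norm x \<le> R"
  using bounded_cbox[of y "y + r *\<^sub>R One"] unfolding bounded_iff cube_def by blast

lemma integral_translate:
  fixes f :: "'a::euclidean_space \<Rightarrow> real"
  assumes "f \<in> borel_measurable borel"
  shows "(LINT x|lborel. f (x + h)) = (LINT x|lborel. f x)"
  using integral_distr[of "(+) h" lborel borel f] assms
  by (simp add: lborel_distr_plus add.commute)

lemma nn_integral_loc_int_bound:
  assumes f: "loc_int f"
  shows "(\<integral>\<^sup>+x. ennreal (\<bar>f x\<bar> * indicator {x. norm x \<le> R} x) \<partial>lborel) < \<infinity>"
proof -
  let ?Q = "cube (- R *\<^sub>R One) (2 * R)"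
  have "(\<integral>\<^sup>+x. ennreal (\<bar>f x\<bar> * indicator {x. norm x \<le> R} x) \<partial>lborel) \<le> (\<integral>\<^sup>+x. ennreal (norm (indicator ?Q x *\<^sub>R f x)) \<partial>lborel)"
    using cube_contains by (intro nn_integral_mono ennreal_leI) (auto split: split_indicator)
  also have "\<dots> < \<infinity>"
    using f unfolding loc_int_def set_integrable_def integrable_iff_bounded by blast
  finally show ?thesis .
qed

lemma integrable_loc_int_bump:
  assumes f: "loc_int f" and \<psi>: "bump \<psi>"
  shows "integrable lborel (\<lambda>x. f x * \<psi> x)"
proof (rule integrableI_bounded)
  note [measurable] = loc_int_borel[OF f] bump_borel[OF \<psi>]
  obtain M R where M: "0 < M" "\<And>x. \<bar>\<psi> x\<bar> \<le> M" "\<And>x. \<psi> x \<noteq> 0 \<Longrightarrow> norm x \<le> R"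
    using bumpE[OF \<psi>] by blast
  show "(\<lambda>x. f x * \<psi> x) \<in> borel_measurable lborel" by measurable
  have "(\<integral>\<^sup>+x. ennreal (norm (f x * \<psi> x)) \<partial>lborel) \<le> (\<integral>\<^sup>+x. ennreal M * ennreal (\<bar>f x\<bar> * indicator {x. norm x \<le> R} x) \<partial>lborel)"
  proof (rule nn_integral_mono)
    fix x
    show "ennreal (norm (f x * \<psi> x)) \<le> ennreal M * ennreal (\<bar>f x\<bar> * indicator {x. norm x \<le> R} x)"
      using M(1) M(2)[of x] M(3)[of x]
      by (cases "\<psi> x = 0") (auto simp: abs_mult ennreal_mult[symmetric] mult.commute[of M] intro!: ennreal_leI mult_left_mono)
  qed
  also have "\<dots> = ennreal M * (\<integral>\<^sup>+x. ennreal (\<bar>f x\<bar> * indicator {x. norm x \<le> R} x) \<partial>lborel)"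
    by (rule nn_integral_cmult) measurable
  also have "\<dots> < \<infinity>"
    using nn_integral_loc_int_bound[OF f] by (simp add: ennreal_mult_less_top)
  finally show "(\<integral>\<^sup>+x. ennreal (norm (f x * \<psi> x)) \<partial>lborel) < \<infinity>" .
qed

lemma loc_intI:
  assumes [measurable]: "f \<in> borel_measurable borel"
    and fin: "\<And>R. (\<integral>\<^sup>+x. ennreal (\<bar>f x\<bar> * indicator {x. norm x \<le> R} x) \<partial>lborel) < \<infinity>"
  shows "loc_int f"
  unfolding loc_int_def
proof (intro conjI allI assms(1))
  fix y :: 'a and r
  obtain R where R: "\<And>x. x \<in> cube y r \<Longrightarrow> norm x \<le> R" using cube_bound by blast
  show "set_integrable lborel (cube y r) f"
    unfolding set_integrable_def
  proof (rule integrableI_bounded)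
    have "(\<integral>\<^sup>+x. ennreal (norm (indicator (cube y r) x *\<^sub>R f x)) \<partial>lborel) \<le> (\<integral>\<^sup>+x. ennreal (\<bar>f x\<bar> * indicator {x. norm x \<le> R} x) \<partial>lborel)"
      using R by (intro nn_integral_mono ennreal_leI) (auto split: split_indicator)
    then show "(\<integral>\<^sup>+x. ennreal (norm (indicator (cube y r) x *\<^sub>R f x)) \<partial>lborel) < \<infinity>"
      using fin[of R] by (rule le_less_trans)
  qed measurable
qed

lemma loc_int_translate:
  assumes f: "loc_int f"
  shows "loc_int (\<lambda>x. f (x + h))"
proof (rule loc_intI)
  note [measurable] = loc_int_borel[OF f]
  show "(\<lambda>x. f (x + h)) \<in> borel_measurable borel" by measurable
  fix R
  have "(\<integral>\<^sup>+x. ennreal (\<bar>f (x + h)\<bar> * indicator {x. norm x \<le> R} x) \<partial>lborel)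
      \<le> (\<integral>\<^sup>+x. ennreal (\<bar>f (x + h)\<bar> * indicator {x. norm x \<le> R + norm h} (x + h)) \<partial>lborel)"
  proof (intro nn_integral_mono ennreal_leI mult_left_mono)
    fix x
    show "indicator {x. norm x \<le> R} x \<le> (indicator {x. norm x \<le> R + norm h} (x + h) :: real)"
      using norm_triangle_ineq[of x h] by (auto split: split_indicator)
  qed auto
  also have "\<dots> = (\<integral>\<^sup>+x. ennreal (\<bar>f x\<bar> * indicator {x. norm x \<le> R + norm h} x) \<partial>lborel)"
    by (rule nn_integral_translate) measurable
  also have "\<dots> < \<infinity>" by (rule nn_integral_loc_int_bound[OF f])
  finally show "(\<integral>\<^sup>+x. ennreal (\<bar>f (x + h)\<bar> * indicator {x. norm x \<le> R} x) \<partial>lborel) < \<infinity>" .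
qed

text \<open>Two directions are allowed because the integration by parts below needs the shift once
  in the test function, with \<open>a = 0\<close>, and once in the gradient, with
  \<open>b = 0\<close>. Where the shifted \<open>\<psi>\<close> does not vanish,
  \<open>x + \<tau> *\<^sub>R a\<close> lies in the ball of radius \<open>R + norm (a - b)\<close>,
  and translation invariance gives a bound uniform in \<open>\<tau>\<close>.\<close>

lemma Fubini_loc_int:
  fixes f \<psi> :: "'a::euclidean_space \<Rightarrow> real"
  assumes f: "loc_int f" and \<psi>: "bump \<psi>"
  shows "(LINT x|lborel. LINT \<tau>|lborel. indicator {0..1::real} \<tau> * (f (x + \<tau> *\<^sub>R a) * \<psi> (x + \<tau> *\<^sub>R b)))
       = (LINT \<tau>|lborel. LINT x|lborel. indicator {0..1::real} \<tau> * (f (x + \<tau> *\<^sub>R a) * \<psi> (x + \<tau> *\<^sub>R b)))"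
proof -
  note [measurable] = loc_int_borel[OF f] bump_borel[OF \<psi>]
  let ?k = "\<lambda>\<tau> x. indicator {0..1::real} \<tau> * (f (x + \<tau> *\<^sub>R a) * \<psi> (x + \<tau> *\<^sub>R b))"
  obtain M R where M: "0 < M" "\<And>x. \<bar>\<psi> x\<bar> \<le> M" "\<And>x. \<psi> x \<noteq> 0 \<Longrightarrow> norm x \<le> R"
    using bumpE[OF \<psi>] by blast
  define S where "S = R + norm (a - b)"
  define J where "J = (\<integral>\<^sup>+x. ennreal (\<bar>f x\<bar> * indicator {x. norm x \<le> S} x) \<partial>lborel)"
  have J: "J < \<infinity>" unfolding J_def by (rule nn_integral_loc_int_bound[OF f])
  have "integrable (lborel \<Otimes>\<^sub>M lborel) (case_prod ?k)"
  proof (rule integrableI_bounded)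
    show km [measurable]: "case_prod ?k \<in> borel_measurable (lborel \<Otimes>\<^sub>M lborel)" by measurable
    have "(\<integral>\<^sup>+z. ennreal (norm (case_prod ?k z)) \<partial>(lborel \<Otimes>\<^sub>M lborel)) = (\<integral>\<^sup>+\<tau>. (\<integral>\<^sup>+x. ennreal (norm (?k \<tau> x)) \<partial>lborel) \<partial>lborel)"
      by (subst lborel.nn_integral_fst[symmetric]) (use km in \<open>auto intro!: measurable_compose[OF _ measurable_ennreal]\<close>)
    also have "\<dots> \<le> (\<integral>\<^sup>+\<tau>. ennreal M * J * indicator {0..1::real} \<tau> \<partial>lborel)"
    proof (rule nn_integral_mono)
      fix \<tau> :: real
      show "(\<integral>\<^sup>+x. ennreal (norm (?k \<tau> x)) \<partial>lborel) \<le> ennreal M * J * indicator {0..1::real} \<tau>"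
      proof (cases "\<tau> \<in> {0..1}")
        case True
        have "(\<integral>\<^sup>+x. ennreal (norm (?k \<tau> x)) \<partial>lborel)
            \<le> (\<integral>\<^sup>+x. ennreal M * ennreal (\<bar>f (x + \<tau> *\<^sub>R a)\<bar> * indicator {x. norm x \<le> S} (x + \<tau> *\<^sub>R a)) \<partial>lborel)"
        proof (rule nn_integral_mono)
          fix x
          show "ennreal (norm (?k \<tau> x)) \<le> ennreal M * ennreal (\<bar>f (x + \<tau> *\<^sub>R a)\<bar> * indicator {x. norm x \<le> S} (x + \<tau> *\<^sub>R a))"
          proof (cases "\<psi> (x + \<tau> *\<^sub>R b) = 0")
            case False
            have "norm (x + \<tau> *\<^sub>R a) = norm ((x + \<tau> *\<^sub>R b) + \<tau> *\<^sub>R (a - b))"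
              by (simp add: algebra_simps)
            also have "\<dots> \<le> norm (x + \<tau> *\<^sub>R b) + norm (\<tau> *\<^sub>R (a - b))"
              by (rule norm_triangle_ineq)
            also have "norm (\<tau> *\<^sub>R (a - b)) \<le> norm (a - b)"
              using True by (simp add: mult_left_le_one_le)
            finally have "norm (x + \<tau> *\<^sub>R a) \<le> S"
              using M(3)[OF False] by (simp add: S_def)
            then show ?thesis
              using True M(1) M(2)[of "x + \<tau> *\<^sub>R b"]
              by (auto simp: abs_mult ennreal_mult[symmetric] mult.commute[of M] intro!: ennreal_leI mult_left_mono)
          qed simp
        qed
        also have "\<dots> = ennreal M * (\<integral>\<^sup>+x. ennreal (\<bar>f (x + \<tau> *\<^sub>R a)\<bar> * indicator {x. norm x \<le> S} (x + \<tau> *\<^sub>R a)) \<partial>lborel)"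
          by (rule nn_integral_cmult) measurable
        also have "(\<integral>\<^sup>+x. ennreal (\<bar>f (x + \<tau> *\<^sub>R a)\<bar> * indicator {x. norm x \<le> S} (x + \<tau> *\<^sub>R a)) \<partial>lborel) = J"
          unfolding J_def by (rule nn_integral_translate) measurable
        finally show ?thesis using True by simp
      qed simp
    qed
    also have "\<dots> = ennreal M * J"
      by (simp add: nn_integral_cmult_indicator)
    also have "\<dots> < \<infinity>" using J by (simp add: ennreal_mult_less_top)
    finally show "(\<integral>\<^sup>+z. ennreal (norm (case_prod ?k z)) \<partial>(lborel \<Otimes>\<^sub>M lborel)) < \<infinity>" .
  qed
  then show ?thesis by (rule lborel_pair.Fubini_integral)
qed

lemma test_function_bump: "\<phi> \<in> test_functions UNIV \<Longrightarrow> bump \<phi>"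
  unfolding test_functions_UNIV bump_def by (metis Ck.simps(1))

lemma test_function_deriv_bump:
  assumes "\<phi> \<in> test_functions UNIV"
  shows "bump (\<lambda>x. frechet_derivative \<phi> (at x) h)"
  unfolding bump_def
proof
  have "Ck (Suc 0) \<phi>" using assms by (simp add: test_functions_UNIV del: Ck.simps)
  then show "continuous_on UNIV (\<lambda>x. frechet_derivative \<phi> (at x) h)" by simp
  let ?S = "closure {x. \<phi> x \<noteq> 0}"
  have "frechet_derivative \<phi> (at x) h = 0" if "x \<notin> ?S" for x
  proof -
    have "((\<lambda>x. 0) has_derivative (\<lambda>h. 0)) (at x)" by simp
    then have "(\<phi> has_derivative (\<lambda>h. 0)) (at x)"
      by (rule has_derivative_transform_within_open[of _ _ _ _ "- ?S"])
        (use that closure_subset[of "{x. \<phi> x \<noteq> 0}"] in auto)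
    from frechet_derivative_at[OF this] show ?thesis by (metis)
  qed
  then have "{x. frechet_derivative \<phi> (at x) h \<noteq> 0} \<subseteq> ?S" by blast
  then show "bounded {x. frechet_derivative \<phi> (at x) h \<noteq> 0}"
    using assms bounded_subset bounded_closure unfolding test_functions_UNIV by blast
qed

lemma test_function_has_derivative:
  "\<phi> \<in> test_functions UNIV \<Longrightarrow> (\<phi> has_derivative frechet_derivative \<phi> (at x)) (at x)"
  unfolding test_functions_UNIV using Ck_derivD(1) by blast

lemma test_function_translate:
  assumes \<phi>: "\<phi> \<in> test_functions UNIV"
  shows "(\<lambda>x. \<phi> (x + c)) \<in> test_functions UNIV"
    and "frechet_derivative (\<lambda>x. \<phi> (x + c)) (at x) = frechet_derivative \<phi> (at (x + c))"
proof -
  have "{x. \<phi> (x + c) \<noteq> 0} = (+) (- c) ` {x. \<phi> x \<noteq> 0}"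
    by (auto simp: image_iff algebra_simps)
  then show "(\<lambda>x. \<phi> (x + c)) \<in> test_functions UNIV"
    using \<phi> bounded_translation[of "{x. \<phi> x \<noteq> 0}" "- c"] Ck_translate unfolding test_functions_UNIV by metis
  have "((\<lambda>x. x + c) has_derivative (\<lambda>v. v)) (at x)"
    by (auto intro!: derivative_eq_intros)
  from has_derivative_compose[OF this test_function_has_derivative[OF \<phi>]]
  show "frechet_derivative (\<lambda>x. \<phi> (x + c)) (at x) = frechet_derivative \<phi> (at (x + c))"
    by (rule frechet_derivative_at[symmetric])
qed

section \<open>From weak derivatives to differences of the function\<close>

text \<open>The weak gradient for Borel versions on the whole space; \<open>loc_int\<close> is
  applied to the norm because it speaks of real functions.\<close>

definition borel_weak_gradient :: "('a::euclidean_space \<Rightarrow> real) \<Rightarrow> ('a \<Rightarrow> 'a) \<Rightarrow> bool" where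
  "borel_weak_gradient u g \<longleftrightarrow> loc_int u \<and> g \<in> borel_measurable borel \<and> loc_int (\<lambda>x. norm (g x)) \<and>
     (\<forall>\<phi> \<in> test_functions UNIV. \<forall>i \<in> Basis.
        (LINT x|lborel. u x * frechet_derivative \<phi> (at x) i) = - (LINT x|lborel. (g x \<bullet> i) * \<phi> x))"

lemma loc_int_inner:
  fixes g :: "'a::euclidean_space \<Rightarrow> 'a"
  assumes [measurable]: "g \<in> borel_measurable borel" and g: "loc_int (\<lambda>x. norm (g x))"
  shows "loc_int (\<lambda>x. g x \<bullet> h)"
proof (rule loc_intI)
  fix R
  have "(\<integral>\<^sup>+x. ennreal (\<bar>g x \<bullet> h\<bar> * indicator {x. norm x \<le> R} x) \<partial>lborel)
      \<le> (\<integral>\<^sup>+x. ennreal (norm h) * ennreal (\<bar>norm (g x)\<bar> * indicator {x. norm x \<le> R} x) \<partial>lborel)"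
    using Cauchy_Schwarz_ineq2[of _ h]
    by (intro nn_integral_mono) (auto simp: ennreal_mult[symmetric] mult.commute[of "norm h"] intro!: ennreal_leI split: split_indicator)
  also have "\<dots> = ennreal (norm h) * (\<integral>\<^sup>+x. ennreal (\<bar>norm (g x)\<bar> * indicator {x. norm x \<le> R} x) \<partial>lborel)"
    by (rule nn_integral_cmult) measurable
  also have "\<dots> < \<infinity>"
    using nn_integral_loc_int_bound[OF g, of R] by (simp add: ennreal_mult_less_top)
  finally show "(\<integral>\<^sup>+x. ennreal (\<bar>g x \<bullet> h\<bar> * indicator {x. norm x \<le> R} x) \<partial>lborel) < \<infinity>" .
qed measurable

lemma weak_gradient_direction:
  assumes wg: "borel_weak_gradient u g" and \<phi>: "\<phi> \<in> test_functions UNIV"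
  shows "(LINT x|lborel. u x * frechet_derivative \<phi> (at x) h) = - (LINT x|lborel. (g x \<bullet> h) * \<phi> x)"
proof -
  have u: "loc_int u" and g: "loc_int (\<lambda>x. g x \<bullet> i)" for i
    using wg loc_int_inner unfolding borel_weak_gradient_def by auto
  have D: "frechet_derivative \<phi> (at x) h = (\<Sum>i\<in>Basis. (h \<bullet> i) * frechet_derivative \<phi> (at x) i)" for x
  proof -
    have lin: "linear (frechet_derivative \<phi> (at x))"
      using test_function_has_derivative[OF \<phi>] by (rule has_derivative_linear)
    have "frechet_derivative \<phi> (at x) (\<Sum>i\<in>Basis. (h \<bullet> i) *\<^sub>R i) = (\<Sum>i\<in>Basis. (h \<bullet> i) * frechet_derivative \<phi> (at x) i)"
      by (simp add: linear_sum[OF lin] linear_scale[OF lin])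
    then show ?thesis by (simp add: euclidean_representation)
  qed
  have "(LINT x|lborel. u x * frechet_derivative \<phi> (at x) h)
      = (LINT x|lborel. (\<Sum>i\<in>Basis. (h \<bullet> i) * (u x * frechet_derivative \<phi> (at x) i)))"
    unfolding D by (simp add: sum_distrib_left mult_ac)
  also have "\<dots> = (\<Sum>i\<in>Basis. (h \<bullet> i) * (LINT x|lborel. u x * frechet_derivative \<phi> (at x) i))"
    using integrable_loc_int_bump[OF u test_function_deriv_bump[OF \<phi>]]
    by (subst Bochner_Integration.integral_sum) auto
  also have "\<dots> = - (\<Sum>i\<in>Basis. (h \<bullet> i) * (LINT x|lborel. (g x \<bullet> i) * \<phi> x))"
    using wg \<phi> by (simp add: borel_weak_gradient_def sum_negf)
  also have "(\<Sum>i\<in>Basis. (h \<bullet> i) * (LINT x|lborel. (g x \<bullet> i) * \<phi> x)) = (LINT x|lborel. (\<Sum>i\<in>Basis. (h \<bullet> i) * ((g x \<bullet> i) * \<phi> x)))"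
    using integrable_loc_int_bump[OF g test_function_bump[OF \<phi>]]
    by (subst Bochner_Integration.integral_sum) auto
  also have "\<dots> = (LINT x|lborel. (g x \<bullet> h) * \<phi> x)"
    by (rule Bochner_Integration.integral_cong)
      (auto simp: euclidean_inner[of "g _" h] sum_distrib_left mult_ac)
  finally show ?thesis .
qed

text \<open>The fundamental theorem of calculus is applied to the smooth \<open>\<phi>\<close> along
  the segment, not to \<open>u\<close>. At each \<open>\<tau>\<close> the translate of
  \<open>\<phi>\<close> is again a test function, so the derivative passes to \<open>u\<close> as
  its weak gradient, and translating the integral puts the shift on \<open>g\<close>.\<close>

lemma weak_gradient_translate_identity:
  fixes u :: "'a::euclidean_space \<Rightarrow> real"
  assumes wg: "borel_weak_gradient u g" and \<phi>: "\<phi> \<in> test_functions UNIV"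
  shows "(LINT x|lborel. u x * (\<phi> (x + (- h)) - \<phi> x))
    = (LINT x|lborel. (LINT \<tau>|lborel. indicator {0..1::real} \<tau> * (g (x + \<tau> *\<^sub>R h) \<bullet> h)) * \<phi> x)"
proof -
  have u: "loc_int u" and g: "loc_int (\<lambda>x. g x \<bullet> h)"
    using wg loc_int_inner unfolding borel_weak_gradient_def by auto
  note b = test_function_bump[OF \<phi>] and Db = test_function_deriv_bump[OF \<phi>]
  note [measurable] = loc_int_borel[OF u] loc_int_borel[OF g] bump_borel[OF b]
  let ?D = "\<lambda>x. frechet_derivative \<phi> (at x) (- h)"
  have FTC: "\<phi> (x + (- h)) - \<phi> x = (LINT \<tau>|lborel. indicator {0..1::real} \<tau> * ?D (x + \<tau> *\<^sub>R (- h)))" for x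
  proof -
    have der: "((\<lambda>\<tau>. \<phi> (x + \<tau> *\<^sub>R (- h))) has_vector_derivative ?D (x + \<tau> *\<^sub>R (- h))) (at \<tau> within {0..1})" for \<tau>
    proof -
      have "((\<lambda>\<tau>. x + \<tau> *\<^sub>R (- h)) has_derivative (\<lambda>t. t *\<^sub>R (- h))) (at \<tau> within {0..1})"
        by (auto intro!: derivative_eq_intros)
      from has_derivative_compose[OF this test_function_has_derivative[OF \<phi>]]
      show ?thesis
        unfolding has_vector_derivative_def
        by (simp only: linear_scale[OF has_derivative_linear[OF test_function_has_derivative[OF \<phi>]]])
    qed
    have "continuous_on UNIV ?D"
      using Db[of "- h"] by (simp add: bump_def)
    then have "continuous_on {0..1} (\<lambda>\<tau>. ?D (x + \<tau> *\<^sub>R (- h)))"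
      by (rule continuous_on_compose2) (auto intro!: continuous_intros)
    from integral_FTC_atLeastAtMost[OF _ der this] show ?thesis by simp
  qed
  have "(LINT x|lborel. u x * (\<phi> (x + (- h)) - \<phi> x))
      = (LINT x|lborel. LINT \<tau>|lborel. indicator {0..1::real} \<tau> * (u (x + \<tau> *\<^sub>R 0) * ?D (x + \<tau> *\<^sub>R (- h))))"
    unfolding FTC integral_mult_right_zero[symmetric]
    by (intro Bochner_Integration.integral_cong refl) (simp only: scaleR_zero_right add_0_right mult.left_commute)
  also have "\<dots> = (LINT \<tau>|lborel. LINT x|lborel. indicator {0..1::real} \<tau> * (u (x + \<tau> *\<^sub>R 0) * ?D (x + \<tau> *\<^sub>R (- h))))"
    by (rule Fubini_loc_int[OF u Db])
  also have "\<dots> = (LINT \<tau>|lborel. LINT x|lborel. indicator {0..1::real} \<tau> * ((g (x + \<tau> *\<^sub>R h) \<bullet> h) * \<phi> (x + \<tau> *\<^sub>R 0)))"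
  proof (rule Bochner_Integration.integral_cong[OF refl])
    fix \<tau> :: real
    let ?\<phi> = "\<lambda>x. \<phi> (x + \<tau> *\<^sub>R (- h))"
    have "(LINT x|lborel. u x * ?D (x + \<tau> *\<^sub>R (- h))) = (LINT x|lborel. (g x \<bullet> h) * ?\<phi> x)"
      using weak_gradient_direction[OF wg test_function_translate(1)[OF \<phi>], of "\<tau> *\<^sub>R (- h)" "- h"]
      unfolding test_function_translate(2)[OF \<phi>] by simp
    also have "\<dots> = (LINT x|lborel. (g (x + \<tau> *\<^sub>R h) \<bullet> h) * ?\<phi> (x + \<tau> *\<^sub>R h))"
      by (rule integral_translate[symmetric]) measurable
    finally show "(LINT x|lborel. indicator {0..1::real} \<tau> * (u (x + \<tau> *\<^sub>R 0) * ?D (x + \<tau> *\<^sub>R (- h))))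
        = (LINT x|lborel. indicator {0..1::real} \<tau> * ((g (x + \<tau> *\<^sub>R h) \<bullet> h) * \<phi> (x + \<tau> *\<^sub>R 0)))"
      by simp
  qed
  also have "\<dots> = (LINT x|lborel. LINT \<tau>|lborel. indicator {0..1::real} \<tau> * ((g (x + \<tau> *\<^sub>R h) \<bullet> h) * \<phi> (x + \<tau> *\<^sub>R 0)))"
    by (rule Fubini_loc_int[OF g b, symmetric])
  also have "\<dots> = (LINT x|lborel. (LINT \<tau>|lborel. indicator {0..1::real} \<tau> * (g (x + \<tau> *\<^sub>R h) \<bullet> h)) * \<phi> x)"
    unfolding integral_mult_left_zero[symmetric]
    by (intro Bochner_Integration.integral_cong refl) (simp only: scaleR_zero_right add_0_right mult.assoc)
  finally show ?thesis .
qed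

lemma seg_integral_bound:
  fixes g :: "'a::euclidean_space \<Rightarrow> 'a"
  assumes [measurable]: "g \<in> borel_measurable borel"
  shows "ennreal \<bar>LINT \<tau>|lborel. indicator {0..1::real} \<tau> * (g (x + \<tau> *\<^sub>R h) \<bullet> h)\<bar>
    \<le> ennreal (norm h) * seg (\<lambda>z. ennreal (norm (g z))) x h"
proof -
  let ?k = "\<lambda>\<tau>. indicator {0..1::real} \<tau> * (g (x + \<tau> *\<^sub>R h) \<bullet> h)"
  have "ennreal \<bar>LINT \<tau>|lborel. ?k \<tau>\<bar> \<le> (\<integral>\<^sup>+\<tau>. ennreal \<bar>?k \<tau>\<bar> \<partial>lborel)"
  proof (cases "integrable lborel ?k")
    case True
    from integral_norm_bound_ennreal[OF this] show ?thesis by simp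
  \<comment> \<open>A non-integrable integrand has integral 0 by convention, so the bound holds at
    every \<open>x\<close>.\<close>
  qed (simp add: not_integrable_integral_eq)
  also have "\<dots> \<le> (\<integral>\<^sup>+\<tau>. ennreal (norm h) * (ennreal (norm (g (x + \<tau> *\<^sub>R h))) * indicator {0..1::real} \<tau>) \<partial>lborel)"
    using Cauchy_Schwarz_ineq2[of _ h]
    by (intro nn_integral_mono) (auto simp: ennreal_mult[symmetric] mult.commute[of "norm h"] intro!: ennreal_leI split: split_indicator)
  also have "\<dots> = ennreal (norm h) * seg (\<lambda>z. ennreal (norm (g z))) x h"
    unfolding seg_def by (rule nn_integral_cmult) measurable
  finally show ?thesis .
qed

text \<open>The difference of \<open>u\<close> and the segment integral \<open>w\<close> agree when
  tested against every test function, so the fundamental lemma identifies them almost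
  everywhere.\<close>

lemma weak_gradient_translate:
  fixes u :: "'a::euclidean_space \<Rightarrow> real"
  assumes wg: "borel_weak_gradient u g"
  shows "translate_gradient u (\<lambda>x. norm (g x))"
  unfolding translate_gradient_def
proof
  fix h :: 'a
  have u: "loc_int u" and gm [measurable]: "g \<in> borel_measurable borel" and gn: "loc_int (\<lambda>x. norm (g x))"
    using wg unfolding borel_weak_gradient_def by auto
  note [measurable] = loc_int_borel[OF u]
  define w where "w x = (LINT \<tau>|lborel. indicator {0..1::real} \<tau> * (g (x + \<tau> *\<^sub>R h) \<bullet> h))" for x
  have [measurable]: "w \<in> borel_measurable borel" unfolding w_def by measurable
  have wb: "ennreal \<bar>w x\<bar> \<le> ennreal (norm h) * seg (\<lambda>z. ennreal (norm (g z))) x h" for x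
    unfolding w_def by (rule seg_integral_bound) measurable
  have w: "loc_int w"
  proof (rule loc_intI)
    fix R
    \<comment> \<open>For \<open>norm x \<le> R\<close> the segment stays within radius
      \<open>R + norm h\<close>, so \<open>g\<close> may be cut off there before the integral over
      the segment is exchanged with the one over \<open>x\<close>.\<close>
    let ?f = "\<lambda>z. ennreal (\<bar>norm (g z)\<bar> * indicator {x. norm x \<le> R + norm h} z)"
    have "(\<integral>\<^sup>+x. ennreal (\<bar>w x\<bar> * indicator {x. norm x \<le> R} x) \<partial>lborel) \<le> (\<integral>\<^sup>+x. ennreal (norm h) * seg ?f x h \<partial>lborel)"
    proof (rule nn_integral_mono)
      fix x
      show "ennreal (\<bar>w x\<bar> * indicator {x. norm x \<le> R} x) \<le> ennreal (norm h) * seg ?f x h"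
      proof (cases "norm x \<le> R")
        case True
        have "norm (x + \<tau> *\<^sub>R h) \<le> R + norm h" if "\<tau> \<in> {0..1}" for \<tau>
          using that True norm_triangle_ineq[of x "\<tau> *\<^sub>R h"] mult_left_le_one_le[of "norm h" "\<bar>\<tau>\<bar>"] by auto
        then have "seg (\<lambda>z. ennreal (norm (g z))) x h = seg ?f x h"
          unfolding seg_def by (intro nn_integral_cong) (auto split: split_indicator)
        then show ?thesis using wb[of x] True by simp
      qed simp
    qed
    also have "\<dots> = ennreal (norm h) * (\<integral>\<^sup>+x. ?f x \<partial>lborel)"
      by (simp add: nn_integral_cmult nn_integral_seg)
    also have "\<dots> < \<infinity>"
      using nn_integral_loc_int_bound[OF gn, of "R + norm h"] by (simp add: ennreal_mult_less_top)
    finally show "(\<integral>\<^sup>+x. ennreal (\<bar>w x\<bar> * indicator {x. norm x \<le> R} x) \<partial>lborel) < \<infinity>" .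
  qed measurable
  note uh = loc_int_translate[OF u, of h]
  have "AE x in lborel. u (x + h) - u x - w x = 0"
  proof (rule fundamental_lemma)
    show "set_integrable lborel (cube y r) (\<lambda>x. u (x + h) - u x - w x)" for y r
      using u w uh unfolding loc_int_def by (intro set_integral_diff) blast+
    fix \<phi> :: "'a \<Rightarrow> real" assume \<phi>: "\<phi> \<in> test_functions UNIV"
    note b = test_function_bump[OF \<phi>] and bt = test_function_bump[OF test_function_translate(1)[OF \<phi>]]
    note [measurable] = bump_borel[OF b]
    have "(LINT x|lborel. (u (x + h) - u x - w x) * \<phi> x)
        = (LINT x|lborel. u (x + h) * \<phi> x) - (LINT x|lborel. u x * \<phi> x) - (LINT x|lborel. w x * \<phi> x)"
      using integrable_loc_int_bump[OF u b] integrable_loc_int_bump[OF w b] integrable_loc_int_bump[OF uh b]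
      by (simp add: left_diff_distrib)
    also have "(LINT x|lborel. u (x + h) * \<phi> x) = (LINT x|lborel. u x * \<phi> (x + (- h)))"
      using integral_translate[of "\<lambda>x. u x * \<phi> (x + (- h))" h] by simp
    also have "(LINT x|lborel. u x * \<phi> (x + (- h))) - (LINT x|lborel. u x * \<phi> x) = (LINT x|lborel. u x * (\<phi> (x + (- h)) - \<phi> x))"
      unfolding right_diff_distrib
      by (rule Bochner_Integration.integral_diff[symmetric]) (rule integrable_loc_int_bump[OF u bt], rule integrable_loc_int_bump[OF u b])
    also have "\<dots> = (LINT x|lborel. w x * \<phi> x)"
      unfolding w_def by (rule weak_gradient_translate_identity[OF wg \<phi>])
    finally show "(LINT x|lborel. (u (x + h) - u x - w x) * \<phi> x) = 0" by simp
  qed measurable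
  then show "AE x in lborel. ennreal \<bar>u (x + h) - u x\<bar> \<le> ennreal (norm h) * seg (\<lambda>z. ennreal (norm (g z))) x h"
  proof (rule eventually_mono)
    fix x assume "u (x + h) - u x - w x = 0"
    then have "u (x + h) - u x = w x" by simp
    with wb[of x] show "ennreal \<bar>u (x + h) - u x\<bar> \<le> ennreal (norm h) * seg (\<lambda>z. ennreal (norm (g z))) x h"
      by simp
  qed
qed


section \<open>Normalised functions\<close>

lemma Lp_energy_cmult:
  fixes u :: "'a::euclidean_space \<Rightarrow> real"
  assumes [measurable]: "u \<in> borel_measurable borel" and c: "0 < c"
  shows "Lp_energy q (\<lambda>x. c * u x) = ennreal (c powr q) * Lp_energy q u"
  unfolding Lp_energy_def using c
  by (subst nn_integral_cmult[symmetric]) (auto simp: abs_mult powr_mult ennreal_mult intro!: nn_integral_cong)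

lemma gagliardo_energy_cmult:
  fixes u :: "'a::euclidean_space \<Rightarrow> real"
  assumes [measurable]: "u \<in> borel_measurable borel" and c: "0 < c"
  shows "gagliardo_energy s q (\<lambda>x. c * u x) = ennreal (c powr q) * gagliardo_energy s q u"
proof -
  have "gagliardo_kernel s q (\<lambda>x. c * u x) z w = ennreal (c powr q) * gagliardo_kernel s q u z w" for z w :: 'a
    using c by (simp add: abs_mult powr_mult ennreal_mult[symmetric] flip: right_diff_distrib)
  then show ?thesis
    unfolding gagliardo_energy_def by (simp add: nn_integral_cmult)
qed

lemma translate_gradient_cmult:
  fixes u g :: "'a::euclidean_space \<Rightarrow> real"
  assumes "translate_gradient u g" and [measurable]: "g \<in> borel_measurable borel" and c: "0 < c"
  shows "translate_gradient (\<lambda>x. c * u x) (\<lambda>x. c * g x)"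
  unfolding translate_gradient_def
proof
  fix h
  have seg: "seg (\<lambda>z. ennreal (c * g z)) x h = ennreal c * seg (\<lambda>z. ennreal (g z)) x h" for x
    unfolding seg_def using c by (subst nn_integral_cmult[symmetric]) (auto simp: ennreal_mult' mult.assoc)
  show "AE x in lborel. ennreal \<bar>c * u (x + h) - c * u x\<bar> \<le> ennreal (norm h) * seg (\<lambda>z. ennreal (c * g z)) x h"
    using assms(1)[unfolded translate_gradient_def, rule_format, of h]
  proof eventually_elim
    case (elim x)
    have "ennreal \<bar>c * u (x + h) - c * u x\<bar> = ennreal c * ennreal \<bar>u (x + h) - u x\<bar>"
      using c by (simp add: abs_mult ennreal_mult[symmetric] flip: right_diff_distrib)
    also have "\<dots> \<le> ennreal c * (ennreal (norm h) * seg (\<lambda>z. ennreal (g z)) x h)"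
      by (intro mult_left_mono elim) simp
    finally show ?case by (simp add: seg mult_ac)
  qed
qed

text \<open>A unit ball of the source space in terms of energies of Borel functions; the existence
  of \<open>g\<close> stands for a weak gradient of norm at most 1. It gives order one and
  fractional order a common interface.\<close>

definition unit_source :: "real \<Rightarrow> real \<Rightarrow> ('a::euclidean_space \<Rightarrow> real) \<Rightarrow> bool" where
  "unit_source s r v \<longleftrightarrow> v \<in> borel_measurable borel \<and> Lp_energy r v \<le> 1 \<and>
     (if s = 1 then \<exists>g. g \<in> borel_measurable borel \<and> (\<forall>x. 0 \<le> g x) \<and> translate_gradient v g \<and> Lp_energy r g \<le> 1
      else gagliardo_energy s r v \<le> 1)"

lemma unit_source_Morrey:
  assumes s: "0 < s" "s \<le> 1" and r: "1 \<le> r" and \<alpha>: "\<alpha> = s - real DIM('a) / r" "0 < \<alpha>"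
  obtains H where "0 < H" "\<And>v::'a::euclidean_space \<Rightarrow> real. unit_source s r v \<Longrightarrow> holder_ae H \<alpha> v"
proof (cases "s = 1")
  case True
  with \<alpha> have \<alpha>': "\<alpha> = 1 - real DIM('a) / r" by simp
  show ?thesis
    by (rule gradient_Morrey[OF r \<alpha>' \<alpha>(2)]) (rule that, use True in \<open>auto simp: unit_source_def\<close>)
next
  case False
  show ?thesis
    by (rule gagliardo_Morrey[OF r s(1) \<alpha>]) (rule that, use False in \<open>auto simp: unit_source_def\<close>)
qed

text \<open>Morrey's bound for \<open>q - p\<close> factors at fixed \<open>h\<close>; it lifts the
  gradient estimate for translates from \<open>L^p\<close> to \<open>L^q\<close>.\<close>

lemma translate_energy_interpolate:
  fixes u :: "'a::euclidean_space \<Rightarrow> real"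
  assumes H: "holder_ae H \<alpha> u" "0 \<le> H" and p: "0 < p" "p \<le> q" and [measurable]: "u \<in> borel_measurable borel"
  shows "translate_energy q u h \<le> ennreal (H powr (q - p) * norm h powr (\<alpha> * (q - p))) * translate_energy p u h"
proof -
  obtain N where N: "negligible N" "\<And>x y. x \<notin> N \<Longrightarrow> y \<notin> N \<Longrightarrow> \<bar>u x - u y\<bar> \<le> H * dist x y powr \<alpha>"
    using H unfolding holder_ae_def by blast
  let ?c = "H powr (q - p) * norm h powr (\<alpha> * (q - p))"
  have "translate_energy q u h \<le> (\<integral>\<^sup>+x. ennreal ?c * ennreal (\<bar>u (x + h) - u x\<bar> powr p) \<partial>lborel)"
    unfolding translate_energy_def
  proof (rule nn_integral_mono_AE)
    show "AE x in lborel. ennreal (\<bar>u (x + h) - u x\<bar> powr q) \<le> ennreal ?c * ennreal (\<bar>u (x + h) - u x\<bar> powr p)"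
      using AE_not_negligible[OF N(1)] AE_translate[OF N(1), of h]
    proof eventually_elim
      case (elim x)
      have "ennpow (ennreal \<bar>u (x + h) - u x\<bar>) q \<le> ennreal ((H * norm h powr \<alpha>) powr (q - p)) * ennpow (ennreal \<bar>u (x + h) - u x\<bar>) p"
        using N(2)[of "x + h" x] elim p H by (intro ennpow_interpolate ennreal_leI) (auto simp: dist_norm)
      then show ?case using H by (simp add: ennpow_ennreal powr_mult powr_powr)
    qed
  qed
  then show ?thesis unfolding translate_energy_def by (simp add: nn_integral_cmult)
qed

text \<open>The conditions leave four cases. For \<open>s < 1\<close> and
  \<open>t < \<delta>\<close> the oscillation sums apply with no sign condition on
  \<open>\<alpha>\<close>. Otherwise \<open>\<alpha> > 0\<close> and Morrey's bound is available: it
  is combined with the estimate of translates by the gradient for \<open>s = 1\<close>,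
  \<open>t < \<delta>\<close>, with the splitting of the gradient for \<open>s = 1\<close>,
  \<open>t = \<delta>\<close>, and with the seminorm itself for \<open>s < 1\<close>,
  \<open>t = \<delta>\<close>.\<close>

lemma unit_source_bounds:
  assumes s: "0 < s" "s \<le> 1" and t: "0 \<le> t" "t < s" and r: "1 \<le> r" "r \<le> q"
    and \<alpha>: "\<alpha> = s - real DIM('a) / r" and \<delta>: "\<delta> = \<alpha> + real DIM('a) / q"
    and c1: "s < 1 \<or> 0 < \<alpha>" and c2: "t < \<delta> \<or> (t = \<delta> \<and> 0 < \<alpha>)"
  obtains C where "0 < C" "\<And>v::'a::euclidean_space \<Rightarrow> real. unit_source s r v \<Longrightarrow>
    Lp_energy q v \<le> ennreal C \<and> (0 < t \<longrightarrow> gagliardo_energy t q v \<le> ennreal C)"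
proof -
  let ?n = "real DIM('a)"
  have q: "0 < q" "1 \<le> q" and r0: "0 < r" using r by auto
  \<comment> \<open>Absolute values make the constants nonnegative without an inspection of their
    signs.\<close>
  have le_abs: "x \<le> ennreal \<bar>K\<bar>" if "x \<le> ennreal K" for x K
    using that by (rule order_trans) (simp add: ennreal_leI)
  consider (sub) "s < 1" "t < \<delta>" | (sup) "0 < \<alpha>" "s = 1 \<or> t = \<delta>"
    using c1 c2 s by force
  then show ?thesis
  proof cases
    case sub
    obtain C0 where C0: "0 < C0" "\<And>(u::'a \<Rightarrow> real). u \<in> borel_measurable borel \<Longrightarrow>
      Lp_energy r u \<le> 1 \<Longrightarrow> gagliardo_energy s r u \<le> 1 \<Longrightarrow>
      Lp_energy q u \<le> ennreal C0 \<and> (\<forall>h. h \<noteq> 0 \<longrightarrow> translate_energy q u h \<le> ennreal (C0 * norm h powr (q * \<delta>)))"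
    proof (rule subcritical_bounds[where 'a = 'a, OF r s(1)])
      show "\<delta> = s - ?n / r + ?n / q" "0 < \<delta>" using \<alpha> \<delta> sub t by auto
    qed blast
    define C where "C = \<bar>C0 * kernel_const DIM('a) (q * (\<delta> - t)) + 2 powr (q + 1) * C0 * kernel_const DIM('a) (q * t)\<bar>"
    show ?thesis
    proof (rule that[of "C0 + C"])
      show "0 < C0 + C" using C0 by (simp add: C_def add_pos_nonneg)
      fix v :: "'a \<Rightarrow> real" assume v: "unit_source s r v"
      then have vm: "v \<in> borel_measurable borel" by (simp add: unit_source_def)
      from C0(2)[OF vm] v sub have *: "Lp_energy q v \<le> ennreal C0"
        "\<And>h. h \<noteq> 0 \<Longrightarrow> translate_energy q v h \<le> ennreal (C0 * norm h powr (q * \<delta>))"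
        by (auto simp: unit_source_def)
      have "gagliardo_energy t q v \<le> ennreal C" if "0 < t"
        unfolding C_def
        by (rule order_trans[OF gagliardo_energy_of_translates[OF vm q(1) that sub(2), of C0 C0]])
          (use C0 * in \<open>auto intro: ennreal_leI\<close>)
      then show "Lp_energy q v \<le> ennreal (C0 + C) \<and> (0 < t \<longrightarrow> gagliardo_energy t q v \<le> ennreal (C0 + C))"
        using *(1) C0(1) by (auto intro: order_trans ennreal_leI simp: C_def)
    qed
  next
    case sup
    obtain H where H: "0 < H" "\<And>v::'a \<Rightarrow> real. unit_source s r v \<Longrightarrow> holder_ae H \<alpha> v"
      using unit_source_Morrey[OF s r(1) \<alpha> sup(1)] by blast
    let ?H = "H powr (q - r)"
    have L: "Lp_energy q v \<le> ennreal ?H" if v: "unit_source s r v" for v :: "'a \<Rightarrow> real"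
    proof -
      have "Lp_energy q v \<le> ennreal ?H * Lp_energy r v"
        using H(2)[OF v] r0 r H(1) v by (intro Lp_energy_interpolate) (auto simp: unit_source_def)
      also have "\<dots> \<le> ennreal ?H * 1"
        using v by (intro mult_left_mono) (auto simp: unit_source_def)
      finally show ?thesis by simp
    qed
    have "\<exists>C\<ge>0. \<forall>v::'a \<Rightarrow> real. unit_source s r v \<longrightarrow> 0 < t \<longrightarrow> gagliardo_energy t q v \<le> ennreal C"
    proof (cases "s = 1")
      case True
      have r1: "1 < r"
      proof -
        have "1 \<le> ?n" using DIM_positive[where 'a = 'a] by linarith
        moreover have "?n < r" using sup True r0 unfolding \<alpha> by (simp add: field_simps)
        ultimately show ?thesis by linarith
      qed
      show ?thesis
      proof (cases "t < \<delta>")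
        case lt: True
        let ?A = "?H * 2 powr r"
        let ?C = "?A * kernel_const DIM('a) (q * (\<delta> - t)) + 2 powr (q + 1) * ?H * kernel_const DIM('a) (q * t)"
        have "gagliardo_energy t q v \<le> ennreal ?C" if v: "unit_source s r v" and t0: "0 < t" for v :: "'a \<Rightarrow> real"
        proof (rule gagliardo_energy_of_translates[OF _ q(1) t0 lt])
          show vm: "v \<in> borel_measurable borel" using v by (simp add: unit_source_def)
          fix h :: 'a assume h: "h \<noteq> 0"
          obtain g where g: "g \<in> borel_measurable borel" "\<And>x. 0 \<le> g x" "translate_gradient v g" "Lp_energy r g \<le> 1"
            using v True by (auto simp: unit_source_def)
          have "translate_energy q v h \<le> ennreal (?H * norm h powr (\<alpha> * (q - r))) * translate_energy r v h"
            using H v r0 r by (intro translate_energy_interpolate vm) auto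
          also have "\<dots> \<le> ennreal (?H * norm h powr (\<alpha> * (q - r))) * ennreal (2 powr r * norm h powr r)"
            by (intro mult_left_mono translate_energy_gradient[OF vm g(1,2,3) r(1) g(4)]) auto
          also have "\<dots> = ennreal (?A * (norm h powr (\<alpha> * (q - r)) * norm h powr r))"
            by (simp add: ennreal_mult[symmetric] mult_ac)
          also have "norm h powr (\<alpha> * (q - r)) * norm h powr r = norm h powr (q * \<delta>)"
          proof -
            have "\<alpha> * (q - r) + r = q * \<delta>" using r0 q by (simp add: \<alpha> \<delta> True field_simps)
            then show ?thesis by (simp only: powr_add[symmetric])
          qed
          finally show "translate_energy q v h \<le> ennreal (?A * norm h powr (q * \<delta>))" .
        qed (use L[OF v] H(1) in auto)
        then show ?thesis
          by (intro exI[of _ "\<bar>?C\<bar>"]) (simp add: le_abs)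
      next
        case False
        then have td: "t = \<alpha> + ?n / q" using c2 \<delta> by auto
        \<comment> \<open>For \<open>r = q\<close> the critical order would be
          \<open>t = \<alpha> + n / r = 1\<close>, contrary to \<open>t < s\<close>.\<close>
        have "r < q"
        proof -
          have "r \<noteq> q" using td t True \<alpha> by auto
          then show ?thesis using r by auto
        qed
        have al: "\<alpha> = 1 - ?n / r" using \<alpha> True by simp
        let ?C = "4 powr q * kernel_const DIM('a) (q * (1 - t)) + 2 * H powr (q - 1) * kernel_const DIM('a) (?n * (1 - 1 / r))"
        have "gagliardo_energy t q v \<le> ennreal ?C" if v: "unit_source s r v" for v :: "'a \<Rightarrow> real"
        proof -
          obtain g where g: "g \<in> borel_measurable borel" "\<And>x. 0 \<le> g x" "translate_gradient v g" "Lp_energy r g \<le> 1"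
            using v True by (auto simp: unit_source_def)
          have vm: "v \<in> borel_measurable borel" using v by (simp add: unit_source_def)
          show ?thesis
            by (rule gradient_critical[OF vm g H(2)[OF v] less_imp_le[OF H(1)] r1 \<open>r < q\<close> al td])
        qed
        then show ?thesis
          by (intro exI[of _ "\<bar>?C\<bar>"]) (simp add: le_abs)
      qed
    next
      case False
      then have td: "t = \<alpha> + ?n / q" using sup(2) \<delta> by auto
      have "gagliardo_energy t q v \<le> ennreal ?H" if v: "unit_source s r v" for v :: "'a \<Rightarrow> real"
      proof -
        have "gagliardo_energy t q v \<le> ennreal ?H * gagliardo_energy s r v"
          using H(2)[OF v] H(1) r0 r v \<alpha> td by (intro gagliardo_critical) (auto simp: unit_source_def)
        also have "\<dots> \<le> ennreal ?H * 1"
          using v False by (intro mult_left_mono) (auto simp: unit_source_def)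
        finally show ?thesis by simp
      qed
      then show ?thesis by (intro exI[of _ ?H]) auto
    qed
    then obtain C where C: "0 \<le> C" "\<And>v::'a \<Rightarrow> real. unit_source s r v \<Longrightarrow> 0 < t \<Longrightarrow> gagliardo_energy t q v \<le> ennreal C"
      by blast
    show ?thesis
    proof (rule that[of "C + ?H"])
      show "0 < C + ?H" using C(1) H(1) by (simp add: add_nonneg_pos)
      fix v :: "'a \<Rightarrow> real" assume v: "unit_source s r v"
      show "Lp_energy q v \<le> ennreal (C + ?H) \<and> (0 < t \<longrightarrow> gagliardo_energy t q v \<le> ennreal (C + ?H))"
        using L[OF v] C(1) C(2)[OF v] by (auto intro: order_trans ennreal_leI)
    qed
  qed
qed


section \<open>Sobolev norms and energies\<close>

text \<open>Needed for Tonelli's theorem, since the seminorm integrates over the product of two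
  copies of Lebesgue measure. The exhausting sets are inherited from \<open>lborel\<close>.\<close>

lemma sigma_finite_lebesgue: "sigma_finite_measure (lebesgue :: 'a::euclidean_space measure)"
proof
  obtain A where A: "countable A" "A \<subseteq> sets (lborel :: 'a measure)" "\<Union>A = space (lborel :: 'a measure)"
    "\<forall>a\<in>A. emeasure lborel a \<noteq> \<infinity>"
    using lborel.sigma_finite_countable by blast
  then show "\<exists>A. countable A \<and> A \<subseteq> sets (lebesgue :: 'a measure) \<and> \<Union>A = space lebesgue \<and> (\<forall>a\<in>A. emeasure lebesgue a \<noteq> \<infinity>)"
    by (intro exI[of _ A]) (auto simp: subset_iff)
qed

text \<open>The statement for real functions is applied to each coordinate. It is the passage from
  Lebesgue measurable functions to the Borel functions of all previous estimates.\<close>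

lemma ex_borel_version:
  fixes G :: "'a::euclidean_space \<Rightarrow> 'b::euclidean_space"
  assumes "G \<in> borel_measurable lebesgue"
  obtains g where "g \<in> borel_measurable borel" "AE x in lebesgue. G x = g x"
proof -
  have "\<forall>i. \<exists>g. g \<in> borel_measurable borel \<and> (AE x in lborel. G x \<bullet> i = g x)"
  proof
    fix i
    have "(\<lambda>x. G x \<bullet> i) \<in> borel_measurable lebesgue" using assms by measurable
    from completion_ex_borel_measurable_real[OF this]
    show "\<exists>g. g \<in> borel_measurable borel \<and> (AE x in lborel. G x \<bullet> i = g x)" by auto
  qed
  then obtain g where g: "\<And>i. g i \<in> borel_measurable borel" "\<And>i. AE x in lborel. G x \<bullet> i = g i x"
    by metis
  note [measurable] = g(1)
  show ?thesis
  proof (rule that[of "\<lambda>x. \<Sum>i\<in>Basis. g i x *\<^sub>R i"])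
    show "(\<lambda>x. \<Sum>i\<in>Basis. g i x *\<^sub>R i) \<in> borel_measurable borel" by measurable
    have "AE x in lborel. \<forall>i\<in>Basis. G x \<bullet> i = g i x"
      using g(2) by (intro AE_finite_allI) auto
    then have "AE x in lborel. G x = (\<Sum>i\<in>Basis. g i x *\<^sub>R i)"
    proof (rule eventually_mono)
      fix x assume "\<forall>i\<in>Basis. G x \<bullet> i = g i x"
      then have "(\<Sum>i\<in>Basis. g i x *\<^sub>R i) = (\<Sum>i\<in>Basis. (G x \<bullet> i) *\<^sub>R i)"
        by (intro sum.cong) auto
      then show "G x = (\<Sum>i\<in>Basis. g i x *\<^sub>R i)" by (simp add: euclidean_representation)
    qed
    then show "AE x in lebesgue. G x = (\<Sum>i\<in>Basis. g i x *\<^sub>R i)" by (rule AE_completion)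
  qed
qed

lemma Lp_norm_energy:
  fixes G :: "'a::euclidean_space \<Rightarrow> 'b::euclidean_space"
  assumes "AE x in lebesgue. norm (G x) = \<bar>g x\<bar>"
  shows "Lp_norm UNIV (ereal r) G = ennpow (Lp_energy r g) (1 / r)"
proof -
  have "(\<integral>\<^sup>+x. ennreal (norm (G x) powr r) \<partial>lebesgue) = (\<integral>\<^sup>+x. ennreal (\<bar>g x\<bar> powr r) \<partial>lebesgue)"
    using assms by (intro nn_integral_cong_AE) (auto elim!: eventually_mono)
  then show ?thesis
    by (simp add: Lp_norm_def Lp_energy_def lebesgue_on_UNIV_eq nn_integral_completion)
qed

text \<open>Once the product integral is iterated, \<open>u\<close> can be replaced by its Borel
  version in one variable at a time, and each integral over \<open>lebesgue\<close> becomes one over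
  \<open>lborel\<close>.\<close>

lemma gagliardo_seminorm_energy:
  fixes u u0 :: "'a::euclidean_space \<Rightarrow> real"
  assumes u [measurable]: "u \<in> borel_measurable lebesgue" and ae: "AE x in lebesgue. u x = u0 x"
  shows "gagliardo_seminorm UNIV s r u = ennpow (ennreal (gagliardo_const DIM('a) s r) * gagliardo_energy s r u0) (1 / r)"
proof -
  interpret sigma_finite_measure "lebesgue :: 'a measure" by (rule sigma_finite_lebesgue)
  \<comment> \<open>The projections are followed by the identity into the Borel sigma-algebra, so
    that \<open>x - y\<close> is measurable on the product of the Lebesgue sigma-algebras.\<close>
  have id: "(\<lambda>x. x) \<in> measurable (lebesgue :: 'a measure) borel" by (intro measurable_completion) simp
  have [measurable]: "fst \<in> measurable ((lebesgue :: 'a measure) \<Otimes>\<^sub>M (lebesgue :: 'a measure)) borel"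
    "snd \<in> measurable ((lebesgue :: 'a measure) \<Otimes>\<^sub>M (lebesgue :: 'a measure)) borel"
    by (rule measurable_compose[OF measurable_fst id], rule measurable_compose[OF measurable_snd id])
  have u1 [measurable]: "(\<lambda>z. u (fst z)) \<in> borel_measurable ((lebesgue :: 'a measure) \<Otimes>\<^sub>M (lebesgue :: 'a measure))"
    "(\<lambda>z. u (snd z)) \<in> borel_measurable ((lebesgue :: 'a measure) \<Otimes>\<^sub>M (lebesgue :: 'a measure))"
    by (rule measurable_compose[OF measurable_fst u], rule measurable_compose[OF measurable_snd u])
  let ?k = "\<lambda>x y. ennreal (\<bar>u x - u y\<bar> powr r / norm (x - y) powr (real DIM('a) + s * r))"
  have m: "case_prod ?k \<in> borel_measurable ((lebesgue :: 'a measure) \<Otimes>\<^sub>M (lebesgue :: 'a measure))"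
    unfolding split_beta' by measurable
  have "(\<integral>\<^sup>+z. case_prod ?k z \<partial>((lebesgue :: 'a measure) \<Otimes>\<^sub>M (lebesgue :: 'a measure))) = (\<integral>\<^sup>+x. (\<integral>\<^sup>+y. ?k x y \<partial>lebesgue) \<partial>lebesgue)"
    by (subst nn_integral_fst[symmetric, OF m]) simp
  also have "\<dots> = (\<integral>\<^sup>+x. (\<integral>\<^sup>+y. gagliardo_kernel s r u0 x y \<partial>lebesgue) \<partial>lebesgue)"
  proof (rule nn_integral_cong_AE, rule eventually_mono[OF ae])
    fix x assume x: "u x = u0 x"
    show "(\<integral>\<^sup>+y. ?k x y \<partial>lebesgue) = (\<integral>\<^sup>+y. gagliardo_kernel s r u0 x y \<partial>lebesgue)"
      by (rule nn_integral_cong_AE, rule eventually_mono[OF ae]) (simp add: x)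
  qed
  also have "\<dots> = gagliardo_energy s r u0"
    by (simp add: nn_integral_completion gagliardo_energy_def)
  finally show ?thesis
    by (simp add: gagliardo_seminorm_def lebesgue_on_UNIV_eq case_prod_beta')
qed

lemma borel_weak_gradient_transfer:
  fixes u u0 :: "'a::euclidean_space \<Rightarrow> real" and G g :: "'a \<Rightarrow> 'a"
  assumes wg: "has_weak_gradient UNIV u G" and u: "u \<in> borel_measurable lebesgue"
    and u0: "u0 \<in> borel_measurable borel" "AE x in lebesgue. u x = u0 x"
    and g: "g \<in> borel_measurable borel" "AE x in lebesgue. G x = g x"
  shows "borel_weak_gradient u0 g"
proof -
  have G: "G \<in> borel_measurable lebesgue"
    using wg by (simp add: has_weak_gradient_def lebesgue_on_UNIV_eq)
  have bl: "f \<in> borel_measurable lebesgue" if "f \<in> borel_measurable borel" for f :: "'a \<Rightarrow> 'b::euclidean_space"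
    using that by (intro measurable_completion) simp
  note [measurable] = u0(1) g(1)
  have loc: "set_integrable lborel (cube y r) f0"
    if "locally_integrable UNIV f" "AE x in lebesgue. f x = f0 x" "f0 \<in> borel_measurable borel"
    for y r and f f0 :: "'a \<Rightarrow> 'b::euclidean_space"
  proof -
    note [measurable] = that(3)
    have "integrable (lebesgue_on (cube y r)) f"
      using that(1) unfolding locally_integrable_def cube_def by auto
    then have i: "integrable lebesgue (\<lambda>x. indicator (cube y r) x *\<^sub>R f x)"
      by (subst (asm) integrable_restrict_space) (auto simp: cube_def)
    have "(\<lambda>x. indicator (cube y r) x *\<^sub>R f0 x) \<in> borel_measurable lborel" by measurable
    then have "(\<lambda>x. indicator (cube y r) x *\<^sub>R f0 x) \<in> borel_measurable lebesgue" by (rule measurable_completion)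
    then have "integrable lebesgue (\<lambda>x. indicator (cube y r) x *\<^sub>R f0 x)"
      using i that(2) by (subst integrable_cong_AE[where g = "\<lambda>x. indicator (cube y r) x *\<^sub>R f x"])
        (auto elim: eventually_mono)
    then show ?thesis
      unfolding set_integrable_def by (subst (asm) integrable_completion) simp_all
  qed
  have norm_g: "set_integrable lborel (cube y r) (\<lambda>x. norm (g x))" for y r
  proof -
    have "set_integrable lborel (cube y r) g"
      using wg g by (intro loc[of G]) (auto simp: has_weak_gradient_def)
    from set_integrable_norm[OF this] show ?thesis .
  qed
  have "(LINT x|lborel. u0 x * frechet_derivative \<phi> (at x) i) = - (LINT x|lborel. (g x \<bullet> i) * \<phi> x)"
    if \<phi>: "\<phi> \<in> test_functions UNIV" and i: "i \<in> Basis" for \<phi> i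
  proof -
    note pm [measurable] = bump_borel[OF test_function_bump[OF \<phi>]] bump_borel[OF test_function_deriv_bump[OF \<phi>, of i]]
    note [measurable] = u G bl[OF pm(1)] bl[OF pm(2)] bl[OF u0(1)] bl[OF g(1)]
    have "(LINT x|lborel. u0 x * frechet_derivative \<phi> (at x) i) = (LINT x|lebesgue. u0 x * frechet_derivative \<phi> (at x) i)"
      by (rule integral_completion[symmetric]) simp
    also have "\<dots> = (LINT x|lebesgue. u x * frechet_derivative \<phi> (at x) i)"
      using u0(2) by (intro integral_cong_AE) (auto elim: eventually_mono)
    also have "\<dots> = - (LINT x|lebesgue. (G x \<bullet> i) * \<phi> x)"
      using wg \<phi> i by (simp add: has_weak_gradient_def lebesgue_on_UNIV_eq)
    also have "(LINT x|lebesgue. (G x \<bullet> i) * \<phi> x) = (LINT x|lebesgue. (g x \<bullet> i) * \<phi> x)"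
      using g(2) by (intro integral_cong_AE) (auto elim: eventually_mono)
    also have "\<dots> = (LINT x|lborel. (g x \<bullet> i) * \<phi> x)"
      by (rule integral_completion) simp
    finally show ?thesis .
  qed
  then show ?thesis
    using loc[of u u0] norm_g wg u0 g unfolding borel_weak_gradient_def loc_int_def has_weak_gradient_def by auto
qed

text \<open>The argument of the Gamma function in the numerator is positive since
  \<open>p * s > 0\<close>, \<open>p \<ge> 1\<close> and \<open>n \<ge> 1\<close>. Positivity is
  what lets the source norm control the energy.\<close>

lemma gagliardo_const_pos:
  assumes "0 < s" "s < 1" "1 \<le> p" "1 \<le> n"
  shows "0 < gagliardo_const n s p"
proof -
  have "0 < p * s" using assms by simp
  moreover have "1 \<le> real n" using assms by simp
  ultimately have "2 < p * s + p + real n" using assms(3) by linarith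
  then have "0 < (p * s + p + real n - 2) / 2" by simp
  then show ?thesis
    using assms unfolding gagliardo_const_def
    by (intro divide_pos_pos mult_pos_pos Gamma_real_pos) auto
qed

lemma ennpow_inverse_le:
  assumes "ennpow x (1 / r) \<le> ennreal \<kappa>" "0 < r" "0 \<le> \<kappa>"
  shows "x \<le> ennreal (\<kappa> powr r)"
proof -
  have "ennpow (ennpow x (1 / r)) r \<le> ennpow (ennreal \<kappa>) r"
    using assms by (intro ennpow_mono) auto
  then show ?thesis using assms by (simp add: ennpow_ennpow ennpow_ennreal)
qed

section \<open>Normalisation of the source\<close>

text \<open>The number \<open>\<kappa>\<close> is any positive bound for the norm rather than the
  norm itself, which may be 0. The factor \<open>a\<close> is independent of \<open>u\<close> and
  compensates the constant in the seminorm.\<close>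

lemma unit_source_normalise:
  assumes s: "0 < s" "s \<le> 1" and r: "1 \<le> r"
  obtains a where "0 < a" "\<And>(u::'a::euclidean_space \<Rightarrow> real) \<kappa>. u \<in> sobolev_space UNIV s (ereal r) \<Longrightarrow> 0 < \<kappa> \<Longrightarrow>
    sobolev_norm UNIV s (ereal r) u \<le> ennreal \<kappa> \<Longrightarrow>
    \<exists>v. unit_source s r v \<and> (AE x in lebesgue. u x = a * \<kappa> * v x)"
proof -
  define c where "c = gagliardo_const DIM('a) s r"
  have c: "0 < c" if "s \<noteq> 1"
    unfolding c_def using s r that DIM_positive[where 'a = 'a] by (intro gagliardo_const_pos) auto
  \<comment> \<open>For fractional order the energy is the \<open>r\<close>-th power of the seminorm
    divided by \<open>c\<close>, so after division of \<open>u\<close> by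
    \<open>a * \<kappa>\<close> it is at most \<open>1 / (c * a powr r)\<close>; the second entry of
    the maximum makes this at most 1.\<close>
  define a where "a = (if s = 1 then 1 else max 1 (c powr (- (1 / r))))"
  have a: "1 \<le> a" by (auto simp: a_def)
  have r0: "0 < r" using r by simp
  show ?thesis
  proof (rule that[of a])
    fix u :: "'a \<Rightarrow> real" and \<kappa> :: real
    assume u: "u \<in> sobolev_space UNIV s (ereal r)" and \<kappa>: "0 < \<kappa>" and K: "sobolev_norm UNIV s (ereal r) u \<le> ennreal \<kappa>"
    let ?S = "sobolev_seminorm UNIV s (ereal r) u" and ?L = "Lp_norm UNIV (ereal r) u"
    have um: "u \<in> borel_measurable lebesgue"
      using u by (simp add: sobolev_space_def Lp_space_def lebesgue_on_UNIV_eq)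
    obtain u0 where u0 [measurable]: "u0 \<in> borel_measurable borel" and ae: "AE x in lebesgue. u x = u0 x"
      using ex_borel_version[OF um] by blast
    define d where "d = 1 / (a * \<kappa>)"
    have d: "0 < d" "a * \<kappa> * d = 1" using a \<kappa> by (auto simp: d_def)
    have dk: "d * \<kappa> = 1 / a" using a \<kappa> by (simp add: d_def)
    have dr: "d powr r * \<kappa> powr r = (1 / a) powr r"
      using d \<kappa> by (simp flip: powr_mult dk)
    have ar: "(1 / a) powr r \<le> 1" using a r by (intro powr_le1) auto
    define v where "v x = d * u0 x" for x
    have [measurable]: "v \<in> borel_measurable borel" unfolding v_def by measurable
    have sum: "ennpow (ennpow ?S r + ennpow ?L r) (1 / r) \<le> ennreal \<kappa>"
      using K s by (simp add: sobolev_norm_def)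
    have S: "?S \<le> ennreal \<kappa>"
    proof -
      have "?S = ennpow (ennpow ?S r) (1 / r)" using r by (simp add: ennpow_ennpow)
      also have "\<dots> \<le> ennpow (ennpow ?S r + ennpow ?L r) (1 / r)" using r by (intro ennpow_mono) auto
      finally show ?thesis using sum by (rule order_trans)
    qed
    have L: "?L \<le> ennreal \<kappa>"
    proof -
      have "?L = ennpow (ennpow ?L r) (1 / r)" using r by (simp add: ennpow_ennpow)
      also have "\<dots> \<le> ennpow (ennpow ?S r + ennpow ?L r) (1 / r)" using r by (intro ennpow_mono) auto
      finally show ?thesis using sum by (rule order_trans)
    qed
    have scale: "Lp_energy r (\<lambda>x. d * f x) \<le> 1" if "Lp_energy r f \<le> ennreal (\<kappa> powr r)" "f \<in> borel_measurable borel" for f :: "'a \<Rightarrow> real"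
    proof -
      have "Lp_energy r (\<lambda>x. d * f x) \<le> ennreal (d powr r) * ennreal (\<kappa> powr r)"
        using that d by (subst Lp_energy_cmult) (auto intro: mult_left_mono)
      also have "\<dots> = ennreal ((1 / a) powr r)" by (simp add: ennreal_mult[symmetric] dr)
      also have "\<dots> \<le> ennreal 1" by (rule ennreal_leI[OF ar])
      finally show ?thesis by simp
    qed
    have Lv: "Lp_energy r v \<le> 1"
    proof -
      have "?L = ennpow (Lp_energy r u0) (1 / r)"
        using ae by (intro Lp_norm_energy) (auto elim: eventually_mono)
      with L have "Lp_energy r u0 \<le> ennreal (\<kappa> powr r)"
        using r0 \<kappa> by (intro ennpow_inverse_le) auto
      then show ?thesis unfolding v_def by (rule scale) measurable
    qed
    have "if s = 1 then \<exists>g. g \<in> borel_measurable borel \<and> (\<forall>x. 0 \<le> g x) \<and> translate_gradient v g \<and> Lp_energy r g \<le> 1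
      else gagliardo_energy s r v \<le> 1"
    proof (cases "s = 1")
      case True
      have ex: "\<exists>G. has_weak_gradient UNIV u G"
        using S True by (auto simp: sobolev_seminorm_def top_unique split: if_splits)
      let ?G = "weak_gradient UNIV u"
      have wg: "has_weak_gradient UNIV u ?G"
        unfolding weak_gradient_def using ex by (rule someI_ex)
      then have "?G \<in> borel_measurable lebesgue"
        by (simp add: has_weak_gradient_def lebesgue_on_UNIV_eq)
      then obtain g where g [measurable]: "g \<in> borel_measurable borel" and ag: "AE x in lebesgue. ?G x = g x"
        using ex_borel_version by blast
      have tg: "translate_gradient u0 (\<lambda>x. norm (g x))"
        by (intro weak_gradient_translate borel_weak_gradient_transfer[OF wg um u0 ae g ag])
      have "?S = Lp_norm UNIV (ereal r) ?G"
        using ex True by (simp add: sobolev_seminorm_def)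
      also have "\<dots> = ennpow (Lp_energy r (\<lambda>x. norm (g x))) (1 / r)"
        using ag by (intro Lp_norm_energy) (auto elim: eventually_mono)
      finally have "Lp_energy r (\<lambda>x. norm (g x)) \<le> ennreal (\<kappa> powr r)"
        using r0 \<kappa> S by (intro ennpow_inverse_le) auto
      then have "Lp_energy r (\<lambda>x. d * norm (g x)) \<le> 1" by (rule scale) measurable
      moreover have "translate_gradient v (\<lambda>x. d * norm (g x))"
        unfolding v_def using tg d by (intro translate_gradient_cmult) auto
      ultimately show ?thesis
        using True d by (simp, intro exI[of _ "\<lambda>x. d * norm (g x)"]) auto
    next
      case False
      let ?E = "gagliardo_energy s r u0"
      have "?S = ennpow (ennreal c * ?E) (1 / r)"
        using False s by (simp add: sobolev_seminorm_def gagliardo_seminorm_energy[OF um ae] c_def)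
      with S have "ennreal c * ?E \<le> ennreal (\<kappa> powr r)"
        using r0 \<kappa> by (intro ennpow_inverse_le) auto
      then have "ennreal (d powr r / c) * (ennreal c * ?E) \<le> ennreal (d powr r / c) * ennreal (\<kappa> powr r)"
        by (rule mult_left_mono) simp
      also have "ennreal (d powr r / c) * (ennreal c * ?E) = ennreal (d powr r) * ?E"
        using c[OF False] by (simp add: mult.assoc[symmetric] ennreal_mult[symmetric])
      also have "\<dots> = gagliardo_energy s r v"
        unfolding v_def using d by (intro gagliardo_energy_cmult[symmetric]) auto
      also have "ennreal (d powr r / c) * ennreal (\<kappa> powr r) = ennreal ((1 / a) powr r / c)"
        using c[OF False] by (simp add: ennreal_mult[symmetric] dr)
      also have "(1 / a) powr r / c \<le> 1"
      proof -
        have "c powr (- (1 / r)) \<le> a" using False by (simp add: a_def)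
        then have "(c powr (- (1 / r))) powr r \<le> a powr r"
          using r c[OF False] by (intro powr_mono2) auto
        moreover have "- (1 / r) * r = - 1" using r0 by simp
        ultimately have "1 / c \<le> a powr r"
          unfolding powr_powr using c[OF False] by (simp add: powr_minus divide_inverse)
        then show ?thesis
          using a c[OF False] by (simp add: powr_divide field_simps)
      qed
      finally have "gagliardo_energy s r v \<le> 1" by (simp add: ennreal_leI)
      then show ?thesis using False by simp
    qed
    moreover have "AE x in lebesgue. u x = a * \<kappa> * v x"
      using ae by (rule eventually_mono) (simp add: v_def mult.assoc[symmetric] d)
    ultimately show "\<exists>v. unit_source s r v \<and> (AE x in lebesgue. u x = a * \<kappa> * v x)"
      using Lv unfolding unit_source_def by (intro exI[of _ v]) auto
  qed (use a in auto)
qed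

section \<open>Norms in the target space\<close>

text \<open>Homogeneity takes \<open>c\<close> out of the root. The summand 1 next to the
  normalising constant accounts for the Lebesgue part of the norm, and for the whole norm when
  \<open>t = 0\<close>.\<close>

lemma sobolev_target:
  fixes u v :: "'a::euclidean_space \<Rightarrow> real"
  assumes um: "u \<in> borel_measurable lebesgue" and ae: "AE x in lebesgue. u x = c * v x" and c: "0 < c"
    and v [measurable]: "v \<in> borel_measurable borel" and t: "0 \<le> t" "t < 1" and q: "1 \<le> q" and C: "0 \<le> C"
    and L: "Lp_energy q v \<le> ennreal C" and E: "0 < t \<Longrightarrow> gagliardo_energy t q v \<le> ennreal C"
  shows "u \<in> sobolev_space UNIV t (ereal q)"
    and "sobolev_norm UNIV t (ereal q) u \<le> ennreal (((\<bar>gagliardo_const DIM('a) t q\<bar> + 1) * C) powr (1 / q) * c)"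
proof -
  let ?cv = "\<lambda>x. c * v x" and ?g = "\<bar>gagliardo_const DIM('a) t q\<bar>"
  have q0: "0 < q" using q by simp
  have "Lp_norm UNIV (ereal q) u = ennpow (Lp_energy q ?cv) (1 / q)"
    using ae by (intro Lp_norm_energy) (auto elim: eventually_mono)
  moreover have Lc: "Lp_energy q ?cv \<le> ennreal (c powr q * C)"
    using L c C by (subst Lp_energy_cmult) (auto simp: ennreal_mult intro: mult_left_mono)
  ultimately have Lq: "ennpow (Lp_norm UNIV (ereal q) u) q \<le> ennreal (c powr q * C)"
    using q0 by (simp add: ennpow_ennpow)
  then have Lfin: "Lp_norm UNIV (ereal q) u < \<infinity>"
    by (metis ennpow_less_top ennreal_less_top infinity_ennreal_def le_less_trans)
  have Sq: "ennpow (sobolev_seminorm UNIV t (ereal q) u) q \<le> ennreal (?g * (c powr q * C))" if t0: "0 < t"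
  proof -
    have "sobolev_seminorm UNIV t (ereal q) u = ennpow (ennreal (gagliardo_const DIM('a) t q) * gagliardo_energy t q ?cv) (1 / q)"
      using t t0 by (simp add: sobolev_seminorm_def gagliardo_seminorm_energy[OF um ae])
    then have "ennpow (sobolev_seminorm UNIV t (ereal q) u) q = ennreal (gagliardo_const DIM('a) t q) * gagliardo_energy t q ?cv"
      using q0 by (simp add: ennpow_ennpow)
    also have "\<dots> \<le> ennreal ?g * (ennreal (c powr q) * ennreal C)"
      using E[OF t0] c by (intro mult_mono) (auto simp: gagliardo_energy_cmult intro!: ennreal_leI mult_left_mono)
    finally show ?thesis using C by (simp add: ennreal_mult)
  qed
  have Sfin: "sobolev_seminorm UNIV t (ereal q) u < \<infinity>"
  proof (cases "t = 0")
    case False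
    with Sq t show ?thesis
      by (metis ennpow_less_top ennreal_less_top infinity_ennreal_def le_less_trans less_le)
  qed (use Lfin in \<open>simp add: sobolev_seminorm_def\<close>)
  show "u \<in> sobolev_space UNIV t (ereal q)"
    using um Lfin Sfin by (simp add: sobolev_space_def Lp_space_def lebesgue_on_UNIV_eq)
  have bound: "ennpow x (1 / q) \<le> ennreal (((?g + 1) * C) powr (1 / q) * c)" if "x \<le> ennreal ((?g + 1) * (c powr q * C))" for x
  proof -
    have "ennpow x (1 / q) \<le> ennpow (ennreal ((?g + 1) * (c powr q * C))) (1 / q)"
      using that q0 by (intro ennpow_mono) auto
    also have "\<dots> = ennreal (((?g + 1) * (c powr q * C)) powr (1 / q))"
      using C by (intro ennpow_ennreal) auto
    also have "((?g + 1) * (c powr q * C)) powr (1 / q) = (((?g + 1) * C) * c powr q) powr (1 / q)"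
      by (simp add: mult_ac)
    also have "\<dots> = ((?g + 1) * C) powr (1 / q) * c"
      using C c q0 by (subst powr_mult) (auto simp: powr_powr)
    finally show ?thesis .
  qed
  show "sobolev_norm UNIV t (ereal q) u \<le> ennreal (((?g + 1) * C) powr (1 / q) * c)"
  proof (cases "t = 0")
    case True
    have "Lp_norm UNIV (ereal q) u = ennpow (ennpow (Lp_norm UNIV (ereal q) u) q) (1 / q)"
      using q0 by (simp add: ennpow_ennpow)
    also have "\<dots> \<le> ennreal (((?g + 1) * C) powr (1 / q) * c)"
    proof (rule bound)
      have "c powr q * C \<le> (?g + 1) * (c powr q * C)"
        using C by (simp add: algebra_simps)
      with Lq show "ennpow (Lp_norm UNIV (ereal q) u) q \<le> ennreal ((?g + 1) * (c powr q * C))"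
        by (meson ennreal_leI order_trans)
    qed
    finally show ?thesis using True by (simp add: sobolev_norm_def)
  next
    case False
    have "ennpow (sobolev_seminorm UNIV t (ereal q) u) q + ennpow (Lp_norm UNIV (ereal q) u) q
        \<le> ennreal (?g * (c powr q * C)) + ennreal (c powr q * C)"
      using False t by (intro add_mono Sq Lq) auto
    also have "\<dots> = ennreal ((?g + 1) * (c powr q * C))"
      using C by (simp add: ennreal_plus[symmetric] distrib_right del: ennreal_plus)
    finally show ?thesis using False bound by (simp add: sobolev_norm_def)
  qed
qed


section \<open>Continuous representatives and infinite exponents\<close>

lemma AE_lebesgue_negligible:
  fixes P :: "'a::euclidean_space \<Rightarrow> bool"
  assumes "AE x in lebesgue. P x"
  shows "negligible {x. \<not> P x}"
proof -
  obtain N where "N \<in> null_sets (lebesgue :: 'a measure)" "{x. \<not> P x} \<subseteq> N"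
    using assms by (auto simp: eventually_ae_filter)
  then show ?thesis by (meson negligible_iff_null_sets negligible_subset)
qed

lemma open_negligible_empty:
  fixes S :: "'a::euclidean_space set"
  assumes "open S" "negligible S"
  shows "S = {}"
proof (rule ccontr)
  assume "S \<noteq> {}"
  then obtain x e where "0 < e" "ball x e \<subseteq> S"
    using assms(1) open_contains_ball by blast
  then have "negligible (ball x e)" using assms(2) negligible_subset by blast
  then have "emeasure lebesgue (ball x e) = 0"
    by (simp add: negligible_iff_null_sets null_sets_def)
  then show False
    using \<open>0 < e\<close> less_imp_neq[OF unit_ball_vol_DIM_pos[where 'a = 'a]] by (simp add: emeasure_lborel_ball)
qed

text \<open>Off the null set \<open>v\<close> is uniformly continuous, and the complement of a null
  set is dense, so \<open>v\<close> extends; both inequalities are closed conditions and pass to the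
  closure.\<close>

lemma holder_ae_extend:
  fixes v :: "'a::euclidean_space \<Rightarrow> real"
  assumes v: "holder_ae H \<alpha> v" and H: "0 \<le> H" and \<alpha>: "0 < \<alpha>"
  obtains w where "continuous_on UNIV w" "AE x in lebesgue. v x = w x"
    "\<And>x y. \<bar>w x - w y\<bar> \<le> H * dist x y powr \<alpha>" "\<And>x. \<bar>w x\<bar> \<le> H"
proof -
  obtain N where N: "negligible N" "\<And>x y. x \<notin> N \<Longrightarrow> y \<notin> N \<Longrightarrow> \<bar>v x - v y\<bar> \<le> H * dist x y powr \<alpha>"
    "\<And>x. x \<notin> N \<Longrightarrow> \<bar>v x\<bar> \<le> H"
    using v unfolding holder_ae_def by blast
  have "interior N = {}"
    using N(1) negligible_subset[OF _ interior_subset] by (intro open_negligible_empty) auto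
  then have dense: "closure (- N) = UNIV"
    by (simp add: closure_complement)
  have "uniformly_continuous_on (- N) v"
    unfolding uniformly_continuous_on_def
  proof (intro allI impI)
    fix e :: real assume e: "0 < e"
    \<comment> \<open>\<open>H + 1\<close> instead of \<open>H\<close> avoids division by 0 and
      makes \<open>H * d powr \<alpha>\<close> strictly smaller than \<open>e\<close>.\<close>
    define d where "d = (e / (H + 1)) powr (1 / \<alpha>)"
    have d: "0 < d" "d powr \<alpha> = e / (H + 1)"
      using e H \<alpha> by (auto simp: d_def powr_powr)
    show "\<exists>d>0. \<forall>x\<in>- N. \<forall>x'\<in>- N. dist x' x < d \<longrightarrow> dist (v x') (v x) < e"
    proof (intro exI[of _ d] conjI ballI impI d(1))
      fix x x' assume x: "x \<in> - N" "x' \<in> - N" "dist x' x < d"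
      have "dist (v x') (v x) \<le> H * dist x' x powr \<alpha>"
        using N(2)[of x' x] x by (simp add: dist_real_def)
      also have "\<dots> \<le> H * d powr \<alpha>"
        using x H \<alpha> by (intro mult_left_mono powr_mono2) auto
      also have "\<dots> < e"
        unfolding d(2) using e H by (simp add: pos_divide_less_eq distrib_left mult.commute)
      finally show "dist (v x') (v x) < e" .
    qed
  qed
  then obtain w where w: "uniformly_continuous_on UNIV w" "\<And>x. x \<in> - N \<Longrightarrow> v x = w x"
    using uniformly_continuous_on_extension_on_closure[of "- N" v] dense by metis
  have cw: "continuous_on UNIV w" by (rule uniformly_continuous_imp_continuous[OF w(1)])
  have "\<bar>w x - w y\<bar> - H * dist x y powr \<alpha> \<le> 0" for x y
  proof -
    let ?f = "\<lambda>(x, y). \<bar>w x - w y\<bar> - H * dist x y powr \<alpha>"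
    have "continuous_on UNIV ?f"
      unfolding split_beta' using \<alpha>
      by (intro continuous_intros continuous_on_powr' continuous_on_compose2[OF cw]) auto
    moreover have "closure ((- N) \<times> (- N)) = UNIV" by (simp add: closure_Times dense)
    moreover have "?f z \<le> 0" if "z \<in> (- N) \<times> (- N)" for z
      using that N(2) w(2) by auto
    ultimately have "?f (x, y) \<le> 0"
      using continuous_le_on_closure[of "(- N) \<times> (- N)" ?f "(x, y)" 0] by simp
    then show ?thesis by simp
  qed
  moreover have "\<bar>w x\<bar> \<le> H" for x
  proof -
    have "continuous_on UNIV (\<lambda>x. \<bar>w x\<bar>)" by (intro continuous_intros cw)
    then show ?thesis
      using continuous_le_on_closure[of "- N" "\<lambda>x. \<bar>w x\<bar>" x H] dense N(3) w(2) by simp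
  qed
  moreover have "AE x in lebesgue. v x = w x"
    using AE_completion[OF AE_not_negligible[OF N(1)]] by (rule eventually_mono) (use w(2) in auto)
  ultimately show ?thesis using that cw by (metis diff_le_0_iff_le)
qed

text \<open>Two continuous representatives differ on an open null set. The choice operator in the
  definition is thereby pinned down.\<close>

lemma continuous_rep_unique:
  fixes u :: "'a::euclidean_space \<Rightarrow> real"
  assumes "is_continuous_rep UNIV u w"
  shows "continuous_rep UNIV u = w"
proof -
  let ?w = "continuous_rep UNIV u"
  have r: "is_continuous_rep UNIV u ?w"
    using someI[of "is_continuous_rep UNIV u" w] assms by (simp add: continuous_rep_def)
  have "AE x in lebesgue. ?w x = w x"
    using r assms unfolding is_continuous_rep_def lebesgue_on_UNIV_eq by (auto elim: eventually_elim2)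
  then have "negligible {x. ?w x \<noteq> w x}" by (rule AE_lebesgue_negligible)
  moreover have "open {x. ?w x \<noteq> w x}"
    using r assms unfolding is_continuous_rep_def by (intro open_Collect_neq) auto
  ultimately show ?thesis using open_negligible_empty by blast
qed

text \<open>\<open>3 * H\<close> is \<open>H\<close> for the supremum plus \<open>2 * H\<close> for
  the quotient. At distances at most 1 the order can be lowered from \<open>\<alpha>\<close> to
  \<open>t\<close>; at larger distances the difference is at most twice the supremum.\<close>

lemma sobolev_target_infinity:
  fixes u v :: "'a::euclidean_space \<Rightarrow> real"
  assumes um: "u \<in> borel_measurable lebesgue" and ae: "AE x in lebesgue. u x = c * v x" and c: "0 < c"
    and v: "holder_ae H \<alpha> v" "0 \<le> H" and t: "0 < \<alpha>" "0 \<le> t" "t \<le> \<alpha>"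
  shows "u \<in> sobolev_space UNIV t \<infinity> \<and> sobolev_norm UNIV t \<infinity> u \<le> ennreal (3 * H * c)"
proof -
  obtain w where w: "continuous_on UNIV w" "AE x in lebesgue. v x = w x"
    "\<And>x y. \<bar>w x - w y\<bar> \<le> H * dist x y powr \<alpha>" "\<And>x. \<bar>w x\<bar> \<le> H"
    using holder_ae_extend[OF v t(1)] by blast
  let ?W = "\<lambda>x. c * w x"
  have aeW: "AE x in lebesgue. u x = ?W x"
    using ae w(2) by eventually_elim simp
  then have rep: "is_continuous_rep UNIV u ?W"
    unfolding is_continuous_rep_def lebesgue_on_UNIV_eq
    by (auto intro!: continuous_intros w(1) elim: eventually_mono)
  have Wb: "\<bar>?W x\<bar> \<le> c * H" for x
    using w(4)[of x] c by (simp add: abs_mult)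
  have um': "(\<lambda>x. ennreal (norm (u x))) \<in> borel_measurable lebesgue"
    using um by measurable
  have L: "Lp_norm UNIV \<infinity> u \<le> ennreal (c * H)"
    unfolding Lp_norm_def lebesgue_on_UNIV_eq if_P[OF refl]
    by (intro esssup_I um') (use aeW Wb in \<open>auto elim!: eventually_mono intro!: ennreal_leI\<close>)
  have "holder_seminorm UNIV t ?W \<le> ennreal (2 * (c * H))"
    unfolding holder_seminorm_def
  proof (rule SUP_least)
    fix z :: "'a \<times> 'a" assume "z \<in> {(x, y). x \<in> UNIV \<and> y \<in> UNIV \<and> x \<noteq> y}"
    then obtain x y where z: "z = (x, y)" "x \<noteq> y" by auto
    define d where "d = norm (x - y)"
    have d: "0 < d" using z by (simp add: d_def)
    have "\<bar>?W x - ?W y\<bar> \<le> 2 * (c * H) * d powr t"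
    proof (cases "d \<le> 1")
      case True
      have "\<bar>?W x - ?W y\<bar> = c * \<bar>w x - w y\<bar>"
        using c by (simp add: abs_mult flip: right_diff_distrib)
      also have "\<dots> \<le> c * (H * d powr \<alpha>)"
        using w(3)[of x y] c by (simp add: d_def dist_norm)
      also have "\<dots> \<le> c * (H * d powr t)"
        using c v(2) d t True by (intro mult_left_mono powr_mono') auto
      also have "\<dots> \<le> 2 * (c * H) * d powr t"
        using c v(2) by (simp add: mult.assoc)
      finally show ?thesis .
    next
      case False
      have "\<bar>?W x - ?W y\<bar> \<le> 2 * (c * H)" using Wb[of x] Wb[of y] by linarith
      also have "\<dots> \<le> 2 * (c * H) * d powr t"
        using mult_left_mono[of 1 "d powr t" "2 * (c * H)"] c v(2) False t by (simp add: ge_one_powr_ge_zero)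
      finally show ?thesis .
    qed
    then have "\<bar>?W x - ?W y\<bar> / d powr t \<le> 2 * (c * H)"
      using d by (simp add: pos_divide_le_eq)
    then show "(case z of (x, y) \<Rightarrow> ennreal (\<bar>?W x - ?W y\<bar> / norm (x - y) powr t)) \<le> ennreal (2 * (c * H))"
      by (simp add: z d_def ennreal_leI)
  qed
  then have S: "sobolev_seminorm UNIV t \<infinity> u \<le> ennreal (2 * (c * H))" if "t \<noteq> 0"
    using rep that by (auto simp: sobolev_seminorm_def continuous_rep_unique[OF rep])
  have "sobolev_seminorm UNIV t \<infinity> u < \<infinity>"
  proof (cases "t = 0")
    case True
    then show ?thesis using L by (auto simp: sobolev_seminorm_def intro: le_less_trans)
  next
    case False
    then show ?thesis using le_less_trans[OF S] by simp
  qed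
  then have "u \<in> sobolev_space UNIV t \<infinity>"
    using um L by (auto simp: sobolev_space_def Lp_space_def lebesgue_on_UNIV_eq intro: le_less_trans)
  moreover have "sobolev_norm UNIV t \<infinity> u \<le> ennreal (3 * H * c)"
  proof (cases "t = 0")
    case True
    have "Lp_norm UNIV \<infinity> u \<le> ennreal (3 * H * c)"
      using c v(2) by (intro order_trans[OF L] ennreal_leI) simp
    then show ?thesis using True by (simp add: sobolev_norm_def)
  next
    case False
    have "Lp_norm UNIV \<infinity> u + sobolev_seminorm UNIV t \<infinity> u \<le> ennreal (c * H) + ennreal (2 * (c * H))"
      using S False by (intro add_mono L) auto
    also have "\<dots> = ennreal (3 * H * c)"
      using c v(2) by (simp add: ennreal_plus[symmetric] del: ennreal_plus)
    finally show ?thesis using False by (simp add: sobolev_norm_def)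
  qed
  ultimately show ?thesis ..
qed

text \<open>The Hoelder bound of the representative holds everywhere, and the null set in
  \<open>holder_ae\<close> absorbs the essential supremum. The case \<open>p = \<infinity>\<close>
  then only amounts to lowering the order of a Hoelder function.\<close>

lemma holder_source:
  fixes u :: "'a::euclidean_space \<Rightarrow> real"
  assumes u: "u \<in> sobolev_space UNIV s \<infinity>" and s: "0 < s" and \<kappa>: "0 < \<kappa>" and K: "sobolev_norm UNIV s \<infinity> u \<le> ennreal \<kappa>"
  obtains v where "holder_ae 1 s v" "AE x in lebesgue. u x = \<kappa> * v x"
proof -
  let ?L = "Lp_norm UNIV \<infinity> u" and ?S = "sobolev_seminorm UNIV s \<infinity> u"
  let ?w = "continuous_rep UNIV u"
  have LS: "?L \<le> ennreal \<kappa>" "?S \<le> ennreal \<kappa>"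
    using K s by (auto simp: sobolev_norm_def intro: order_trans[rotated])
  then have ex: "\<exists>v. is_continuous_rep UNIV u v"
    using s by (auto simp: sobolev_seminorm_def top_unique split: if_splits)
  then have rep: "is_continuous_rep UNIV u ?w"
    unfolding continuous_rep_def by (rule someI_ex)
  then have aew: "AE x in lebesgue. ?w x = u x"
    unfolding is_continuous_rep_def lebesgue_on_UNIV_eq by (rule conjunct2)
  have hol: "\<bar>?w x - ?w y\<bar> \<le> \<kappa> * dist x y powr s" for x y
  proof (cases "x = y")
    case False
    have "ennreal (\<bar>?w x - ?w y\<bar> / norm (x - y) powr s) \<le> holder_seminorm UNIV s ?w"
      unfolding holder_seminorm_def using False by (intro SUP_upper2[of "(x, y)"]) auto
    also have "\<dots> \<le> ennreal \<kappa>"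
      using LS(2) ex s by (simp add: sobolev_seminorm_def)
    finally have "\<bar>?w x - ?w y\<bar> / norm (x - y) powr s \<le> \<kappa>"
      using \<kappa> by simp
    then show ?thesis using False by (simp add: dist_norm divide_le_eq)
  qed simp
  have "AE x in lebesgue. ennreal (norm (u x)) \<le> ?L"
    using esssup_AE[of "\<lambda>x. ennreal (norm (u x))" lebesgue] by (simp add: Lp_norm_def lebesgue_on_UNIV_eq)
  with aew have "AE x in lebesgue. \<bar>?w x\<bar> \<le> \<kappa>"
  proof eventually_elim
    case (elim x)
    then have "ennreal \<bar>?w x\<bar> \<le> ennreal \<kappa>" using LS(1) by (auto intro: order_trans)
    then show ?case using \<kappa> by simp
  qed
  then have N: "negligible {x. \<not> \<bar>?w x\<bar> \<le> \<kappa>}" by (rule AE_lebesgue_negligible)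
  let ?v = "\<lambda>x. ?w x / \<kappa>"
  have diff: "\<bar>?v x - ?v y\<bar> = \<bar>?w x - ?w y\<bar> / \<kappa>" for x y
    using \<kappa> by (simp add: abs_divide flip: diff_divide_distrib)
  have "holder_ae 1 s ?v"
    unfolding holder_ae_def diff using N hol \<kappa>
    by (intro exI[of _ "{x. \<not> \<bar>?w x\<bar> \<le> \<kappa>}"]) (auto simp: abs_divide divide_le_eq mult.commute)
  moreover have "AE x in lebesgue. u x = \<kappa> * ?v x"
    using aew by (rule eventually_mono) (use \<kappa> in simp)
  ultimately show ?thesis by (rule that)
qed

section \<open>Embeddings\<close>

lemma sobolev_norm_finite:
  assumes "u \<in> sobolev_space \<Omega> s p"
  shows "sobolev_norm \<Omega> s p u < \<infinity>"
  using assms by (auto simp: sobolev_norm_def sobolev_space_def Lp_space_def)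

text \<open>The estimate is available for positive \<open>\<kappa>\<close> only. If
  \<open>K = 0\<close>, the values \<open>\<kappa> = e / B\<close> show that \<open>X\<close> is
  0.\<close>

lemma ennreal_homogeneous_bound:
  fixes K X :: ennreal
  assumes B: "0 < B" and K: "K < \<infinity>" and le: "\<And>\<kappa>. 0 < \<kappa> \<Longrightarrow> K \<le> ennreal \<kappa> \<Longrightarrow> X \<le> ennreal (B * \<kappa>)"
  shows "X \<le> ennreal B * K"
proof -
  obtain k where k: "K = ennreal k" "0 \<le> k" using K by (cases K) auto
  show ?thesis
  proof (cases "k = 0")
    case True
    have "X \<le> 0"
    proof (rule ennreal_le_epsilon)
      fix e :: real assume "0 < e"
      with le[of "e / B"] B k True show "X \<le> 0 + ennreal e" by simp
    qed
    then show ?thesis using k True by simp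
  next
    case False
    with le[of k] k B show ?thesis by (simp add: ennreal_mult)
  qed
qed

lemma sobolev_embeddedI:
  fixes \<Omega> :: "'a::euclidean_space set"
  assumes B: "0 < B" and le: "\<And>u \<kappa>. u \<in> sobolev_space \<Omega> s p \<Longrightarrow> 0 < \<kappa> \<Longrightarrow> sobolev_norm \<Omega> s p u \<le> ennreal \<kappa> \<Longrightarrow>
    u \<in> sobolev_space \<Omega> t q \<and> sobolev_norm \<Omega> t q u \<le> ennreal (B * \<kappa>)"
  shows "sobolev_embedded \<Omega> (s, p) (t, q)"
  unfolding sobolev_embedded_def prod.case
proof (intro conjI subsetI exI[of _ B] ballI B)
  fix u assume u: "u \<in> sobolev_space \<Omega> s p"
  show "sobolev_norm \<Omega> t q u \<le> ennreal B * sobolev_norm \<Omega> s p u"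
    using le[OF u] sobolev_norm_finite[OF u] by (intro ennreal_homogeneous_bound B) auto
  obtain k where "sobolev_norm \<Omega> s p u = ennreal k" "0 \<le> k"
    using sobolev_norm_finite[OF u] by (cases "sobolev_norm \<Omega> s p u") auto
  \<comment> \<open>Since \<open>k\<close> may be 0, membership is taken from the bound at
    \<open>k + 1\<close>.\<close>
  then show "u \<in> sobolev_space \<Omega> t q"
    using le[OF u, of "k + 1"] by (simp add: ennreal_leI)
qed

lemma sobolev_space_measurable: "u \<in> sobolev_space UNIV s p \<Longrightarrow> u \<in> borel_measurable lebesgue"
  by (simp add: sobolev_space_def Lp_space_def lebesgue_on_UNIV_eq)

lemma sobolev_embedded_finite:
  assumes s: "0 < s" "s \<le> 1" and t: "0 \<le> t" "t < s" and r: "1 \<le> r" "r \<le> q"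
    and \<alpha>: "\<alpha> = s - real DIM('a::euclidean_space) / r" and c1: "s < 1 \<or> 0 < \<alpha>"
    and c2: "t < \<alpha> + real DIM('a) / q \<or> (t = \<alpha> + real DIM('a) / q \<and> 0 < \<alpha>)"
  shows "sobolev_embedded (UNIV :: 'a set) (s, ereal r) (t, ereal q)"
proof -
  obtain C where C: "0 < C" "\<And>v::'a \<Rightarrow> real. unit_source s r v \<Longrightarrow>
    Lp_energy q v \<le> ennreal C \<and> (0 < t \<longrightarrow> gagliardo_energy t q v \<le> ennreal C)"
    using unit_source_bounds[OF s t r \<alpha> refl c1 c2] by blast
  obtain a where a: "0 < a" "\<And>(u::'a \<Rightarrow> real) \<kappa>. u \<in> sobolev_space UNIV s (ereal r) \<Longrightarrow> 0 < \<kappa> \<Longrightarrow>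
    sobolev_norm UNIV s (ereal r) u \<le> ennreal \<kappa> \<Longrightarrow>
    \<exists>v. unit_source s r v \<and> (AE x in lebesgue. u x = a * \<kappa> * v x)"
    using unit_source_normalise[where 'a = 'a, OF s r(1)] by blast
  let ?B = "((\<bar>gagliardo_const DIM('a) t q\<bar> + 1) * C) powr (1 / q) * a"
  show ?thesis
  proof (rule sobolev_embeddedI)
    show "0 < ?B" using C(1) a(1) by (intro mult_pos_pos) (auto simp: add_nonneg_eq_0_iff)
    fix u :: "'a \<Rightarrow> real" and \<kappa> :: real
    assume u: "u \<in> sobolev_space UNIV s (ereal r)" and \<kappa>: "0 < \<kappa>" "sobolev_norm UNIV s (ereal r) u \<le> ennreal \<kappa>"
    obtain v where v: "unit_source s r v" "AE x in lebesgue. u x = a * \<kappa> * v x"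
      using a(2)[OF u \<kappa>] by blast
    have "u \<in> sobolev_space UNIV t (ereal q)"
      "sobolev_norm UNIV t (ereal q) u \<le> ennreal (((\<bar>gagliardo_const DIM('a) t q\<bar> + 1) * C) powr (1 / q) * (a * \<kappa>))"
      by (rule sobolev_target[OF sobolev_space_measurable[OF u] v(2)];
          use C v a(1) \<kappa> s t r in \<open>auto simp: unit_source_def\<close>)+
    then show "u \<in> sobolev_space UNIV t (ereal q) \<and> sobolev_norm UNIV t (ereal q) u \<le> ennreal (?B * \<kappa>)"
      by (simp add: mult.assoc)
  qed
qed

lemma sobolev_embedded_infinity:
  assumes s: "0 < s" "s \<le> 1" and r: "1 \<le> r"
    and \<alpha>: "\<alpha> = s - real DIM('a::euclidean_space) / r" "0 < \<alpha>" and t: "0 \<le> t" "t \<le> \<alpha>"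
  shows "sobolev_embedded (UNIV :: 'a set) (s, ereal r) (t, \<infinity>)"
proof -
  obtain H where H: "0 < H" "\<And>v::'a \<Rightarrow> real. unit_source s r v \<Longrightarrow> holder_ae H \<alpha> v"
    using unit_source_Morrey[OF s r \<alpha>] by blast
  obtain a where a: "0 < a" "\<And>(u::'a \<Rightarrow> real) \<kappa>. u \<in> sobolev_space UNIV s (ereal r) \<Longrightarrow> 0 < \<kappa> \<Longrightarrow>
    sobolev_norm UNIV s (ereal r) u \<le> ennreal \<kappa> \<Longrightarrow>
    \<exists>v. unit_source s r v \<and> (AE x in lebesgue. u x = a * \<kappa> * v x)"
    using unit_source_normalise[where 'a = 'a, OF s r(1)] by blast
  show ?thesis
  proof (rule sobolev_embeddedI)
    show "0 < 3 * H * a" using H(1) a(1) by simp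
    fix u :: "'a \<Rightarrow> real" and \<kappa> :: real
    assume u: "u \<in> sobolev_space UNIV s (ereal r)" and \<kappa>: "0 < \<kappa>" "sobolev_norm UNIV s (ereal r) u \<le> ennreal \<kappa>"
    obtain v where v: "unit_source s r v" "AE x in lebesgue. u x = a * \<kappa> * v x"
      using a(2)[OF u \<kappa>] by blast
    from sobolev_target_infinity[OF sobolev_space_measurable[OF u] v(2) _ H(2)[OF v(1)] _ \<alpha>(2) t] H(1) a(1) \<kappa>(1)
    show "u \<in> sobolev_space UNIV t \<infinity> \<and> sobolev_norm UNIV t \<infinity> u \<le> ennreal (3 * H * a * \<kappa>)"
      by (simp add: mult.assoc)
  qed
qed

lemma holder_embedded:
  assumes "0 < s" "0 \<le> t" "t \<le> s"
  shows "sobolev_embedded (UNIV :: 'a::euclidean_space set) (s, \<infinity>) (t, \<infinity>)"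
proof (rule sobolev_embeddedI)
  fix u :: "'a \<Rightarrow> real" and \<kappa> :: real
  assume u: "u \<in> sobolev_space UNIV s \<infinity>" and \<kappa>: "0 < \<kappa>" "sobolev_norm UNIV s \<infinity> u \<le> ennreal \<kappa>"
  obtain v where v: "holder_ae 1 s v" "AE x in lebesgue. u x = \<kappa> * v x"
    using holder_source[OF u assms(1) \<kappa>] by blast
  from sobolev_target_infinity[OF sobolev_space_measurable[OF u] v(2) \<kappa>(1) v(1) _ assms]
  show "u \<in> sobolev_space UNIV t \<infinity> \<and> sobolev_norm UNIV t \<infinity> u \<le> ennreal (3 * \<kappa>)"
    by simp
qed simp

lemma sobolev_embedded_refl: "sobolev_embedded \<Omega> a a"
  unfolding sobolev_embedded_def by (auto split: prod.split intro!: exI[of _ 1])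

section \<open>The curve of exponents\<close>

text \<open>In the coordinates formed by the order and this reciprocal the curve is a line
  segment.\<close>

definition recip :: "ereal \<Rightarrow> real" where
  "recip p = (if p = \<infinity> then 0 else 1 / real_of_ereal p)"

lemma curve_exponent_infinity: "curve_exponent \<infinity> \<infinity> \<theta> = \<infinity>"
  by (simp add: curve_exponent_def)

text \<open>\<open>k\<close> is the affine interpolation of the reciprocals. It vanishes only at
  \<open>\<theta> = 1\<close> with \<open>p' = \<infinity>\<close>, the one point with infinite
  exponent on a curve that starts at a finite one.\<close>

lemma curve_exponent_finite:
  assumes r: "1 \<le> r" and p': "ereal r \<le> p'" and \<theta>: "0 \<le> \<theta>" "\<theta> \<le> 1"
  defines "k \<equiv> (1 - \<theta>) / r + \<theta> * recip p'"
  shows "curve_exponent (ereal r) p' \<theta> = (if k = 0 then \<infinity> else ereal (1 / k))"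
proof (cases p')
  case (real b)
  have b: "r \<le> b" using p' real by simp
  have "0 < (1 - \<theta>) * b + \<theta> * r"
  proof -
    have "(1 - \<theta>) * r + \<theta> * r \<le> (1 - \<theta>) * b + \<theta> * r"
      using b \<theta> by (intro add_mono mult_left_mono) auto
    moreover have "(1 - \<theta>) * r + \<theta> * r = r" by (simp add: algebra_simps)
    ultimately show ?thesis using r by linarith
  qed
  then have pos: "0 < b + \<theta> * (r - b)" by (simp add: algebra_simps)
  have k: "k = (b + \<theta> * (r - b)) / (r * b)"
    using r b real by (simp add: k_def recip_def field_simps)
  have "0 < k" unfolding k using pos r b by (intro divide_pos_pos) auto
  then show ?thesis
    using pos r b real by (simp add: curve_exponent_def k)
next
  case PInf
  have k: "k = (1 - \<theta>) / r" using PInf by (simp add: k_def recip_def)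
  show ?thesis
    using PInf r \<theta> by (auto simp: curve_exponent_def k one_ereal_def divide_ereal_def field_simps)
qed (use p' in simp)

text \<open>\<open>D\<close> compares the values of \<open>s - n / p\<close> at the two ends of the
  curve. Since order and reciprocal exponent are affine in the parameter, their differences between
  \<open>\<theta>1\<close> and \<open>\<theta>2\<close> are those between the ends multiplied by
  \<open>\<theta>2 - \<theta>1\<close>.\<close>

lemma curve_embedded:
  assumes s: "0 < s" "s \<le> 1" and r: "1 \<le> r" "real DIM('a::euclidean_space) < s * r"
    and s': "0 \<le> s'" "s' \<le> s" and p': "ereal r \<le> p'"
    and D: "s' - real DIM('a) * recip p' \<le> s - real DIM('a) / r"
    and \<theta>: "0 \<le> \<theta>1" "\<theta>1 \<le> \<theta>2" "\<theta>2 \<le> 1"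
  shows "sobolev_embedded (UNIV :: 'a set) (exponent_curve s (ereal r) s' p' \<theta>1) (exponent_curve s (ereal r) s' p' \<theta>2)"
proof -
  let ?n = "real DIM('a)"
  define \<iota> where "\<iota> = recip p'"
  have n: "0 < ?n" by simp
  have \<iota>: "0 \<le> \<iota>" "\<iota> \<le> 1 / r"
  proof -
    show "0 \<le> \<iota>" using p' r by (cases p') (auto simp: \<iota>_def recip_def)
    show "\<iota> \<le> 1 / r" using p' r by (cases p') (auto simp: \<iota>_def recip_def intro!: divide_left_mono)
  qed
  define \<sigma> where "\<sigma> \<theta> = \<theta> * s' + (1 - \<theta>) * s" for \<theta>
  define k where "k \<theta> = (1 - \<theta>) / r + \<theta> * \<iota>" for \<theta>
  have curve: "exponent_curve s (ereal r) s' p' \<theta> = (\<sigma> \<theta>, if k \<theta> = 0 then \<infinity> else ereal (1 / k \<theta>))"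
    if "0 \<le> \<theta>" "\<theta> \<le> 1" for \<theta>
    using curve_exponent_finite[OF r(1) p' that] by (simp add: exponent_curve_def \<sigma>_def k_def \<iota>_def)
  have D': "s' - ?n * \<iota> \<le> s - ?n / r" using D by (simp add: \<iota>_def)
  show ?thesis
  proof (cases "\<theta>1 = \<theta>2 \<or> s' = s")
    case True
    then show ?thesis
    proof
      \<comment> \<open>Without loss of order there is no gain of integrability: \<open>D\<close>
        and \<open>p' \<ge> r\<close> force \<open>p' = r\<close>, so the curve is constant.\<close>
      assume eq: "s' = s"
      have "?n * (1 / r) \<le> ?n * \<iota>" using D' eq by simp
      then have "1 / r \<le> \<iota>" using n by (rule mult_left_le_imp_le)
      then have "\<iota> = 1 / r" using \<iota> by simp
      then have "k \<theta> = 1 / r" "\<sigma> \<theta> = s" for \<theta>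
        using eq by (auto simp: k_def \<sigma>_def algebra_simps diff_divide_distrib)
      then show ?thesis using curve \<theta> by (simp add: sobolev_embedded_refl)
    qed (simp add: sobolev_embedded_refl)
  next
    case False
    then have lt: "\<theta>1 < \<theta>2" "s' < s" using \<theta> s' by auto
    \<comment> \<open>\<open>\<alpha>0\<close> and \<open>d\<close> are the values of
      \<open>s - n / p\<close> at the two ends; \<open>\<alpha>\<close>, its value at
      \<open>\<theta>1\<close>, interpolates between them and can be negative only if
      \<open>d\<close> is.\<close>
    define S t \<alpha>0 d where "S = \<sigma> \<theta>1" and "t = \<sigma> \<theta>2" and "\<alpha>0 = s - ?n / r" and "d = s' - ?n * \<iota>"
    have a0: "0 < \<alpha>0" using r by (simp add: \<alpha>0_def field_simps)
    have d: "d \<le> \<alpha>0" using D' by (simp add: d_def \<alpha>0_def)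
    have St: "S - t = (\<theta>2 - \<theta>1) * (s - s')" by (simp add: S_def t_def \<sigma>_def algebra_simps)
    have "0 < S - t" unfolding St using lt by simp
    then have tS: "t < S" by simp
    have t0: "0 \<le> t" using \<theta> s s' by (simp add: t_def \<sigma>_def)
    have S1: "S = s - \<theta>1 * (s - s')" by (simp add: S_def \<sigma>_def algebra_simps)
    have S: "0 < S" "S \<le> 1" using t0 tS S1 s s' \<theta> by (auto intro: order_trans[of _ s])
    have k1: "0 < k \<theta>1"
      using \<theta> lt \<iota> r by (simp add: k_def add_pos_nonneg)
    have kd: "k \<theta>1 - k \<theta>2 = (\<theta>2 - \<theta>1) * (1 / r - \<iota>)" by (simp add: k_def algebra_simps diff_divide_distrib)
    have k21: "k \<theta>2 \<le> k \<theta>1" using kd lt \<iota> by (metis diff_ge_0_iff_ge less_imp_le mult_nonneg_nonneg)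
    have "k \<theta>1 \<le> 1"
    proof -
      have "k \<theta>1 = 1 / r - \<theta>1 * (1 / r - \<iota>)" by (simp add: k_def algebra_simps diff_divide_distrib)
      also have "\<dots> \<le> 1 / r" using \<theta> \<iota> by simp
      also have "\<dots> \<le> 1" using r by simp
      finally show ?thesis .
    qed
    then have r1: "1 \<le> 1 / k \<theta>1" using k1 by simp
    define \<alpha> where "\<alpha> = S - ?n / (1 / k \<theta>1)"
    have \<alpha>: "\<alpha> = (1 - \<theta>1) * \<alpha>0 + \<theta>1 * d"
      by (simp add: \<alpha>_def S_def \<sigma>_def k_def \<alpha>0_def d_def algebra_simps diff_divide_distrib)
    have at: "\<alpha> - (t - ?n * k \<theta>2) = (\<theta>2 - \<theta>1) * (\<alpha>0 - d)"
      unfolding \<alpha> t_def \<sigma>_def k_def \<alpha>0_def d_def by (simp add: algebra_simps diff_divide_distrib)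
    have k2: "0 \<le> k \<theta>2" using \<theta> \<iota> r by (simp add: k_def)
    have e1: "exponent_curve s (ereal r) s' p' \<theta>1 = (S, ereal (1 / k \<theta>1))"
      using curve[of \<theta>1] \<theta> k1 by (simp add: S_def)
    show ?thesis
    proof (cases "k \<theta>2 = 0")
      case True
      \<comment> \<open>The target exponent is infinite only at the end of the curve with
        \<open>p' = \<infinity>\<close>. Then \<open>d = s' \<ge> 0\<close>, and
        \<open>\<theta>1 < 1\<close> keeps \<open>\<alpha>\<close> positive.\<close>
      have "\<theta>2 = 1" "\<iota> = 0"
      proof -
        have "(1 - \<theta>2) / r = 0" "\<theta>2 * \<iota> = 0"
          using True \<theta> \<iota> r by (auto simp: k_def add_nonneg_eq_0_iff)
        then show "\<theta>2 = 1" "\<iota> = 0" using r by auto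
      qed
      then have "0 < \<alpha>"
        using a0 lt \<theta> s' unfolding \<alpha> d_def by (intro add_pos_nonneg) auto
      moreover have "t \<le> \<alpha>"
      proof -
        have "0 \<le> (\<theta>2 - \<theta>1) * (\<alpha>0 - d)" using lt d by simp
        then show ?thesis using at True by simp
      qed
      ultimately have "sobolev_embedded (UNIV :: 'a set) (S, ereal (1 / k \<theta>1)) (t, \<infinity>)"
        by (intro sobolev_embedded_infinity[OF S r1 \<alpha>_def] t0)
      then show ?thesis using e1 curve[of \<theta>2] \<theta> True by (simp add: t_def)
    next
      case False
      then have k2: "0 < k \<theta>2" using k2 by simp
      have "sobolev_embedded (UNIV :: 'a set) (S, ereal (1 / k \<theta>1)) (t, ereal (1 / k \<theta>2))"
      proof (rule sobolev_embedded_finite[OF S t0 tS r1 _ \<alpha>_def])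
        show "1 / k \<theta>1 \<le> 1 / k \<theta>2" using k1 k2 k21 by (simp add: frac_le)
        show "S < 1 \<or> 0 < \<alpha>"
        proof (cases "\<theta>1 = 0")
          case True
          then show ?thesis using a0 \<alpha> by simp
        next
          case False
          then have "0 < \<theta>1 * (s - s')" using \<theta> lt by simp
          then show ?thesis using S1 s by linarith
        qed
        show "t < \<alpha> + ?n / (1 / k \<theta>2) \<or> (t = \<alpha> + ?n / (1 / k \<theta>2) \<and> 0 < \<alpha>)"
        proof (cases "d = \<alpha>0")
          case True
          then have "\<alpha> = \<alpha>0" unfolding \<alpha> by (simp add: algebra_simps)
          then show ?thesis using a0 at True by simp
        next
          case False
          then have "0 < (\<theta>2 - \<theta>1) * (\<alpha>0 - d)" using lt d by simp
          then show ?thesis using at by simp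
        qed
      qed
      then show ?thesis using e1 curve[of \<theta>2] \<theta> False by (simp add: t_def)
    qed
  qed
qed

lemma curve_endpoints:
  assumes "1 \<le> p" "p \<le> p'"
  shows "exponent_curve s p s' p' 0 = (s, p)" "exponent_curve s p s' p' 1 = (s', p')"
proof -
  show "exponent_curve s p s' p' 0 = (s, p)"
  proof (cases p)
    case (real r)
    then show ?thesis
      using assms curve_exponent_finite[of r p' 0] by (simp add: exponent_curve_def)
  qed (use assms curve_exponent_infinity in \<open>auto simp: exponent_curve_def\<close>)
  show "exponent_curve s p s' p' 1 = (s', p')"
  proof (cases p)
    case (real r)
    then have "1 \<le> r" using assms by simp
    with real show ?thesis
      using assms curve_exponent_finite[of r p' 1] by (cases p') (auto simp: exponent_curve_def recip_def)
  qed (use assms curve_exponent_infinity in \<open>auto simp: exponent_curve_def\<close>)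
qed

text \<open>The first claim is the case of the parameters 0 and 1 in the second, so only the curve
  has to be treated.\<close>

theorem theorem1p9:
  fixes s s' :: real and p p' :: ereal
  assumes "0 < s" "s \<le> 1" "1 \<le> p" "ereal s * p > ereal (real CARD('n::finite))"
    and "(0 \<le> s' \<and> ereal s' \<le> ereal s - ereal (real CARD('n)) / p \<and> p \<le> p') \<or>
         (ereal s - ereal (real CARD('n)) / p < ereal s' \<and> s' \<le> s \<and>
          p \<le> p' \<and>
          p' \<le> ereal (real CARD('n)) * p / (ereal (real CARD('n)) - ereal (s - s') * p))"
  shows "(\<exists>C::real. C > 0 \<and>
            (\<forall>u \<in> sobolev_space (UNIV :: (real ^ 'n) set) s p.
               u \<in> sobolev_space UNIV s' p' \<and>
               sobolev_norm UNIV s' p' u \<le> ennreal C * sobolev_norm UNIV s p u)) \<and>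
         (\<forall>\<theta>\<^sub>1 \<theta>\<^sub>2. 0 \<le> \<theta>\<^sub>1 \<and> \<theta>\<^sub>1 \<le> \<theta>\<^sub>2 \<and> \<theta>\<^sub>2 \<le> 1 \<longrightarrow>
            sobolev_embedded (UNIV :: (real ^ 'n) set)
              (exponent_curve s p s' p' \<theta>\<^sub>1) (exponent_curve s p s' p' \<theta>\<^sub>2))"
proof -
  let ?n = "real CARD('n)"
  have pp': "p \<le> p'" using assms(5) by blast
  have emb: "sobolev_embedded (UNIV :: (real ^ 'n) set)
      (exponent_curve s p s' p' \<theta>\<^sub>1) (exponent_curve s p s' p' \<theta>\<^sub>2)"
    if \<theta>: "0 \<le> \<theta>\<^sub>1" "\<theta>\<^sub>1 \<le> \<theta>\<^sub>2" "\<theta>\<^sub>2 \<le> 1" for \<theta>\<^sub>1 \<theta>\<^sub>2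
  proof (cases p)
    case (real r)
    have r: "1 \<le> r" "?n < s * r" using assms(3,4) real by auto
    \<comment> \<open>Both alternatives are reduced to one inequality between the values of
      \<open>s - n / p\<close> at the ends of the curve. In the first it holds because
      \<open>recip p'\<close> is nonnegative.\<close>
    have main: "0 \<le> s' \<and> s' \<le> s \<and> s' - ?n * recip p' \<le> s - ?n / r"
      using assms(5)
    proof
      assume "0 \<le> s' \<and> ereal s' \<le> ereal s - ereal ?n / p \<and> p \<le> p'"
      then have *: "0 \<le> s'" "s' \<le> s - ?n / r" using real r by auto
      have "0 \<le> recip p'" using pp' real r by (cases p') (auto simp: recip_def)
      then have "0 \<le> ?n * recip p'" "0 \<le> ?n / r" using r by auto
      then show ?thesis using * by linarith
    next
      assume "ereal s - ereal ?n / p < ereal s' \<and> s' \<le> s \<and> p \<le> p' \<and>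
          p' \<le> ereal ?n * p / (ereal ?n - ereal (s - s') * p)"
      then have *: "s - ?n / r < s'" "s' \<le> s" "p' \<le> ereal ?n * ereal r / (ereal ?n - ereal (s - s') * ereal r)"
        using real r by auto
      \<comment> \<open>The denominator in the bound for \<open>p'\<close>, positive because
        \<open>s' > s - n / r\<close>. The bound thus reads \<open>m / r \<le> n / p'\<close>, which
        rearranges to the claim; moreover \<open>s' > s - n / r > 0\<close>.\<close>
      define m where "m = ?n - (s - s') * r"
      have m: "0 < m" using *(1) r by (simp add: m_def field_simps)
      have b: "p' \<le> ereal (?n * r / m)" using *(3) m by (simp add: m_def)
      then obtain b where b: "p' = ereal b" "r \<le> b" "b \<le> ?n * r / m"
        using pp' real by (cases p') auto
      have "m / r \<le> ?n / b"
        using b(2,3) m r by (simp add: field_simps)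
      moreover have "m / r = ?n / r - (s - s')" using r by (simp add: m_def field_simps)
      moreover have "0 < s - ?n / r" using r by (simp add: field_simps)
      ultimately show ?thesis using * b by (simp add: recip_def)
    qed
    then show ?thesis
      unfolding real using r assms(1,2) pp' real \<theta> by (intro curve_embedded) auto
  next
    case PInf
    then have p': "p' = \<infinity>" using pp' by simp
    \<comment> \<open>The second alternative is contradictory for \<open>p = \<infinity>\<close>, as
      it would require \<open>s < s' \<le> s\<close>.\<close>
    have s': "0 \<le> s'" "s' \<le> s"
      using assms(1,5) PInf by auto
    let ?\<sigma> = "\<lambda>\<theta>. \<theta> * s' + (1 - \<theta>) * s"
    have curve: "exponent_curve s p s' p' \<theta> = (?\<sigma> \<theta>, \<infinity>)" for \<theta>
      by (simp add: exponent_curve_def PInf p' curve_exponent_infinity)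
    have diff: "?\<sigma> \<theta>\<^sub>1 - ?\<sigma> \<theta>\<^sub>2 = (\<theta>\<^sub>2 - \<theta>\<^sub>1) * (s - s')" by (simp add: algebra_simps)
    show ?thesis
    proof (cases "?\<sigma> \<theta>\<^sub>1 = ?\<sigma> \<theta>\<^sub>2")
      case True
      then show ?thesis unfolding curve by (simp add: sobolev_embedded_refl)
    next
      case False
      have nn: "0 \<le> ?\<sigma> \<theta>\<^sub>2" using s' assms(1) \<theta> by simp
      moreover have le: "?\<sigma> \<theta>\<^sub>2 \<le> ?\<sigma> \<theta>\<^sub>1"
        using diff \<theta> s' by (metis diff_ge_0_iff_ge mult_nonneg_nonneg)
      ultimately show ?thesis
        unfolding curve using False by (intro holder_embedded) auto
    qed
  qed (use assms(3) in simp)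
  have "sobolev_embedded (UNIV :: (real ^ 'n) set) (s, p) (s', p')"
    using emb[of 0 1] by (simp add: curve_endpoints[OF assms(3) pp'])
  then have "\<exists>C::real. C > 0 \<and> (\<forall>u \<in> sobolev_space (UNIV :: (real ^ 'n) set) s p.
      u \<in> sobolev_space UNIV s' p' \<and> sobolev_norm UNIV s' p' u \<le> ennreal C * sobolev_norm UNIV s p u)"
    unfolding sobolev_embedded_def prod.case by blast
  then show ?thesis using emb by blast
qed

end
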